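(* Let $p$ be a fixed odd prime. There are arbitrarily large primes $q$ and $r$ such that $D(pqr)=2$, and, for each integer $h$ with $3\le h<\sqrt{p}$, there are arbitrarily large primes $q$ and $r$ such that $D(pqr)=2h$. Moreover, there are arbitrarily large primes $q$ and $r$ such that $D(pqr)=p$, and, for each integer $k$ with $1\le k<\frac{\sqrt{p}}{2}-1$, there are arbitrarily large primes $q$ and $r$ such that $D(pqr)=p-2k$.
   Context: For distinct odd primes $p,q,r$, $D(pqr)$ denotes the diameter of the cyclotomic polynomial $\Phi_{pqr}$, i.e. the difference between its largest and its smallest coefficient. "There are arbitrarily large primes $q$ and $r$ such that ..." means that for every $N$ there are primes $q,r$ with $q>N$ and $r>q>p$ having the stated property. *)

theory Defs
  imports Complex_Main "HOL-Computational_Algebra.Computational_Algebra"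
begin

definition primitive_root_of_unity :: "nat \<Rightarrow> complex \<Rightarrow> bool" where
  "primitive_root_of_unity n z \<longleftrightarrow> n > 0 \<and> z ^ n = 1 \<and> (\<forall>m. 0 < m \<and> m < n \<longrightarrow> z ^ m \<noteq> 1)"

definition complex_cyclotomic :: "nat \<Rightarrow> complex poly" where
  "complex_cyclotomic n = (\<Prod>z | primitive_root_of_unity n z. [:- z, 1:])"

(* The description is justified by the theorem of_int_cyclotomic below. *)
definition cyclotomic :: "nat \<Rightarrow> int poly" where
  "cyclotomic n = (THE P. map_poly of_int P = complex_cyclotomic n)"

(* coeffs P lists exactly the coefficients of x^0, ..., x^(degree P); coefficients beyond the
   degree do not take part in the maximum and the minimum. *)
definition diameter :: "int poly \<Rightarrow> int" where
  "diameter P = Max (set (coeffs P)) - Min (set (coeffs P))"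

definition arbitrarily_large_primes :: "nat \<Rightarrow> (nat \<Rightarrow> nat \<Rightarrow> bool) \<Rightarrow> bool" where
  "arbitrarily_large_primes p Q \<longleftrightarrow>
     (\<forall>N. \<exists>q r. prime q \<and> prime r \<and> q > N \<and> q > p \<and> r > q \<and> Q q r)"

lemma primitive_root_of_unity_unique:
  assumes "primitive_root_of_unity m z" "primitive_root_of_unity n z"
  shows   "m = n"
  using assms unfolding primitive_root_of_unity_def by (metis linorder_neqE_nat)

lemma finite_primitive_roots_of_unity [simp]: "finite {z. primitive_root_of_unity n z}"
proof (cases "n = 0")
  case False
  show ?thesis
    by (rule finite_subset[OF _ finite_roots_unity[of n]])
       (use False in \<open>auto simp: primitive_root_of_unity_def\<close>)
qed (auto simp: primitive_root_of_unity_def)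

lemma roots_of_unity_decompose:
  assumes "n > 0"
  shows   "{z::complex. z ^ n = 1} = (\<Union>d\<in>{d. d dvd n}. {z. primitive_root_of_unity d z})"
proof (intro set_eqI iffI)
  fix z :: complex assume "z \<in> {z. z ^ n = 1}"
  hence z: "z ^ n = 1" by simp
  define d where "d = (LEAST d. d > 0 \<and> z ^ d = 1)"
  have d: "d > 0 \<and> z ^ d = 1"
    unfolding d_def by (rule LeastI[of _ n]) (use assms z in auto)
  have min: "z ^ m \<noteq> 1" if "0 < m" "m < d" for m
    using that not_less_Least[of m "\<lambda>d. d > 0 \<and> z ^ d = 1"] unfolding d_def by auto
  have "z ^ n = (z ^ d) ^ (n div d) * z ^ (n mod d)"
    by (metis mult_div_mod_eq power_add power_mult)
  hence "z ^ (n mod d) = 1" using z d by simp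
  hence "n mod d = 0" using min[of "n mod d"] d by fastforce
  thus "z \<in> (\<Union>d\<in>{d. d dvd n}. {z. primitive_root_of_unity d z})"
    using d min by (auto simp: primitive_root_of_unity_def)
next
  fix z :: complex assume "z \<in> (\<Union>d\<in>{d. d dvd n}. {z. primitive_root_of_unity d z})"
  thus "z \<in> {z. z ^ n = 1}"
    by (auto simp: primitive_root_of_unity_def power_mult elim!: dvdE)
qed

lemma prod_roots_of_unity:
  assumes "n > 0"
  shows   "(\<Prod>z | z ^ n = 1. [:- z, 1:]) = (monom 1 n - 1 :: complex poly)"
proof (rule poly_eqI_degree_lead_coeff)
  let ?A = "{z::complex. z ^ n = 1}"
  have fin: "finite ?A" and card: "card ?A = n"
    using assms by (auto intro!: finite_roots_unity card_roots_unity_eq)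
  show "card ?A \<ge> n" using card by simp
  show "degree (\<Prod>z\<in>?A. [:- z, 1:]) \<le> n"
    using card by (subst degree_prod_eq_sum_degree) auto
  show "degree (monom 1 n - 1 :: complex poly) \<le> n"
    by (intro degree_diff_le) (auto simp: degree_monom_eq)
  show "poly (\<Prod>z\<in>?A. [:- z, 1:]) z = poly (monom 1 n - 1) z" if "z \<in> ?A" for z
    using that fin by (auto simp: poly_prod poly_monom intro!: bexI[of _ z])
  have "degree (\<Prod>z\<in>?A. [:- z, 1:]) = n"
    using card by (subst degree_prod_eq_sum_degree) auto
  moreover have "lead_coeff (\<Prod>z\<in>?A. [:- z, 1:]) = 1"
    by (simp add: lead_coeff_prod)
  ultimately show "coeff (\<Prod>z\<in>?A. [:- z, 1:]) n = coeff (monom 1 n - 1) n"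
    using assms by (simp add: coeff_1)
qed

lemma prod_complex_cyclotomic:
  assumes "n > 0"
  shows   "(\<Prod>d | d dvd n. complex_cyclotomic d) = monom 1 n - 1"
proof -
  have "(\<Prod>d | d dvd n. complex_cyclotomic d) =
          (\<Prod>z\<in>(\<Union>d\<in>{d. d dvd n}. {z. primitive_root_of_unity d z}). [:- z, 1:])"
    unfolding complex_cyclotomic_def
    by (subst prod.UNION_disjoint)
       (use assms in \<open>auto dest: primitive_root_of_unity_unique\<close>)
  thus ?thesis
    using assms by (simp add: prod_roots_of_unity flip: roots_of_unity_decompose)
qed

lemma lead_coeff_complex_cyclotomic [simp]: "lead_coeff (complex_cyclotomic n) = 1"
  by (simp add: complex_cyclotomic_def lead_coeff_prod)

lemma map_poly_of_int_mult:
  "map_poly of_int (P * Q) = map_poly of_int P * (map_poly of_int Q :: complex poly)"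
  by (intro poly_eqI) (simp add: coeff_map_poly coeff_mult)

lemma map_poly_of_int_prod:
  "map_poly of_int (\<Prod>x\<in>A. f x) = (\<Prod>x\<in>A. map_poly of_int (f x) :: complex poly)"
  by (induction A rule: infinite_finite_induct) (simp_all add: map_poly_of_int_mult)

lemma map_poly_of_int_inject:
  "map_poly of_int P = (map_poly of_int Q :: complex poly) \<longleftrightarrow> P = Q"
  by (auto simp: poly_eq_iff coeff_map_poly)

lemma complex_cyclotomic_integral: "\<exists>P. map_poly of_int P = complex_cyclotomic n"
proof (induction n rule: less_induct)
  case (less n)
  show ?case
  proof (cases "n = 0")
    case True
    hence "map_poly of_int 1 = complex_cyclotomic n"
      by (simp add: complex_cyclotomic_def primitive_root_of_unity_def)
    thus ?thesis by blast
  next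
    case False
    define D where "D = {d. d dvd n \<and> d \<noteq> n}"
    have D: "{d. d dvd n} = insert n D" "n \<notin> D" "finite D"
      using False by (auto simp: D_def)
    have "\<forall>d\<in>D. \<exists>P. map_poly of_int P = complex_cyclotomic d"
      using less False by (auto simp: D_def intro!: less dvd_imp_le le_neq_implies_less)
    then obtain F where F: "\<And>d. d \<in> D \<Longrightarrow> map_poly of_int (F d) = complex_cyclotomic d"
      by metis
    define Q where "Q = (\<Prod>d\<in>D. F d)"
    define Q' where "Q' = (map_poly of_int Q :: complex poly)"
    have Q': "Q' = (\<Prod>d\<in>D. complex_cyclotomic d)"
      using F by (simp add: Q'_def Q_def map_poly_of_int_prod)
    have deg: "degree Q' = degree Q"
      unfolding Q'_def by (intro degree_map_poly) auto
    have "lead_coeff Q' = 1"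
      by (simp add: Q' lead_coeff_prod)
    hence lead: "lead_coeff Q = 1" 
      by (simp only: deg) (simp add: Q'_def coeff_map_poly)
    hence "Q \<noteq> 0" by auto
    obtain A R where AR: "pseudo_divmod (monom 1 n - 1) Q = (A, R)"
      by (metis surj_pair)
    have eq: "monom 1 n - 1 = Q * A + R" and R: "R = 0 \<or> degree R < degree Q"
      using pseudo_divmod[OF \<open>Q \<noteq> 0\<close> AR] lead by simp_all
    define A' R' where "A' = (map_poly of_int A :: complex poly)"
      and "R' = (map_poly of_int R :: complex poly)"
    have "map_poly of_int (monom 1 n - 1) = Q' * A' + R'"
      unfolding eq by (simp add: Q'_def A'_def R'_def poly_eq_iff coeff_map_poly
                         flip: map_poly_of_int_mult)
    also have "map_poly of_int (monom 1 n - 1) = (monom 1 n - 1 :: complex poly)"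
      by (auto simp: poly_eq_iff coeff_map_poly coeff_1)
    also have "\<dots> = Q' * complex_cyclotomic n"
      using prod_complex_cyclotomic[of n] False D by (simp add: Q' mult.commute)
    finally have eq': "R' = Q' * (complex_cyclotomic n - A')"
      by (simp add: algebra_simps)
    have "complex_cyclotomic n = A'"
    proof (rule ccontr)
      assume neq: "complex_cyclotomic n \<noteq> A'"
      have "Q' \<noteq> 0" using \<open>lead_coeff Q' = 1\<close> by auto
      with neq eq' have "R' \<noteq> 0" and "degree R' \<ge> degree Q'"
        by (simp_all add: degree_mult_eq)
      moreover have "degree R' = degree R"
        unfolding R'_def by (intro degree_map_poly) auto
      ultimately show False
        using R deg by (auto simp: R'_def)
    qed
    thus ?thesis unfolding A'_def by metis
  qed
qed

theorem of_int_cyclotomic: "map_poly of_int (cyclotomic n) = complex_cyclotomic n"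
proof -
  have "\<exists>!P. map_poly of_int P = complex_cyclotomic n"
    using complex_cyclotomic_integral[of n] by (metis map_poly_of_int_inject)
  from theI'[OF this] show ?thesis
    by (simp add: cyclotomic_def)
qed

end

theory Submission
  imports Defs "HOL-Analysis.Analysis" "HOL-Number_Theory.Number_Theory" "HOL-Real_Asymp.Real_Asymp"
begin

text \<open>
  Let \<open>\<sigma> < p/2\<close> and let \<open>s \<ge> 1\<close> be an inverse of \<open>\<sigma>\<close> modulo \<open>p\<close>. By Dirichlet's theorem there
  are arbitrarily large primes \<open>q \<equiv> s (mod p)\<close> and \<open>r\<close> with \<open>r s \<equiv> -1 (mod p q)\<close>. Comparing
  \<open>\<Phi>\<^bsub>pqr\<^esub>(x) (1 - x\<^bsup>pq\<^esup>) = \<Phi>\<^bsub>pq\<^esub>(x\<^bsup>r\<^esup>) (1 + x + \<dots> + x\<^bsup>p-1\<^esup>) (1 - x\<^bsup>q\<^esup>)\<close> coefficientwise writes each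
  coefficient of \<open>\<Phi>\<^bsub>pqr\<^esub>\<close> as a truncated difference of two sums of \<open>p\<close> coefficients of
  \<open>\<Phi>\<^bsub>pq\<^esub>\<close>, each taken along an arithmetic progression with difference \<open>s\<close>. These sums telescope. With
  \<open>s\<^sub>0 = s mod p\<close>, and if \<open>s \<ge> 2\<close>, the largest coefficient is \<open>\<sigma> + 1\<close> or \<open>\<sigma>\<close> according to whether
  \<open>s\<^sub>0 > \<sigma>\<close>, and the smallest is \<open>-\<sigma> - 1\<close> or \<open>-\<sigma>\<close> according to whether \<open>s\<^sub>0 < p - \<sigma>\<close>; for \<open>s = 1\<close>
  they are \<open>1\<close> and \<open>-1\<close>. The choices \<open>\<sigma> = 1\<close>, \<open>\<sigma> = h - 1\<close>, \<open>\<sigma> = (p - 1)/2\<close> and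
  \<open>\<sigma> = (p - 1)/2 - k\<close> give the four claims; the bounds on \<open>h\<close> and \<open>k\<close> decide the position of \<open>s\<^sub>0\<close>.
\<close>

hide_const (open) up_ring.monom up_ring.coeff Elementary_Metric_Spaces.diameter

section \<open>Dirichlet characters\<close>

text \<open>The parameter \<open>s\<close> is an integer and not merely a residue: it is the step of
  the progressions, and \<open>s * p < q\<close> keeps a progression of \<open>p\<close> terms
  shorter than a block of length \<open>q\<close>, so that it crosses at most one block boundary.
  Away from a boundary the telescoped sum has modulus at most \<open>\<sigma>\<close>; a crossing
  can lower it by 1 but never raise it, so a single window reaches from \<open>-\<sigma> - 1\<close>
  to \<open>\<sigma>\<close>. The value \<open>\<sigma> + 1\<close> appears because the two windows
  enter with opposite signs and either may have the smaller block number. These numbers differ by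
  \<open>s\<close> modulo \<open>p\<close>, whence the comparison of \<open>s mod p\<close> with
  \<open>\<sigma>\<close> and \<open>p - \<sigma>\<close>. The bounds on \<open>h\<close> and
  \<open>k\<close> make a certain nonzero multiple of \<open>p\<close> built from
  \<open>s * \<sigma> - 1\<close> too small to exist. Dirichlet's theorem is applied to a prime
  modulus and to a product of two primes; its proof stays on the real axis and asks of the character
  group only that it is finite and separates residues.\<close>

definition dirichlet_char :: "nat \<Rightarrow> (nat \<Rightarrow> complex) \<Rightarrow> bool" where
  "dirichlet_char m \<omega> \<longleftrightarrow>
     (\<forall>a b. \<omega> (a * b) = \<omega> a * \<omega> b) \<and> (\<forall>a. \<omega> (a mod m) = \<omega> a) \<and>
     \<omega> 1 = 1 \<and> (\<forall>a. \<omega> a = 0 \<longleftrightarrow> \<not> coprime a m)"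

definition principal_char :: "nat \<Rightarrow> nat \<Rightarrow> complex" where
  "principal_char m a = (if coprime a m then 1 else 0)"

lemma dirichlet_charD:
  assumes "dirichlet_char m \<omega>"
  shows "\<omega> (a * b) = \<omega> a * \<omega> b" "\<omega> (a mod m) = \<omega> a" "\<omega> 1 = 1" "\<omega> (Suc 0) = 1"
    "\<omega> a = 0 \<longleftrightarrow> \<not> coprime a m" "\<omega> (a ^ k) = \<omega> a ^ k"
proof -
  show *: "\<omega> (a * b) = \<omega> a * \<omega> b" "\<omega> (a mod m) = \<omega> a" "\<omega> 1 = 1" "\<omega> (Suc 0) = 1"
    "\<omega> a = 0 \<longleftrightarrow> \<not> coprime a m" for a b
    using assms unfolding dirichlet_char_def by auto
  show "\<omega> (a ^ k) = \<omega> a ^ k"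
    by (induction k) (simp_all add: *)
qed

lemma dirichlet_char_cong:
  assumes "dirichlet_char m \<omega>" "[a = b] (mod m)"
  shows "\<omega> a = \<omega> b"
  using dirichlet_charD(2)[OF assms(1)] assms(2) unfolding cong_def by metis

lemma dirichlet_char_power_totient:
  assumes "dirichlet_char m \<omega>" "coprime a m"
  shows "\<omega> a ^ totient m = 1"
  using dirichlet_char_cong[OF assms(1) euler_theorem[OF assms(2)]] dirichlet_charD[OF assms(1)]
  by metis

lemma norm_dirichlet_char:
  assumes "dirichlet_char m \<omega>" "m > 0"
  shows "norm (\<omega> a) = (if coprime a m then 1 else 0)"
proof (cases "coprime a m")
  case True
  have "norm (\<omega> a) ^ totient m = 1 ^ totient m"
    using dirichlet_char_power_totient[OF assms(1) True] by (metis norm_one norm_power power_one)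
  hence "norm (\<omega> a) = 1"
    using assms(2) by (subst (asm) power_eq_iff_eq_base) auto
  thus ?thesis using True by simp
qed (use dirichlet_charD(5)[OF assms(1)] in auto)

lemma norm_dirichlet_char_le:
  assumes "dirichlet_char m \<omega>" "m > 0"
  shows "norm (\<omega> a) \<le> 1"
  using norm_dirichlet_char[OF assms] by auto

lemma dirichlet_char_principal:
  assumes "m > 0"
  shows "dirichlet_char m (principal_char m)"
  unfolding dirichlet_char_def principal_char_def
proof (intro conjI allI)
  fix a show "(if coprime (a mod m) m then 1 else 0) = (if coprime a m then 1 else (0::complex))"
    using coprime_mod_left_iff[of m a] assms by simp
qed auto

lemma dirichlet_char_mult:
  assumes "dirichlet_char m \<omega>" "dirichlet_char m \<psi>"
  shows "dirichlet_char m (\<lambda>a. \<omega> a * \<psi> a)"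
  unfolding dirichlet_char_def
  by (simp add: dirichlet_charD[OF assms(1)] dirichlet_charD[OF assms(2)])

lemma bij_betw_mult_mod:
  assumes "coprime b m" "m > (0::nat)"
  shows "bij_betw (\<lambda>a. a * b mod m) {..<m} {..<m}"
proof -
  have inj: "inj_on (\<lambda>a. a * b mod m) {..<m}"
  proof (rule inj_onI)
    fix x y assume xy: "x \<in> {..<m}" "y \<in> {..<m}" "x * b mod m = y * b mod m"
    hence "[x * b = y * b] (mod m)" by (simp add: cong_def)
    hence "[x = y] (mod m)" using cong_mult_rcancel_nat[OF assms(1)] by blast
    thus "x = y" using xy(1,2) by (simp add: cong_def)
  qed
  moreover have "(\<lambda>a. a * b mod m) ` {..<m} = {..<m}"
    using assms(2) by (intro endo_inj_surj[OF _ _ inj]) auto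
  ultimately show ?thesis unfolding bij_betw_def by blast
qed

lemma sum_dirichlet_char_eq_0:
  assumes "dirichlet_char m \<omega>" "m > 0" "\<omega> \<noteq> principal_char m"
  shows "(\<Sum>a<m. \<omega> a) = 0"
proof -
  obtain b where b: "\<omega> b \<noteq> principal_char m b" using assms(3) by auto
  hence cop: "coprime b m" "\<omega> b \<noteq> 1"
    using dirichlet_charD(5)[OF assms(1)] unfolding principal_char_def by (auto split: if_splits)
  have "(\<Sum>a<m. \<omega> a) = (\<Sum>a<m. \<omega> (a * b mod m))"
    using sum.reindex_bij_betw[OF bij_betw_mult_mod[OF cop(1) assms(2)], of \<omega>] by simp
  also have "\<dots> = (\<Sum>a<m. \<omega> a) * \<omega> b"
    by (simp add: dirichlet_charD(1,2)[OF assms(1)] sum_distrib_right)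
  finally show ?thesis using cop(2) by simp
qed

text \<open>Each full period contributes 0, so only the last \<open>N mod m\<close> terms count. The
  bound, independent of \<open>N\<close>, is what summation by parts requires.\<close>

lemma norm_sum_dirichlet_char_le:
  assumes "dirichlet_char m \<omega>" "m > 0" "\<omega> \<noteq> principal_char m"
  shows "norm (\<Sum>a<N. \<omega> a) \<le> real m"
proof -
  have "norm (\<Sum>a<N. \<omega> a) \<le> real (N mod m)"
  proof (induction N rule: less_induct)
    case (less N)
    show ?case
    proof (cases "N < m")
      case True
      have "norm (\<Sum>a<N. \<omega> a) \<le> (\<Sum>a<N. 1)"
        by (rule order_trans[OF norm_sum], rule sum_mono)
           (use norm_dirichlet_char_le[OF assms(1,2)] in auto)
      thus ?thesis using True by simp
    next
      case False
      define K where "K = N - m"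
      have N: "N = m + K" using False K_def by simp
      have "(\<Sum>a<N. \<omega> a) = (\<Sum>a<m. \<omega> a) + (\<Sum>a<K. \<omega> (m + a))"
        unfolding N by (induction K) (simp_all add: add.assoc)
      also have "(\<Sum>a<m. \<omega> a) = 0" by (rule sum_dirichlet_char_eq_0[OF assms])
      also have "(\<Sum>a<K. \<omega> (m + a)) = (\<Sum>a<K. \<omega> a)"
        by (intro sum.cong refl dirichlet_char_cong[OF assms(1)]) (simp add: cong_def)
      finally show ?thesis using less[of K] assms(2) N by simp
    qed
  qed
  also have "\<dots> \<le> real m" using assms(2) by (simp add: less_imp_le)
  finally show ?thesis .
qed

lemma finite_dirichlet_chars:
  assumes "m > 0"
  shows "finite {\<omega>. dirichlet_char m \<omega>}"
proof -
  let ?Z = "insert 0 {z::complex. z ^ totient m = 1}"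
  have "finite ?Z" using finite_roots_unity[of "totient m"] assms by (simp add: Suc_leI)
  hence fin: "finite ({..<m} \<rightarrow>\<^sub>E ?Z)" by (intro finite_PiE) auto
  show ?thesis
  proof (rule inj_on_finite[OF _ _ fin])
    show "inj_on (\<lambda>\<omega>. restrict \<omega> {..<m}) {\<omega>. dirichlet_char m \<omega>}"
    proof (rule inj_onI, rule ext)
      fix \<omega> \<psi> a
      assume "\<omega> \<in> {\<omega>. dirichlet_char m \<omega>}" "\<psi> \<in> {\<omega>. dirichlet_char m \<omega>}"
        and eq: "restrict \<omega> {..<m} = restrict \<psi> {..<m}"
      hence "\<omega> a = \<omega> (a mod m)" "\<psi> a = \<psi> (a mod m)" by (simp_all add: dirichlet_charD(2))
      moreover have "\<omega> (a mod m) = \<psi> (a mod m)"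
        using fun_cong[OF eq, of "a mod m"] assms by simp
      ultimately show "\<omega> a = \<psi> a" by simp
    qed
    show "(\<lambda>\<omega>. restrict \<omega> {..<m}) ` {\<omega>. dirichlet_char m \<omega>} \<subseteq> {..<m} \<rightarrow>\<^sub>E ?Z"
    proof (intro image_subsetI)
      fix \<omega> assume "\<omega> \<in> {\<omega>. dirichlet_char m \<omega>}"
      hence "\<omega> a \<in> ?Z" for a
        using dirichlet_char_power_totient[of m \<omega> a] dirichlet_charD(5)[of m \<omega> a]
        by (cases "coprime a m") auto
      thus "restrict \<omega> {..<m} \<in> {..<m} \<rightarrow>\<^sub>E ?Z" by auto
    qed
  qed
qed

text \<open>This is what orthogonality needs to know about the unit group. As a property of the
  modulus it can be obtained from a primitive root for primes and passed on to coprime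
  products.\<close>

definition separated_modulus :: "nat \<Rightarrow> bool" where
  "separated_modulus m \<longleftrightarrow>
     (\<forall>a. coprime a m \<longrightarrow> \<not> [a = 1] (mod m) \<longrightarrow> (\<exists>\<omega>. dirichlet_char m \<omega> \<and> \<omega> a \<noteq> 1))"

lemma sum_dirichlet_chars_eq_0:
  assumes "separated_modulus m" "m > 0" "coprime a m" "\<not> [a = 1] (mod m)"
  shows "(\<Sum>\<omega> | dirichlet_char m \<omega>. \<omega> a) = 0"
proof -
  let ?X = "{\<omega>. dirichlet_char m \<omega>}"
  obtain \<psi> where psi: "dirichlet_char m \<psi>" "\<psi> a \<noteq> 1"
    using assms unfolding separated_modulus_def by blast
  have inj: "inj_on (\<lambda>\<omega> b. \<psi> b * \<omega> b) ?X"
  proof (rule inj_onI, rule ext)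
    fix \<omega> \<omega>' b assume *: "\<omega> \<in> ?X" "\<omega>' \<in> ?X" "(\<lambda>b. \<psi> b * \<omega> b) = (\<lambda>b. \<psi> b * \<omega>' b)"
    from fun_cong[OF *(3), of b] show "\<omega> b = \<omega>' b"
      using *(1,2) dirichlet_charD(5)[OF psi(1), of b] dirichlet_charD(5)[of m \<omega> b]
        dirichlet_charD(5)[of m \<omega>' b] by auto
  qed
  have "(\<lambda>\<omega> b. \<psi> b * \<omega> b) ` ?X = ?X"
    by (rule endo_inj_surj) (use finite_dirichlet_chars[OF assms(2)] inj
        dirichlet_char_mult[OF psi(1)] in auto)
  hence "(\<Sum>\<omega>\<in>?X. \<omega> a) = (\<Sum>\<omega>\<in>?X. \<psi> a * \<omega> a)"
    using sum.reindex[OF inj, of "\<lambda>\<omega>. \<omega> a"] by (simp add: o_def)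
  also have "\<dots> = \<psi> a * (\<Sum>\<omega>\<in>?X. \<omega> a)" by (simp add: sum_distrib_left)
  finally show ?thesis using psi(2) by simp
qed

text \<open>The factor \<open>\<omega> b\<close>, with \<open>b\<close> inverse to \<open>a\<close>,
  stands in for the complex conjugate of \<open>\<omega> a\<close>; the sum becomes one over
  \<open>\<omega> (b * n)\<close>.\<close>

lemma dirichlet_char_orthogonality:
  assumes "separated_modulus m" "m > 0" "coprime b m" "[b * a = 1] (mod m)"
  shows "(\<Sum>\<omega> | dirichlet_char m \<omega>. \<omega> b * \<omega> n) =
           (if [n = a] (mod m) then of_nat (card {\<omega>. dirichlet_char m \<omega>}) else 0)"
proof -
  have eq: "[n = a] (mod m) \<longleftrightarrow> [b * n = 1] (mod m)"
    using cong_mult_lcancel_nat[OF assms(3), of n a] assms(4) cong_trans cong_sym by blast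
  show ?thesis
  proof (cases "coprime n m")
    case True
    have "(\<Sum>\<omega> | dirichlet_char m \<omega>. \<omega> b * \<omega> n) = (\<Sum>\<omega> | dirichlet_char m \<omega>. \<omega> (b * n))"
      by (intro sum.cong) (auto simp: dirichlet_charD(1))
    also have "\<dots> = (if [b * n = 1] (mod m) then of_nat (card {\<omega>. dirichlet_char m \<omega>}) else 0)"
    proof (cases "[b * n = 1] (mod m)")
      case c: True
      have "(\<Sum>\<omega> | dirichlet_char m \<omega>. \<omega> (b * n)) = (\<Sum>\<omega> | dirichlet_char m \<omega>. 1)"
        by (intro sum.cong refl) (metis c dirichlet_charD(3) dirichlet_char_cong mem_Collect_eq)
      thus ?thesis using c by simp
    next
      case False
      show ?thesis
        using sum_dirichlet_chars_eq_0[OF assms(1,2) _ False] True assms(3) False by simp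
    qed
    finally show ?thesis using eq by simp
  next
    case False
    hence "\<not> [n = a] (mod m)"
      using assms(4) unfolding eq
      using cong_imp_coprime[of 1 "b * n" m] cong_sym[of "b * n" 1 m] by auto
    moreover have "(\<Sum>\<omega> | dirichlet_char m \<omega>. \<omega> b * \<omega> n) = 0"
      using False dirichlet_charD(5)[of m _ n] by (intro sum.neutral) auto
    ultimately show ?thesis by simp
  qed
qed

text \<open>Discrete logarithms to a primitive root \<open>g\<close> turn the unit group into the
  integers modulo \<open>totient p\<close>. Sending \<open>g\<close> to a primitive root of unity of
  that order gives one faithful character, which separates all residues at once.\<close>

lemma separated_modulus_prime:
  assumes "prime p"
  shows "separated_modulus p"
  unfolding separated_modulus_def
proof (intro allI impI)
  fix a assume a: "coprime a p" "\<not> [a = 1] (mod p)"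
  have p1: "p > 1" using assms prime_gt_1_nat by blast
  obtain g where g: "residue_primroot p g"
    using prime_primitive_root_exists[OF p1 assms] by metis
  define k where "k = totient p"
  have k0: "k > 0" using p1 by (simp add: k_def)
  have cg: "coprime g p" and og: "ord p g = k"
    using g unfolding residue_primroot_def k_def by (auto simp: coprime_commute)
  have gen: "\<exists>i. [g ^ i = b] (mod p)" if "coprime b p" for b
  proof -
    have "b mod p \<in> totatives p"
      unfolding in_totatives_iff
    proof (intro conjI)
      show "0 < b mod p"
      proof (rule ccontr)
        assume "\<not> 0 < b mod p"
        hence "p dvd b" by auto
        hence "p dvd 1" using coprime_common_divisor[OF that, of p] by simp
        thus False using p1 by simp
      qed
      show "b mod p \<le> p" using p1 by (simp add: less_imp_le)
      show "coprime (b mod p) p" using that p1 by simp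
    qed
    also have "totatives p = (\<lambda>i. g ^ i mod p) ` {..<totient p}"
      using residue_primroot_is_generator[OF p1 g] by (simp add: bij_betw_def)
    finally show ?thesis by (auto simp: cong_def)
  qed
  have ord_cong: "[g ^ i = g ^ j] (mod p) \<longleftrightarrow> [i = j] (mod k)" for i j
    using order_divides_expdiff[OF cg[unfolded coprime_commute[of g]], of i j] og by simp
  define ind where "ind b = (SOME i. [g ^ i = b] (mod p))" for b
  have ind: "[g ^ ind b = b] (mod p)" if "coprime b p" for b
    unfolding ind_def using gen[OF that] by (rule someI_ex)
  define w where "w = cis (2 * pi / k)"
  have w_pow: "w ^ i = 1 \<longleftrightarrow> k dvd i" for i
  proof -
    have "w ^ i = cis (2 * pi * i / k)" by (simp add: w_def Complex.DeMoivre mult_ac)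
    also have "\<dots> = 1 \<longleftrightarrow> k dvd i"
    proof
      assume "cis (2 * pi * i / k) = 1"
      hence "exp (of_real (2 * pi * i / k) * \<i>) = 1" by (simp add: cis_conv_exp mult.commute)
      then obtain n :: int where "2 * pi * i / k = of_int (2 * n) * pi"
        using exp_eq_1 by force
      hence "real i = of_int n * real k" using k0 by (simp add: field_simps)
      hence "int i = n * int k" by (metis of_int_eq_iff of_int_mult of_int_of_nat_eq)
      thus "k dvd i" by (metis dvd_triv_right int_dvd_int_iff)
    next
      assume "k dvd i"
      then obtain n where "i = k * n" by blast
      hence "2 * pi * i / k = of_int (int n) * (2 * pi)" using k0 by simp
      thus "cis (2 * pi * i / k) = 1" by (metis Ints_of_int cis_multiple_2pi mult.commute)
    qed
    finally show ?thesis .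
  qed
  have w0: "w \<noteq> 0" by (simp add: w_def)
  have w_cong: "w ^ i = w ^ j" if "[i = j] (mod k)" for i j
  proof -
    have *: "w ^ i = w ^ j" if "i \<le> j" "[i = j] (mod k)" for i j
    proof -
      have "k dvd j - i" using that by (metis cong_altdef_nat cong_sym)
      hence "w ^ (j - i) = 1" using w_pow by simp
      moreover have "w ^ j = w ^ i * w ^ (j - i)" using that(1) by (simp flip: power_add)
      ultimately show ?thesis by simp
    qed
    show ?thesis using *[of i j] *[of j i] that cong_sym by (metis nat_le_linear)
  qed
  define \<omega> where "\<omega> b = (if coprime b p then w ^ ind b else 0)" for b
  have chi_g: "\<omega> b = w ^ i" if "[g ^ i = b] (mod p)" for b i
  proof -
    have cb: "coprime b p"
      using that cg by (metis cong_imp_coprime coprime_power_left_iff)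
    have "[g ^ ind b = g ^ i] (mod p)" using ind[OF cb] that cong_sym cong_trans by blast
    thus ?thesis using ord_cong w_cong cb by (simp add: \<omega>_def)
  qed
  have "dirichlet_char p \<omega>"
    unfolding dirichlet_char_def
  proof (intro conjI allI)
    show "\<omega> (a * b) = \<omega> a * \<omega> b" for a b
    proof (cases "coprime a p \<and> coprime b p")
      case True
      hence "[g ^ (ind a + ind b) = a * b] (mod p)"
        by (simp add: power_add cong_mult ind)
      from chi_g[OF this] True show ?thesis by (simp add: \<omega>_def power_add)
    qed (auto simp: \<omega>_def)
    show "\<omega> (a mod p) = \<omega> a" for a
    proof (cases "coprime a p")
      case True
      have "[g ^ ind a = a mod p] (mod p)" using ind[OF True] by (simp add: cong_def)
      from chi_g[OF this] True show ?thesis by (simp add: \<omega>_def)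
    next
      case False
      thus ?thesis using p1 by (simp add: \<omega>_def)
    qed
    show "\<omega> 1 = 1" using chi_g[of 0 1] by simp
    show "\<omega> a = 0 \<longleftrightarrow> \<not> coprime a p" for a using w0 by (simp add: \<omega>_def)
  qed
  moreover have "\<omega> a \<noteq> 1"
  proof
    assume "\<omega> a = 1"
    hence "k dvd ind a" using a(1) w_pow by (simp add: \<omega>_def)
    hence "[ind a = 0] (mod k)" by (simp add: cong_0_iff)
    hence "[g ^ ind a = g ^ 0] (mod p)" using ord_cong by blast
    thus False using ind[OF a(1)] a(2) by (simp add: cong_def)
  qed
  ultimately show "\<exists>\<omega>. dirichlet_char p \<omega> \<and> \<omega> a \<noteq> 1" by blast
qed

text \<open>A residue other than 1 modulo \<open>m * n\<close> differs from 1 modulo one of the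
  factors. A character of that factor is inflated by \<open>principal_char\<close> of the other,
  which supplies the zeros at arguments sharing a factor with it.\<close>

lemma separated_modulus_mult:
  assumes "separated_modulus m" "separated_modulus n" "coprime m n" "m > 0" "n > 0"
  shows "separated_modulus (m * n)"
  unfolding separated_modulus_def
proof (intro allI impI)
  fix a assume a: "coprime a (m * n)" "\<not> [a = 1] (mod m * n)"
  have *: "dirichlet_char (k * l) (\<lambda>b. \<omega> b * principal_char l b)"
    if "dirichlet_char k \<omega>" "k > 0" "l > 0" for k l \<omega>
  proof -
    have "\<omega> (b mod (k * l)) = \<omega> b" for b
      by (rule dirichlet_char_cong[OF that(1)]) (simp add: cong_def mod_mult2_eq)
    moreover have "principal_char l (b mod (k * l)) = principal_char l b" for b
      by (rule dirichlet_char_cong[OF dirichlet_char_principal[OF that(3)]])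
         (simp add: cong_def mod_mult2_eq mult.commute[of k])
    ultimately show ?thesis
      using that(1) dirichlet_char_principal[OF that(3)] unfolding dirichlet_char_def
      by simp
  qed
  have "\<not> [a = 1] (mod m) \<or> \<not> [a = 1] (mod n)"
    using a(2) assms(3) coprime_cong_mult_nat by blast
  thus "\<exists>\<omega>. dirichlet_char (m * n) \<omega> \<and> \<omega> a \<noteq> 1"
  proof
    assume "\<not> [a = 1] (mod m)"
    then obtain \<omega> where "dirichlet_char m \<omega>" "\<omega> a \<noteq> 1"
      using assms(1) a(1) unfolding separated_modulus_def by auto
    thus ?thesis using *[of m \<omega> n] assms a(1) by (intro exI) (auto simp: principal_char_def)
  next
    assume "\<not> [a = 1] (mod n)"
    then obtain \<omega> where "dirichlet_char n \<omega>" "\<omega> a \<noteq> 1"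
      using assms(2) a(1) unfolding separated_modulus_def by auto
    thus ?thesis using *[of n \<omega> m] assms a(1)
      by (intro exI[of _ "\<lambda>b. \<omega> b * principal_char m b"]) (auto simp: principal_char_def mult.commute)
  qed
qed

section \<open>L-series on the real axis\<close>

text \<open>Summation by parts. The separate majorant \<open>u\<close> of the differences lets the
  same bound serve the increment of an L-series at 1, its derivative and a Lambert series.\<close>

lemma abel_bound:
  fixes c :: "nat \<Rightarrow> complex" and f u :: "nat \<Rightarrow> real"
  assumes B: "\<And>N. norm (\<Sum>n<N. c n) \<le> B" and u: "\<And>n. \<bar>f n - f (Suc n)\<bar> \<le> u n"
    and "summable u" and lim: "f \<longlonglongrightarrow> 0"
  shows "summable (\<lambda>n. c n * of_real (f n))" "norm (\<Sum>n. c n * of_real (f n)) \<le> B * suminf u"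
proof -
  define S where "S N = (\<Sum>n<N. c n)" for N
  define g where "g n = S (Suc n) * of_real (f n - f (Suc n))" for n
  have "0 \<le> norm (\<Sum>n<0. c n)" by simp
  also have "\<dots> \<le> B" by (rule B)
  finally have B0: "0 \<le> B" .
  have part: "(\<Sum>n<N. c n * of_real (f n)) = S N * of_real (f N) + (\<Sum>n<N. g n)" for N
    by (induction N) (simp_all add: S_def g_def algebra_simps)
  have "norm (g n) \<le> B * u n" for n
    unfolding g_def norm_mult S_def using B[of "Suc n"] u[of n] B0
    by (intro mult_mono) (auto simp del: sum.lessThan_Suc of_real_diff simp: norm_of_real)
  moreover have sBu: "summable (\<lambda>n. B * u n)" by (intro summable_mult assms)
  ultimately have sg: "summable (\<lambda>n. norm (g n))"
    by (intro summable_comparison_test'[OF sBu, of 0]) auto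
  have "(\<lambda>N. S N * of_real (f N)) \<longlonglongrightarrow> 0"
  proof (rule Lim_null_comparison)
    show "\<forall>\<^sub>F N in sequentially. norm (S N * of_real (f N)) \<le> B * \<bar>f N\<bar>"
      using B by (intro always_eventually allI) (auto simp: norm_mult S_def intro: mult_right_mono)
    show "(\<lambda>N. B * \<bar>f N\<bar>) \<longlonglongrightarrow> 0" using tendsto_mult_right_zero[OF tendsto_rabs_zero[OF lim]] .
  qed
  moreover have "(\<lambda>N. \<Sum>n<N. g n) \<longlonglongrightarrow> suminf g"
    using summable_norm_cancel[OF sg] by (rule summable_LIMSEQ)
  ultimately have "(\<lambda>N. \<Sum>n<N. c n * of_real (f n)) \<longlonglongrightarrow> 0 + suminf g"
    unfolding part by (rule tendsto_add)
  hence sums: "(\<lambda>n. c n * of_real (f n)) sums suminf g" by (simp add: sums_def)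
  thus "summable (\<lambda>n. c n * of_real (f n))" by (rule sums_summable)
  have "norm (suminf g) \<le> (\<Sum>n. norm (g n))" by (rule summable_norm[OF sg])
  also have "\<dots> \<le> (\<Sum>n. B * u n)"
    by (rule suminf_le) fact+
  also have "\<dots> = B * suminf u" by (rule suminf_mult[OF assms(3)])
  finally show "norm (\<Sum>n. c n * of_real (f n)) \<le> B * suminf u" by (simp add: sums_unique[OF sums])
qed

text \<open>Rearrangement of an absolutely convergent double series along the hyperbolas
  \<open>n = d * k\<close>. It serves both the Dirichlet product and the Lambert series.\<close>

lemma has_sum_divisors:
  fixes g :: "nat \<Rightarrow> nat \<Rightarrow> 'a :: banach"
  assumes "(\<lambda>(d, k). norm (g d k)) summable_on ({1..} \<times> {1..})"
    and "\<And>d. d \<ge> 1 \<Longrightarrow> ((\<lambda>k. g d k) has_sum r d) {1..}" and "(r has_sum S) {1..}"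
  shows "((\<lambda>n. \<Sum>d | d dvd n. g d (n div d)) has_sum S) {1..}"
proof -
  have "(\<lambda>(d, k). g d k) summable_on ({1..} \<times> {1..})"
  proof (rule abs_summable_summable)
    have "(\<lambda>x. norm (case x of (d, k) \<Rightarrow> g d k)) = (\<lambda>(d, k). norm (g d k))" by auto
    thus "(\<lambda>x. norm (case x of (d, k) \<Rightarrow> g d k)) summable_on {1..} \<times> {1..}"
      using assms(1) by simp
  qed
  hence "((\<lambda>(d, k). g d k) has_sum S) ({1..} \<times> {1..})"
    using assms(2,3) by (intro has_sum_SigmaI[where g = r]) auto
  also have "?this \<longleftrightarrow> ((\<lambda>(n, d). g d (n div d)) has_sum S) (Sigma {1..} (\<lambda>n. {d. d dvd n}))"
    by (rule has_sum_reindex_bij_witness[of _ "\<lambda>(n, d). (d, n div d)" "\<lambda>(d, k). (d * k, d)"])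
       (auto elim!: dvdE simp: Suc_le_eq)
  finally show ?thesis
    by (rule has_sum_SigmaD) (auto intro!: has_sum_finiteI)
qed

definition L_series :: "(nat \<Rightarrow> complex) \<Rightarrow> real \<Rightarrow> complex" where
  "L_series \<omega> s = (\<Sum>n. \<omega> n * of_real (real n powr (- s)))"

definition L_ln_series :: "(nat \<Rightarrow> complex) \<Rightarrow> real \<Rightarrow> complex" where
  "L_ln_series \<omega> s = (\<Sum>n. \<omega> n * of_real (ln (real n) * real n powr (- s)))"

text \<open>The negative logarithmic derivative, defined by its own series so that it makes sense
  before \<open>L_series\<close> is known to be nonzero.\<close>

definition L_mangoldt_series :: "(nat \<Rightarrow> complex) \<Rightarrow> real \<Rightarrow> complex" where
  "L_mangoldt_series \<omega> s = (\<Sum>n. \<omega> n * of_real (mangoldt n * real n powr (- s)))"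

section \<open>Convergence, product and derivative for \<open>s > 1\<close>\<close>

lemma summable_powr: "s > 1 \<Longrightarrow> summable (\<lambda>n. real n powr (- s))"
  by (simp add: summable_real_powr_iff)

lemma summable_ln_powr:
  assumes "s > 1"
  shows "summable (\<lambda>n. ln (real n) * real n powr (- s))"
proof (rule summable_comparison_test'[of "\<lambda>n. (2 / (s - 1)) * real n powr (- ((s + 1) / 2))" 0])
  show "summable (\<lambda>n. (2 / (s - 1)) * real n powr (- ((s + 1) / 2)))"
    using assms by (intro summable_mult summable_powr) auto
  fix n :: nat
  show "norm (ln (real n) * real n powr (- s)) \<le> (2 / (s - 1)) * real n powr (- ((s + 1) / 2))"
  proof (cases "n = 0")
    case False
    define d where "d = (s - 1) / 2"
    have d: "d > 0" "- s = - d + (- ((s + 1) / 2))" using assms by (auto simp: d_def field_simps)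
    have "ln (real n) \<le> real n powr d / d" using False d by (intro ln_powr_bound) auto
    hence "ln (real n) * real n powr (- s) \<le> real n powr d / d * real n powr (- s)"
      by (intro mult_right_mono) auto
    also have "\<dots> = real n powr (d + (- s)) / d" by (simp only: powr_add times_divide_eq_left)
    also have "d + (- s) = - ((s + 1) / 2)" using d by simp
    finally show ?thesis using False by (simp add: d_def abs_mult mult.commute[of 2])
  qed auto
qed

lemma summable_mangoldt_powr:
  assumes "s > 1"
  shows "summable (\<lambda>n. mangoldt n * real n powr (- s))"
proof (rule summable_comparison_test'[OF summable_ln_powr[OF assms], of 0])
  fix n :: nat
  show "norm (mangoldt n * real n powr (- s)) \<le> ln (real n) * real n powr (- s)"
    using mangoldt_le[of n] mangoldt_nonneg[of n]
    by (cases "n = 0") (auto simp: abs_mult intro!: mult_right_mono)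
qed

lemma summable_norm_bounded_mult:
  fixes \<omega> :: "nat \<Rightarrow> complex" and f :: "nat \<Rightarrow> real"
  assumes "\<And>n. norm (\<omega> n) \<le> 1" "summable f" "\<And>n. f n \<ge> 0"
  shows "summable (\<lambda>n. norm (\<omega> n * of_real (f n)))" "summable (\<lambda>n. \<omega> n * of_real (f n))"
proof -
  show *: "summable (\<lambda>n. norm (\<omega> n * of_real (f n)))"
    by (rule summable_comparison_test'[OF assms(2), of 0])
       (use assms in \<open>auto simp: norm_mult intro: mult_left_le_one_le\<close>)
  show "summable (\<lambda>n. \<omega> n * of_real (f n))" by (rule summable_norm_cancel[OF *])
qed

lemma ln_powr_nonneg: "ln (real n) * real n powr (- s) \<ge> 0"
  by (cases "n = 0") auto

lemma mangoldt_powr_nonneg: "mangoldt n * real n powr (- s) \<ge> (0::real)"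
  by (simp add: mangoldt_nonneg)

lemma has_sum_atLeast_1:
  fixes f :: "nat \<Rightarrow> 'a :: banach"
  assumes "summable (\<lambda>n. norm (f n))" "f 0 = 0"
  shows "(f has_sum suminf f) {1..}"
proof -
  have "f sums suminf f" using summable_norm_cancel[OF assms(1)] by (rule summable_sums)
  hence "(f has_sum suminf f) UNIV" by (rule norm_summable_imp_has_sum[OF assms(1)])
  also have "?this \<longleftrightarrow> ?thesis"
  proof (rule has_sum_cong_neutral)
    fix x :: nat assume "x \<in> UNIV - {1..}"
    hence "x = 0" by auto
    thus "f x = 0" using assms(2) by simp
  qed auto
  finally show ?thesis .
qed

lemma summable_on_product:
  fixes f g :: "nat \<Rightarrow> real"
  assumes "summable f" "summable g" "\<And>n. f n \<ge> 0" "\<And>n. g n \<ge> 0"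
  shows "(\<lambda>(d, k). f d * g k) summable_on (A \<times> B)"
proof -
  have "(g has_sum suminf g) UNIV" "f summable_on UNIV"
    using assms sums_nonneg_imp_has_sum summable_sums summable_nonneg_imp_summable_on by blast+
  hence "(\<lambda>(d, k). f d * g k) summable_on (UNIV \<times> UNIV)"
    using assms(3,4)
    by (intro summable_on_SigmaI[where g = "\<lambda>d. f d * suminf g"])
       (auto intro!: has_sum_cmult_right summable_on_cmult_left)
  thus ?thesis by (rule summable_on_subset) auto
qed

text \<open>Complete multiplicativity lets \<open>\<omega> n\<close> be pulled out of the
  convolution, and the divisor sum of \<open>mangoldt\<close> is \<open>ln\<close>. This is the
  identity \<open>L * (- L' / L) = - L'\<close>.\<close>

lemma L_series_mult_mangoldt:
  assumes mult: "\<And>a b. \<omega> (a * b) = \<omega> a * \<omega> b" and le: "\<And>n. norm (\<omega> n) \<le> 1" and "s > 1"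
  shows "L_series \<omega> s * L_mangoldt_series \<omega> s = L_ln_series \<omega> s"
proof -
  define f where "f n = \<omega> n * of_real (real n powr (- s))" for n
  define g where "g n = \<omega> n * of_real (mangoldt n * real n powr (- s))" for n
  define h where "h n = \<omega> n * of_real (ln (real n) * real n powr (- s))" for n
  have sf: "summable (\<lambda>n. norm (f n))" and sg: "summable (\<lambda>n. norm (g n))"
    and sh: "summable (\<lambda>n. norm (h n))"
    unfolding f_def g_def h_def
    using summable_powr summable_mangoldt_powr summable_ln_powr ln_powr_nonneg mangoldt_powr_nonneg
    by (intro summable_norm_bounded_mult(1) le assms(3); force simp: assms(3))+
  have z: "f 0 = 0" "g 0 = 0" "h 0 = 0" by (auto simp: f_def g_def h_def)
  have "((\<lambda>n. \<Sum>d | d dvd n. g d * f (n div d)) has_sum (suminf g * suminf f)) {1..}"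
  proof (rule has_sum_divisors[where r = "\<lambda>d. g d * suminf f"])
    show "(\<lambda>(d, k). norm (g d * f k)) summable_on {1..} \<times> {1..}"
      unfolding norm_mult by (rule summable_on_product) (use sf sg in auto)
    show "((\<lambda>k. g d * f k) has_sum g d * suminf f) {1..}" for d
      by (intro has_sum_cmult_right has_sum_atLeast_1 sf z)
    show "((\<lambda>d. g d * suminf f) has_sum suminf g * suminf f) {1..}"
      by (intro has_sum_cmult_left has_sum_atLeast_1 sg z)
  qed
  also have "?this \<longleftrightarrow> (h has_sum (suminf g * suminf f)) {1..}"
  proof (rule has_sum_cong)
    fix n :: nat assume n: "n \<in> {1..}"
    have "(\<Sum>d | d dvd n. g d * f (n div d)) =
            (\<Sum>d | d dvd n. \<omega> n * of_real (real n powr (- s)) * of_real (mangoldt d))"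
    proof (rule sum.cong, rule refl)
      fix d assume "d \<in> {d. d dvd n}"
      then obtain k where k: "n = d * k" by auto
      hence "d > 0" "k > 0" using n by (auto intro!: Nat.gr0I)
      thus "g d * f (n div d) = \<omega> n * of_real (real n powr (- s)) * of_real (mangoldt d)"
        by (simp add: f_def g_def k mult powr_mult)
    qed
    also have "\<dots> = \<omega> n * of_real (real n powr (- s)) * of_real (\<Sum>d | d dvd n. mangoldt d)"
      by (simp add: sum_distrib_left)
    also have "(\<Sum>d | d dvd n. mangoldt d) = ln (real n)"
      using n mangoldt_sum[of n, where ?'a = real] by simp
    finally show "(\<Sum>d | d dvd n. g d * f (n div d)) = h n" by (simp add: h_def)
  qed
  finally have "suminf g * suminf f = suminf h"
    using has_sum_atLeast_1[OF sh z(3)] has_sum_unique by blast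
  thus ?thesis
    unfolding L_series_def L_mangoldt_series_def L_ln_series_def f_def g_def h_def
    by (simp only: mult.commute)
qed

text \<open>Termwise differentiation takes place in the complex half-plane
  \<open>Re z \<ge> d\<close>, with \<open>d\<close> midway between 1 and \<open>s\<close>: then
  \<open>s\<close> is interior and the derived series still has a summable majorant.\<close>

lemma L_series_has_derivative:
  assumes le: "\<And>n. norm (\<omega> n) \<le> 1" and s: "s > 1"
  shows "(L_series \<omega> has_vector_derivative - L_ln_series \<omega> s) (at s)"
proof -
  define d where "d = (s + 1) / 2"
  have d: "d > 1" "d < s" using s by (auto simp: d_def)
  define S where "S = {z::complex. Re z \<ge> d}"
  define f where "f n z = (if n = 0 then 0 else \<omega> n * exp (- (z * of_real (ln (real n)))))"
    for n and z :: complex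
  define f' where "f' n z = - of_real (ln (real n)) * f n z" for n and z :: complex
  have f_real: "f n (of_real x) = \<omega> n * of_real (real n powr (- x))" for n x
    by (simp add: f_def powr_def flip: exp_of_real)
  have f'_real: "f' n (of_real x) = - (\<omega> n * of_real (ln (real n) * real n powr (- x)))" for n x
    by (simp add: f'_def f_real)
  have convex: "convex S" unfolding S_def by (rule convex_halfspace_Re_ge)
  have deriv: "(f n has_field_derivative f' n z) (at z within S)" for n z
    unfolding f'_def f_def
    by (cases "n = 0") (auto intro!: derivative_eq_intros simp: mult_ac)
  have "uniformly_convergent_on S (\<lambda>n x. \<Sum>i<n. f' i x)"
  proof (rule Weierstrass_m_test')
    show "summable (\<lambda>n. ln (real n) * real n powr (- d))" by (rule summable_ln_powr[OF d(1)])
    fix n z assume z: "z \<in> S"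
    show "norm (f' n z) \<le> ln (real n) * real n powr (- d)"
    proof (cases "n = 0")
      case False
      have "norm (f' n z) = norm (\<omega> n) * (ln (real n) * real n powr (- Re z))"
        using False by (simp add: f'_def f_def norm_mult powr_def)
      also have "\<dots> \<le> 1 * (ln (real n) * real n powr (- d))"
        using z False le[of n] unfolding S_def
        by (intro mult_mono powr_mono) auto
      finally show ?thesis by simp
    qed (auto simp: f'_def f_def)
  qed
  moreover have "of_real s \<in> S" using d by (simp add: S_def)
  moreover have "summable (\<lambda>n. f n (of_real s))"
    unfolding f_real by (rule summable_norm_bounded_mult(2)[OF le summable_powr[OF s]]) auto
  moreover have "of_real s \<in> interior S"
    by (rule interiorI[OF open_halfspace_Re_gt[of d]]) (use d in \<open>auto simp: S_def\<close>)
  ultimately have "((\<lambda>x. \<Sum>n. f n x) has_field_derivative (\<Sum>n. f' n (of_real s))) (at (of_real s))"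
    by (intro has_field_derivative_series'(2)[OF convex deriv]) auto
  from has_vector_derivative_real_field[OF this]
  have "((\<lambda>x. \<Sum>n. f n (of_real x)) has_vector_derivative (\<Sum>n. f' n (of_real s))) (at s)" .
  moreover have "(\<Sum>n. f' n (of_real s)) = - L_ln_series \<omega> s"
    unfolding f'_real L_ln_series_def
    by (rule suminf_minus, rule summable_norm_bounded_mult(2)[OF le summable_ln_powr[OF s]])
       (rule ln_powr_nonneg)
  ultimately show ?thesis unfolding f_real L_series_def[abs_def] by simp
qed

text \<open>The integral test by induction: the mean value theorem for \<open>x powr (1 - s)\<close>
  on \<open>[N, N + 1]\<close> bounds the new term by the increment of the right-hand side.\<close>

lemma sum_powr_le:
  assumes "s > 1" "N \<ge> 1"
  shows "(\<Sum>n<Suc N. real n powr (- s)) \<le> 1 + (1 - real N powr (1 - s)) / (s - 1)"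
  using assms(2)
proof (induction N rule: nat_induct_at_least)
  case (Suc N)
  have "\<exists>z>real N. z < real N + 1 \<and>
          (real N + 1) powr (1 - s) - real N powr (1 - s) =
            (real N + 1 - real N) * ((1 - s) * z powr (1 - s - 1))"
    using Suc(1) by (intro MVT2) (auto intro!: derivative_eq_intros)
  then obtain z where z: "z > real N" "z < real N + 1"
    "(real N + 1) powr (1 - s) - real N powr (1 - s) = (1 - s) * z powr (- s)" by auto
  have "(real N + 1) powr (- s) \<le> z powr (- s)"
    using z assms(1) Suc(1) by (intro powr_mono2') auto
  also have "z powr (- s) = (real N powr (1 - s) - (real N + 1) powr (1 - s)) / (s - 1)"
    using z(3) assms(1) by (simp add: field_simps)
  finally have "(real N + 1) powr (- s) \<le> \<dots>" .
  with Suc.IH show ?case by (simp add: diff_divide_distrib add_ac)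
qed (use assms(1) in auto)

lemma suminf_powr_le:
  assumes "s > 1"
  shows "(\<Sum>n. real n powr (- s)) \<le> 1 + 1 / (s - 1)"
proof (rule suminf_le_const[OF summable_powr[OF assms]])
  fix N
  show "(\<Sum>n<N. real n powr (- s)) \<le> 1 + 1 / (s - 1)"
  proof (cases "N \<ge> 2")
    case True
    then obtain M where M: "N = Suc M" "M \<ge> 1" by (cases N) auto
    have "(1 - real M powr (1 - s)) / (s - 1) \<le> 1 / (s - 1)"
      using assms by (intro divide_right_mono) auto
    thus ?thesis using sum_powr_le[OF assms M(2)] unfolding M(1) by linarith
  next
    case False
    hence "N = 0 \<or> N = 1" by auto
    thus ?thesis using assms by auto
  qed
qed

lemma norm_L_series_le:
  assumes le: "\<And>n. norm (\<omega> n) \<le> 1" and s: "s > 1"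
  shows "norm (L_series \<omega> s) \<le> 1 + 1 / (s - 1)"
proof -
  have "norm (L_series \<omega> s) \<le> (\<Sum>n. norm (\<omega> n * of_real (real n powr (- s))))"
    unfolding L_series_def
    by (rule summable_norm, rule summable_norm_bounded_mult(1)[OF le summable_powr[OF s]]) auto
  also have "\<dots> \<le> (\<Sum>n. real n powr (- s))"
    by (intro suminf_le summable_norm_bounded_mult(1)[OF le summable_powr[OF s]] summable_powr[OF s])
       (use le in \<open>auto simp: norm_mult intro: mult_left_le_one_le\<close>)
  also have "\<dots> \<le> 1 + 1 / (s - 1)" by (rule suminf_powr_le[OF s])
  finally show ?thesis .
qed

text \<open>The term at \<open>n = 1\<close> is 1 and the others add up to at most 1/2. The point 3
  is the reference for the monotonicity argument below; at 2 the estimate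
  \<open>suminf_powr_le\<close> would only bound them by 1.\<close>

lemma L_series_3_nonzero:
  assumes le: "\<And>n. norm (\<omega> n) \<le> 1" and "\<omega> 1 = 1"
  shows "L_series \<omega> 3 \<noteq> 0"
proof
  assume 0: "L_series \<omega> 3 = 0"
  define \<psi> where "\<psi> n = (if n = 1 then 0 else \<omega> n)" for n
  have sm: "summable (\<lambda>n. \<psi> n * of_real (real n powr (-3)))"
    by (rule summable_norm_bounded_mult(2)[OF _ summable_powr]) (use le in \<open>auto simp: \<psi>_def\<close>)
  have s1: "(\<lambda>n. if n = 1 then 1 else 0) sums (1::complex)"
    using sums_If_finite_set'[of "\<lambda>_. 0" 0 "{1::nat}" 1 "\<lambda>_. 1::complex"] by simp
  have "(\<lambda>n. \<psi> n * of_real (real n powr (-3)) + (if n = 1 then 1 else 0)) sums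
          (L_series \<psi> 3 + 1)"
    unfolding L_series_def by (intro sums_add summable_sums sm s1)
  also have "(\<lambda>n. \<psi> n * of_real (real n powr (-3)) + (if n = 1 then 1 else 0)) =
               (\<lambda>n. \<omega> n * of_real (real n powr (-3)))"
    using assms(2) by (auto simp: \<psi>_def fun_eq_iff)
  finally have "L_series \<omega> 3 = L_series \<psi> 3 + 1"
    unfolding L_series_def by (rule sums_unique[symmetric])
  hence one: "norm (L_series \<psi> 3) = 1" using 0 by (simp add: eq_neg_iff_add_eq_0[symmetric])
  have a: "(\<lambda>n. real n powr (-3) - (if n = 1 then 1 else 0)) sums ((\<Sum>n. real n powr (-3)) - 1)"
    using sums_If_finite_set'[of "\<lambda>_. 0" 0 "{1::nat}" 1 "\<lambda>_. 1::real"]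
    by (intro sums_diff summable_sums summable_powr) auto
  have "norm (L_series \<psi> 3) \<le> (\<Sum>n. norm (\<psi> n * of_real (real n powr (-3))))"
    unfolding L_series_def
    by (rule summable_norm, rule summable_norm_bounded_mult(1)[OF _ summable_powr])
       (use le in \<open>auto simp: \<psi>_def\<close>)
  also have "\<dots> \<le> (\<Sum>n. real n powr (-3) - (if n = 1 then 1 else 0))"
    by (intro suminf_le summable_norm_bounded_mult(1)[OF _ summable_powr] sums_summable[OF a])
       (use le in \<open>auto simp: \<psi>_def norm_mult intro: mult_left_le_one_le\<close>)
  also have "\<dots> = (\<Sum>n. real n powr (-3)) - 1" by (rule sums_unique[OF a, symmetric])
  also have "\<dots> \<le> 1 / 2" using suminf_powr_le[of 3] by simp
  finally show False using one by simp
qed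

text \<open>The mean value theorem bounds the differences of \<open>ln n * n powr (- s)\<close> and
  of \<open>1 / n - n powr (- s)\<close> by one summable sequence, the latter with an extra factor
  \<open>s - 1\<close>. Abel summation gives a bounded derivative and a Lipschitz estimate at
  1.\<close>

lemma L_series_bounds:
  assumes B: "\<And>N. norm (\<Sum>n<N. \<omega> n) \<le> B" and le: "\<And>n. norm (\<omega> n) \<le> 1"
  obtains C where "C > 0"
    "\<And>s. s \<in> {1<..2} \<Longrightarrow> norm (L_series \<omega> s - L_series \<omega> 1) \<le> C * (s - 1)"
    "\<And>s. s \<in> {1<..2} \<Longrightarrow> norm (L_ln_series \<omega> s) \<le> C"
    "summable (\<lambda>n. \<omega> n * of_real (1 / real n))"
    "L_series \<omega> 1 = (\<Sum>n. \<omega> n * of_real (1 / real n))"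
proof -
  \<comment> \<open>The value at \<open>n = 0\<close> is 0 by division by zero; the differences to
    be bounded there are 0 as well.\<close>
  define u where "u n = (1 + 2 * ln (real n + 1)) / real n ^ 2" for n
  have u: "summable u"
  proof (rule summable_comparison_test_bigo)
    show "summable (\<lambda>n. norm (real n powr (- (3 / 2))))"
      using summable_powr[of "3/2"] by simp
    show "u \<in> O(\<lambda>n. real n powr (- (3 / 2)))" unfolding u_def by real_asymp
  qed
  have u_nonneg: "u n \<ge> 0" for n unfolding u_def by simp
  have ln_bound: "\<bar>ln (real n) * real n powr (- s) - ln (real (Suc n)) * real (Suc n) powr (- s)\<bar> \<le> u n"
    if s: "s \<in> {1..2}" for s n
  proof (cases "n = 0")
    case False
    let ?f = "\<lambda>x. ln x * x powr (- s)"
    have "\<exists>z>real n. z < real n + 1 \<and> ?f (real n + 1) - ?f (real n) =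
            (real n + 1 - real n) * (z powr (- s - 1) * (1 - s * ln z))"
      using False by (intro MVT2)
        (auto intro!: derivative_eq_intros simp: powr_diff field_simps)
    then obtain z where z: "z > real n" "z < real n + 1"
      "?f (real n + 1) - ?f (real n) = z powr (- s - 1) * (1 - s * ln z)" by auto
    have n1: "real n \<ge> 1" using False by simp
    have "\<bar>?f (real n + 1) - ?f (real n)\<bar> = z powr (- s - 1) * \<bar>1 - s * ln z\<bar>"
      unfolding z(3) by (simp add: abs_mult)
    also have "\<dots> \<le> real n powr (- 2) * (1 + 2 * ln (real n + 1))"
    proof (rule mult_mono)
      have "z powr (- s - 1) \<le> z powr (-2)" using z(1) n1 s by (intro powr_mono) auto
      also have "\<dots> \<le> real n powr (-2)" using z(1) n1 by (intro powr_mono2') auto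
      finally show "z powr (- s - 1) \<le> real n powr (-2)" .
      have "ln z \<ge> 0" "ln z \<le> ln (real n + 1)" using z n1 by auto
      moreover have "s * ln z \<le> 2 * ln z" using s \<open>ln z \<ge> 0\<close> by (intro mult_right_mono) auto
      moreover have "s * ln z \<ge> 0" using s \<open>ln z \<ge> 0\<close> by simp
      ultimately show "\<bar>1 - s * ln z\<bar> \<le> 1 + 2 * ln (real n + 1)" by linarith
    qed auto
    also have "real n powr (-2) = 1 / real n ^ 2"
      using n1 by (simp add: powr_minus divide_inverse)
    finally show ?thesis by (simp add: u_def abs_minus_commute add.commute)
  qed (auto simp: u_def)
  have pow_bound: "\<bar>(1 / real n - real n powr (- s)) - (1 / real (Suc n) - real (Suc n) powr (- s))\<bar>
                     \<le> (s - 1) * u n" if s: "s \<in> {1<..2}" for s n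
  proof (cases "n = 0")
    case False
    let ?f = "\<lambda>x. 1 / x - x powr (- s)"
    have "\<exists>z>real n. z < real n + 1 \<and> ?f (real n + 1) - ?f (real n) =
            (real n + 1 - real n) * (z powr (-2) * (s * z powr (1 - s) - 1))"
      using False by (intro MVT2)
        (auto intro!: derivative_eq_intros simp: powr_diff powr_minus field_simps power2_eq_square)
    then obtain z where z: "z > real n" "z < real n + 1"
      "?f (real n + 1) - ?f (real n) = z powr (-2) * (s * z powr (1 - s) - 1)" by auto
    have n1: "real n \<ge> 1" using False by simp
    have "\<bar>?f (real n + 1) - ?f (real n)\<bar> = z powr (-2) * \<bar>s * z powr (1 - s) - 1\<bar>"
      unfolding z(3) by (simp add: abs_mult)
    also have "\<dots> \<le> real n powr (- 2) * ((s - 1) * (1 + 2 * ln (real n + 1)))"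
    proof (rule mult_mono)
      show "z powr (-2) \<le> real n powr (-2)" using z(1) n1 by (intro powr_mono2') auto
      have l: "ln z \<ge> 0" "ln z \<le> ln (real n + 1)" using z n1 by auto
      have p1: "z powr (1 - s) \<le> 1" using powr_mono[of "1 - s" 0 z] z n1 s by auto
      have p2: "z powr (1 - s) \<ge> 1 + (1 - s) * ln z"
        using exp_ge_add_one_self[of "(1 - s) * ln z"] z n1 by (simp add: powr_def)
      define P where "P = z powr (1 - s)"
      have "(s - 1) * P \<le> (s - 1) * 1"
        using p1 s unfolding P_def by (intro mult_left_mono) auto
      moreover have "0 \<le> (s - 1) * P" using s by (simp add: P_def)
      moreover have "1 - P \<ge> 0" "1 - P \<le> (s - 1) * ln z"
        using p1 p2 unfolding P_def by (auto simp: algebra_simps)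
      moreover have "s * P - 1 = (s - 1) * P - (1 - P)" by (simp add: algebra_simps)
      moreover have "(s - 1) * ln z \<le> (s - 1) * (2 * ln (real n + 1))"
        using l s by (intro mult_left_mono) auto
      ultimately have "\<bar>s * P - 1\<bar> \<le> (s - 1) * 1 + (s - 1) * (2 * ln (real n + 1))" by linarith
      thus "\<bar>s * z powr (1 - s) - 1\<bar> \<le> (s - 1) * (1 + 2 * ln (real n + 1))"
        by (simp add: P_def distrib_left)
    qed auto
    also have "real n powr (-2) = 1 / real n ^ 2"
      using n1 by (simp add: powr_minus divide_inverse)
    finally show ?thesis by (simp add: u_def abs_minus_commute add.commute)
  qed (auto simp: u_def)
  have lim0: "(\<lambda>n. 1 / real n - real n powr (- s)) \<longlonglongrightarrow> 0" if "s > 1" for s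
    using that by real_asymp
  have lim1: "(\<lambda>n. ln (real n) * real n powr (- s)) \<longlonglongrightarrow> 0" if "s > 1" for s
    using that by real_asymp
  have smul: "summable (\<lambda>n. (s - 1) * u n)" for s by (intro summable_mult u)
  note D = abel_bound[OF B pow_bound smul lim0]
  have L1: "L_series \<omega> 1 = (\<Sum>n. \<omega> n * of_real (1 / real n))"
    unfolding L_series_def by (intro suminf_cong) (simp add: powr_minus divide_inverse)
  have sums_s: "summable (\<lambda>n. \<omega> n * of_real (real n powr (- s)))" if "s > 1" for s
    by (rule summable_norm_bounded_mult(2)[OF le summable_powr[OF that]]) auto
  \<comment> \<open>Convergence at \<open>s = 1\<close> is deduced from the absolutely convergent
    series at \<open>s = 2\<close> by adding the difference.\<close>
  have "summable (\<lambda>n. \<omega> n * of_real (1 / real n - real n powr (- 2)) + \<omega> n * of_real (real n powr (- 2)))"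
    by (intro summable_add D(1) sums_s) auto
  hence s1: "summable (\<lambda>n. \<omega> n * of_real (1 / real n))" by (simp add: algebra_simps)
  define C where "C = B * suminf u + 1"
  have B0: "B \<ge> 0" using order_trans[OF norm_ge_zero B] by blast
  have C: "C > 0" "B * suminf u \<le> C"
    using B0 suminf_nonneg[OF u u_nonneg] unfolding C_def by (auto intro: add_nonneg_pos)
  show thesis
  proof (rule that[OF C(1) _ _ s1 L1])
    fix s :: real assume s: "s \<in> {1<..2}"
    have "(\<Sum>n. \<omega> n * of_real (1 / real n - real n powr (- s))) =
            (\<Sum>n. \<omega> n * of_real (1 / real n)) - (\<Sum>n. \<omega> n * of_real (real n powr (- s)))"
      using s sums_s[of s] by (subst suminf_diff[OF s1]) (auto simp: algebra_simps)
    also have "\<dots> = - (L_series \<omega> s - L_series \<omega> 1)" by (simp add: L1 L_series_def)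
    finally have "norm (L_series \<omega> s - L_series \<omega> 1) =
        norm (\<Sum>n. \<omega> n * of_real (1 / real n - real n powr (- s)))"
      by (simp only: norm_minus_cancel)
    also have "\<dots> \<le> B * (\<Sum>n. (s - 1) * u n)" by (rule D(2)) (use s in auto)
    also have "\<dots> = (B * suminf u) * (s - 1)" by (subst suminf_mult[OF u]) (simp add: mult_ac)
    also have "\<dots> \<le> C * (s - 1)" using s C(2) by (intro mult_right_mono) auto
    finally show "norm (L_series \<omega> s - L_series \<omega> 1) \<le> C * (s - 1)" .
    have "norm (L_ln_series \<omega> s) \<le> B * suminf u"
      unfolding L_ln_series_def
      by (rule abel_bound(2)[OF B ln_bound u lim1]) (use s in auto)
    thus "norm (L_ln_series \<omega> s) \<le> C" using C(2) by linarith
  qed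
qed

section \<open>Non-vanishing at \<open>s = 1\<close> when the square of the character is not
  principal\<close>

lemma Re_3_4_1_nonneg:
  assumes "norm z = 1"
  shows "3 + 4 * Re z + Re (z * z) \<ge> 0"
proof -
  have "(Re z)\<^sup>2 + (Im z)\<^sup>2 = 1" using assms by (simp add: cmod_def)
  hence "3 + 4 * Re z + Re (z * z) = 2 * (Re z + 1)\<^sup>2"
    by (simp add: power2_eq_square algebra_simps)
  thus ?thesis by simp
qed

text \<open>Since \<open>3 + 4 cos t + cos 2t \<ge> 0\<close>, the modulus of
  \<open>L(s, \<omega>\<^sub>0)\<^sup>3 L(s, \<omega>)\<^sup>4 L(s, \<omega>\<^sup>2)\<close> decreases for \<open>s > 1\<close>; a zero of
  \<open>L(s, \<omega>)\<close> at \<open>s = 1\<close> would beat the triple pole of the first factor and force the limit \<open>0\<close>.\<close>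

lemma L_series_1_nonzero_complex:
  assumes chr: "dirichlet_char m \<omega>" and m: "m > 1"
    and np: "\<omega> \<noteq> principal_char m" and np2: "(\<lambda>a. \<omega> a * \<omega> a) \<noteq> principal_char m"
  shows "L_series \<omega> 1 \<noteq> 0"
proof
  assume L0: "L_series \<omega> 1 = 0"
  define \<omega>0 where "\<omega>0 = principal_char m"
  define \<omega>2 where "\<omega>2 a = \<omega> a * \<omega> a" for a
  have m0: "m > 0" using m by simp
  have chr0: "dirichlet_char m \<omega>0" unfolding \<omega>0_def by (rule dirichlet_char_principal[OF m0])
  have chr2: "dirichlet_char m \<omega>2" unfolding \<omega>2_def by (rule dirichlet_char_mult[OF chr chr])
  note le = norm_dirichlet_char_le[OF _ m0]
  define F where "F s = L_series \<omega>0 s ^ 3 * L_series \<omega> s ^ 4 * L_series \<omega>2 s" for s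
  define g where "g s = 3 * L_mangoldt_series \<omega>0 s + 4 * L_mangoldt_series \<omega> s + L_mangoldt_series \<omega>2 s" for s
  have deriv: "(F has_vector_derivative - (F s * g s)) (at s)" if s: "s > 1" for s
  proof -
    have *: "(L_series \<psi> has_vector_derivative - (L_series \<psi> s * L_mangoldt_series \<psi> s)) (at s)"
      if "dirichlet_char m \<psi>" for \<psi>
      using L_series_has_derivative[of \<psi>, OF le[OF that] s]
        L_series_mult_mangoldt[of \<psi>, OF dirichlet_charD(1)[OF that] le[OF that] s] by simp
    have pow: "((\<lambda>x. h x ^ n) has_vector_derivative of_nat n * h s ^ (n - 1) * h') (at s)"
      if "(h has_vector_derivative h') (at s)" for h :: "real \<Rightarrow> complex" and h' n
    proof (induction n)
      case (Suc n)
      show ?case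
        using has_vector_derivative_mult[OF that Suc]
        by (cases n) (simp_all add: algebra_simps)
    qed auto
    show ?thesis
      unfolding F_def[abs_def]
      by (rule has_vector_derivative_eq_rhs[OF has_vector_derivative_mult[OF
            has_vector_derivative_mult[OF pow[OF *[OF chr0], of 3] pow[OF *[OF chr], of 4]] *[OF chr2]]])
         (simp add: g_def F_def algebra_simps eval_nat_numeral)
  qed
  have g: "Re (g s) \<ge> 0" if s: "s > 1" for s
  proof -
    have sm: "summable (\<lambda>n. \<psi> n * of_real (mangoldt n * real n powr (- s)))"
      if "dirichlet_char m \<psi>" for \<psi>
      by (rule summable_norm_bounded_mult(2)[OF le[OF that] summable_mangoldt_powr[OF s] mangoldt_powr_nonneg])
    define t where "t n = 3 * (\<omega>0 n * of_real (mangoldt n * real n powr (- s))) +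
                      4 * (\<omega> n * of_real (mangoldt n * real n powr (- s))) +
                      \<omega>2 n * of_real (mangoldt n * real n powr (- s))" for n
    have "t sums g s"
      unfolding t_def[abs_def] g_def L_mangoldt_series_def
      by (intro sums_add sums_mult summable_sums sm chr chr0 chr2)
    hence sums: "(\<lambda>n. Re (t n)) sums Re (g s)" by (rule sums_Re)
    have nonneg: "Re (t n) \<ge> 0" for n
    proof -
      have "t n = (3 * \<omega>0 n + 4 * \<omega> n + \<omega>2 n) * of_real (mangoldt n * real n powr (- s))"
        by (simp add: t_def algebra_simps)
      hence "Re (t n) = Re (3 * \<omega>0 n + 4 * \<omega> n + \<omega>2 n) * (mangoldt n * real n powr (- s))"
        by (simp only: Re_complex_of_real Im_complex_of_real times_complex.sel)
      moreover have "Re (3 * \<omega>0 n + 4 * \<omega> n + \<omega>2 n) \<ge> 0"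
      proof (cases "coprime n m")
        case True
        thus ?thesis using Re_3_4_1_nonneg[of "\<omega> n"] norm_dirichlet_char[OF chr m0, of n]
          by (simp add: \<omega>0_def principal_char_def \<omega>2_def)
      next
        case False
        thus ?thesis using dirichlet_charD(5)[OF chr, of n]
          by (simp add: \<omega>0_def principal_char_def \<omega>2_def)
      qed
      ultimately show ?thesis using mangoldt_powr_nonneg[of n s] by simp
    qed
    show ?thesis using sums_le[OF nonneg sums_zero sums] .
  qed
  \<comment> \<open>The derivative of \<open>norm (F s) ^ 2\<close> is
    \<open>- 2 * norm (F s) ^ 2 * Re (g s)\<close>; working with the square avoids logarithms and
    possible zeros of \<open>F\<close>.\<close>
  have mono: "norm (F 3) ^ 2 \<le> norm (F s) ^ 2" if s: "s \<in> {1<..2}" for s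
  proof (rule DERIV_nonpos_imp_nonincreasing[of s 3 "\<lambda>s. norm (F s) ^ 2"])
    show "s \<le> 3" using s by simp
    fix x assume x: "s \<le> x" "x \<le> 3"
    have "((\<lambda>s. F s \<bullet> F s) has_vector_derivative (F x \<bullet> - (F x * g x) + - (F x * g x) \<bullet> F x)) (at x)"
      using deriv[of x] x s by (intro bounded_bilinear.has_vector_derivative[OF bounded_bilinear_inner]) auto
    moreover have "F x \<bullet> - (F x * g x) + - (F x * g x) \<bullet> F x = - 2 * norm (F x) ^ 2 * Re (g x)"
      unfolding cmod_power2 by (simp add: inner_complex_def power2_eq_square algebra_simps)
    moreover have "\<dots> \<le> 0" using g[of x] x s by (simp add: mult_nonneg_nonneg)
    ultimately show "\<exists>y. ((\<lambda>s. norm (F s) ^ 2) has_real_derivative y) (at x) \<and> y \<le> 0"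
      unfolding power2_norm_eq_inner has_real_derivative_iff_has_vector_derivative by auto
  qed
  have F3: "F 3 \<noteq> 0"
    using L_series_3_nonzero[of \<omega>0] L_series_3_nonzero[of \<omega>] L_series_3_nonzero[of \<omega>2]
      le[OF chr] le[OF chr0] le[OF chr2] dirichlet_charD(3)[OF chr] dirichlet_charD(3)[OF chr0]
      dirichlet_charD(3)[OF chr2] by (simp add: F_def)
  obtain C where C: "C > 0" "\<And>s. s \<in> {1<..2} \<Longrightarrow> norm (L_series \<omega> s - L_series \<omega> 1) \<le> C * (s - 1)"
    using L_series_bounds[of \<omega>, OF norm_sum_dirichlet_char_le[OF chr m0 np] le[OF chr]] by metis
  obtain C2 where C2: "C2 > 0" "\<And>s. s \<in> {1<..2} \<Longrightarrow> norm (L_series \<omega>2 s - L_series \<omega>2 1) \<le> C2 * (s - 1)"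
    using L_series_bounds[of \<omega>2, OF norm_sum_dirichlet_char_le[OF chr2 m0 np2[folded \<omega>2_def]] le[OF chr2]]
    by metis
  \<comment> \<open>\<open>8\<close> is the cube of the 2 in the bound \<open>2 / e\<close> for the
    principal factor, and \<open>C ^ 4\<close> comes from the fourth power of the zero; together
    they leave one factor \<open>e\<close>.\<close>
  define K where "K = 8 * C ^ 4 * (norm (L_series \<omega>2 1) + C2)"
  have K: "K > 0" unfolding K_def using C C2 by (intro mult_pos_pos) (auto intro: add_nonneg_pos)
  have bound: "norm (F (1 + e)) \<le> K * e" if e: "e > 0" "e \<le> 1" for e
  proof -
    have "1 + 1 / e \<le> 2 / e" using e by (simp add: field_simps)
    hence "norm (L_series \<omega>0 (1 + e)) \<le> 2 / e"
      using norm_L_series_le[of \<omega>0 "1 + e"] le[OF chr0] e by auto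
    hence a: "norm (L_series \<omega>0 (1 + e)) ^ 3 \<le> (2 / e) ^ 3" by (intro power_mono) auto
    have "norm (L_series \<omega> (1 + e)) \<le> C * e" using C(2)[of "1 + e"] L0 e by simp
    hence b: "norm (L_series \<omega> (1 + e)) ^ 4 \<le> (C * e) ^ 4" by (intro power_mono) auto
    have "norm (L_series \<omega>2 (1 + e)) \<le> norm (L_series \<omega>2 1) + C2 * e"
      using C2(2)[of "1 + e"] norm_triangle_sub[of "L_series \<omega>2 (1 + e)" "L_series \<omega>2 1"] e by simp
    also have "\<dots> \<le> norm (L_series \<omega>2 1) + C2" using e C2(1) by simp
    finally have c: "norm (L_series \<omega>2 (1 + e)) \<le> norm (L_series \<omega>2 1) + C2" .
    have "norm (F (1 + e)) \<le> (2 / e) ^ 3 * (C * e) ^ 4 * (norm (L_series \<omega>2 1) + C2)"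
      unfolding F_def norm_mult norm_power using e C(1) by (intro mult_mono a b c) auto
    also have "\<dots> = K * e" using e by (simp add: K_def field_simps eval_nat_numeral)
    finally show ?thesis .
  qed
  define e where "e = min 1 (norm (F 3) / (2 * K))"
  have e: "e > 0" "e \<le> 1" "e \<le> norm (F 3) / (2 * K)" using K F3 by (auto simp: e_def)
  have "norm (F 3) ^ 2 \<le> norm (F (1 + e)) ^ 2" by (rule mono) (use e(1,2) in auto)
  hence "norm (F 3) \<le> norm (F (1 + e))" by (rule power2_le_imp_le) auto
  also have "\<dots> \<le> K * e" by (rule bound[OF e(1,2)])
  also have "\<dots> \<le> K * (norm (F 3) / (2 * K))" using e K by (intro mult_left_mono) auto
  also have "\<dots> < norm (F 3)" using K F3 by simp
  finally show False by simp
qed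

section \<open>Non-vanishing at \<open>s = 1\<close> for real characters\<close>

lemma sum_divisors_prime_power_mult:
  fixes f :: "nat \<Rightarrow> 'a :: comm_ring_1"
  assumes mult: "\<And>a b. f (a * b) = f a * f b" and "f 1 = 1"
    and p: "prime p" and "\<not> p dvd M" and "M > 0"
  shows "(\<Sum>d | d dvd p ^ k * M. f d) = (\<Sum>i\<le>k. f p ^ i) * (\<Sum>d | d dvd M. f d)"
proof -
  have fpow: "f (p ^ i) = f p ^ i" for i by (induction i) (use assms in auto)
  have bij: "bij_betw (\<lambda>(i, d). p ^ i * d) ({..k} \<times> {d. d dvd M}) {d. d dvd p ^ k * M}"
    unfolding bij_betw_def
  proof (intro conjI subset_antisym subsetI)
      show "inj_on (\<lambda>(i, d). p ^ i * d) ({..k} \<times> {d. d dvd M})"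
      proof (rule inj_onI, clarify)
        fix i d j e assume *: "d dvd M" "e dvd M" "p ^ i * d = p ^ j * e"
        have nd: "\<not> p dvd d" "\<not> p dvd e" using *(1,2) assms(4) dvd_trans by blast+
        have "multiplicity p (p ^ i * d) = i" "multiplicity p (p ^ j * e) = j"
          using nd p by (auto intro!: multiplicity_eqI simp: prime_gt_0_nat power_Suc2 simp del: power_Suc)
        hence "i = j" using *(3) by simp
        thus "i = j \<and> d = e" using *(3) p by (simp add: prime_gt_0_nat)
      qed
      fix x assume "x \<in> (\<lambda>(i, d). p ^ i * d) ` ({..k} \<times> {d. d dvd M})"
      thus "x \<in> {d. d dvd p ^ k * M}" by (auto intro!: mult_dvd_mono le_imp_power_dvd)
    next
      fix x assume "x \<in> {d. d dvd p ^ k * M}"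
      then obtain a b where ab: "x = a * b" "a dvd p ^ k" "b dvd M"
        using division_decomp by blast
      then obtain i where "i \<le> k" "a = p ^ i" using divides_primepow_nat[OF p] by auto
      thus "x \<in> (\<lambda>(i, d). p ^ i * d) ` ({..k} \<times> {d. d dvd M})" using ab by force
  qed
  have "(\<Sum>d | d dvd p ^ k * M. f d) = (\<Sum>(i, d)\<in>{..k} \<times> {d. d dvd M}. f p ^ i * f d)"
    by (subst sum.reindex_bij_betw[OF bij, symmetric]) (simp add: case_prod_unfold mult fpow)
  also have "\<dots> = (\<Sum>i\<le>k. \<Sum>d | d dvd M. f p ^ i * f d)"
    by (rule sum.cartesian_product[symmetric])
  also have "\<dots> = (\<Sum>i\<le>k. f p ^ i) * (\<Sum>d | d dvd M. f d)"
    by (simp add: sum_product)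
  finally show ?thesis .
qed

lemma geometric_sign_sum:
  assumes "z \<in> {-1, 0, 1::real}"
  shows "(\<Sum>i\<le>k. z ^ i) \<ge> (if even k then 1 else 0)"
proof -
  have "(\<Sum>i\<le>k. (-1::real) ^ i) = (if even k then 1 else 0)" by (induction k) auto
  moreover have "(\<Sum>i\<le>k. (0::real) ^ i) = 1" by (induction k) auto
  ultimately show ?thesis using assms by auto
qed

text \<open>The divisor sum is multiplicative, and its factor at a prime power is a geometric sum in
  a number from \<open>{-1, 0, 1}\<close>, hence nonnegative.\<close>

lemma sum_divisors_nonneg:
  fixes f :: "nat \<Rightarrow> real"
  assumes mult: "\<And>a b. f (a * b) = f a * f b" and "f 1 = 1" and vals: "\<And>n. f n \<in> {-1, 0, 1}"
    and "N > 0"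
  shows "(\<Sum>d | d dvd N. f d) \<ge> 0"
  using assms(4)
proof (induction N rule: less_induct)
  case (less N)
  show ?case
  proof (cases "N = 1")
    case False
    then obtain p where p: "prime p" "p dvd N" using prime_factor_nat by blast
    obtain M where M: "N = p ^ multiplicity p N * M" "\<not> p dvd M"
    proof (rule multiplicity_decompose'[of N p])
      show "N \<noteq> 0" "\<not> is_unit p" using less.prems p(1) not_prime_unit by auto
    qed (rule that)
    have "multiplicity p N > 0"
      using p less.prems by (simp add: prime_multiplicity_gt_zero_iff)
    hence "p ^ multiplicity p N > 1" using prime_gt_1_nat[OF p(1)] by (intro one_less_power)
    moreover have "M > 0" using M(1) less.prems by (auto intro: Nat.gr0I)
    ultimately have "M < N" using M(1) n_less_m_mult_n[of M "p ^ multiplicity p N"] by simp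
    have "(\<Sum>d | d dvd N. f d) = (\<Sum>i\<le>multiplicity p N. f p ^ i) * (\<Sum>d | d dvd M. f d)"
      using sum_divisors_prime_power_mult[of f, OF mult assms(2) p(1) M(2) \<open>M > 0\<close>, of "multiplicity p N"]
      unfolding M(1)[symmetric] .
    also have "\<dots> \<ge> 0"
      using geometric_sign_sum[OF vals, of "multiplicity p N" p] less.IH[OF \<open>M < N\<close> \<open>M > 0\<close>]
      by (intro mult_nonneg_nonneg) (auto split: if_splits)
    finally show ?thesis .
  qed (use assms(2) in simp)
qed

lemma has_sum_geometric:
  assumes "0 \<le> y" "y < (1::real)"
  shows "((\<lambda>k. y ^ k) has_sum (y / (1 - y))) {1..}"
proof -
  define f where "f k = (if k = 0 then 0 else y ^ k)" for k :: nat
  have "(\<lambda>k. y * y ^ k) sums (y * (1 / (1 - y)))"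
    using assms by (intro sums_mult geometric_sums) auto
  hence "(\<lambda>k. f (Suc k)) sums (y / (1 - y) - f 0)" by (simp add: f_def)
  hence s: "f sums (y / (1 - y))" by (subst (asm) sums_Suc_iff) simp
  have "(\<lambda>n. norm (f n)) = f" using assms by (auto simp: f_def fun_eq_iff)
  hence "(f has_sum (suminf f)) {1..}"
    using sums_summable[OF s] by (intro has_sum_atLeast_1) (auto simp: f_def)
  also have "suminf f = y / (1 - y)" using s by (rule sums_unique[symmetric])
  also have "(f has_sum (y / (1 - y))) {1..} \<longleftrightarrow> ?thesis"
    by (rule has_sum_cong) (simp add: f_def)
  finally show ?thesis .
qed

text \<open>With \<open>y = sqrt x\<close>, pairing \<open>x ^ i\<close> with
  \<open>x ^ (k - 1 - i)\<close> gives \<open>S k \<ge> k * y ^ (k - 1)\<close> by the inequality of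
  the means; weakened to \<open>k * y ^ n\<close> and multiplied for \<open>k = n\<close> and
  \<open>k = n + 1\<close>, this is the claim. It will say that the weights \<open>b\<close> of the
  Lambert argument decrease.\<close>

lemma lambert_inequality:
  assumes "0 < x" "x < (1::real)" "n \<ge> 1"
  shows "(1 - x)\<^sup>2 * x ^ n * (real n * real (Suc n)) \<le> (1 - x ^ n) * (1 - x ^ Suc n)"
proof -
  define y where "y = sqrt x"
  have y: "0 < y" "y \<le> 1" "x = y ^ 2" using assms by (auto simp: y_def)
  define S where "S n = (\<Sum>i<n. x ^ i)" for n
  have S: "(1 - x) * S n = 1 - x ^ n" for n
    unfolding S_def by (rule one_diff_power_eq[symmetric])
  have S_ge: "real k * y ^ n \<le> S k" if k: "k \<ge> 1" "k \<le> Suc n" for k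
  proof -
    have "2 * S k = (\<Sum>i<k. x ^ i) + (\<Sum>i<k. x ^ (k - Suc i))"
      unfolding S_def by (simp add: sum.nat_diff_reindex)
    also have "\<dots> = (\<Sum>i<k. (y ^ i) ^ 2 + (y ^ (k - Suc i)) ^ 2)"
      by (simp add: sum.distrib y(3) power_mult[symmetric] mult.commute)
    also have "\<dots> \<ge> (\<Sum>i<k. 2 * (y ^ i * y ^ (k - Suc i)))"
    proof (rule sum_mono)
      fix i
      have "0 \<le> (y ^ i - y ^ (k - Suc i)) ^ 2" by simp
      thus "2 * (y ^ i * y ^ (k - Suc i)) \<le> (y ^ i) ^ 2 + (y ^ (k - Suc i)) ^ 2"
        by (simp add: power2_diff)
    qed
    also have "(\<Sum>i<k. 2 * (y ^ i * y ^ (k - Suc i))) = (\<Sum>i<k. 2 * y ^ (k - 1))"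
      by (intro sum.cong refl) (simp flip: power_add)
    finally have "real k * y ^ (k - 1) \<le> S k" by simp
    moreover have "y ^ n \<le> y ^ (k - 1)" using y k by (intro power_decreasing) auto
    hence "real k * y ^ n \<le> real k * y ^ (k - 1)" by (intro mult_left_mono) auto
    ultimately show ?thesis by linarith
  qed
  have "real n * y ^ n * (real (Suc n) * y ^ n) \<le> S n * S (Suc n)"
    using S_ge[of n] S_ge[of "Suc n"] assms y by (intro mult_mono) (auto simp: S_def intro!: sum_nonneg)
  hence "(1 - x)\<^sup>2 * (real n * y ^ n * (real (Suc n) * y ^ n)) \<le> (1 - x)\<^sup>2 * (S n * S (Suc n))"
    by (intro mult_left_mono) auto
  also have "\<dots> = ((1 - x) * S n) * ((1 - x) * S (Suc n))"
    by (simp add: power2_eq_square mult_ac)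
  also have "\<dots> = (1 - x ^ n) * (1 - x ^ Suc n)" by (simp only: S)
  also have "real n * y ^ n * (real (Suc n) * y ^ n) = x ^ n * (real n * real (Suc n))"
    by (simp add: y(3) power2_eq_square power_mult_distrib mult_ac)
  finally show ?thesis by (simp only: mult.assoc)
qed

text \<open>Monsky's argument: if \<open>L(1)\<close> vanished, the Lambert series of a real character, whose
  power series coefficients are nonnegative and infinitely often at least \<open>1\<close>, would be bounded
  near \<open>x = 1\<close>.\<close>

lemma L_series_1_nonzero_real:
  assumes chr: "dirichlet_char m \<omega>" and m: "m > 1"
    and np: "\<omega> \<noteq> principal_char m" and np2: "(\<lambda>a. \<omega> a * \<omega> a) = principal_char m"
  shows "L_series \<omega> 1 \<noteq> 0"
proof
  assume L0: "L_series \<omega> 1 = 0"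
  have m0: "m > 0" using m by simp
  note le = norm_dirichlet_char_le[OF chr m0]
  note B = norm_sum_dirichlet_char_le[OF chr m0 np]
  define f where "f n = Re (\<omega> n)" for n
  have vals': "\<omega> n \<in> {-1, 0, 1}" for n
  proof -
    have "\<omega> n * \<omega> n = 0 \<or> \<omega> n * \<omega> n = 1"
      using fun_cong[OF np2, of n] by (auto simp: principal_char_def)
    thus ?thesis by (auto simp: square_eq_1_iff)
  qed
  have of_f: "\<omega> n = of_real (f n)" and vals: "f n \<in> {-1, 0, 1}" for n
    using vals'[of n] by (auto simp: f_def)
  have mult: "f (a * b) = f a * f b" for a b
    using dirichlet_charD(1)[OF chr, of a b] unfolding of_f of_real_mult[symmetric] of_real_eq_iff .
  have f1: "f 1 = 1" using dirichlet_charD(3)[OF chr] by (simp add: f_def)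
  have w0: "\<omega> 0 = 0" using dirichlet_charD(5)[OF chr, of 0] m by simp
  have f0: "f 0 = 0" using w0 by (simp add: f_def)
  define r where "r n = (\<Sum>d | d dvd n. f d)" for n
  have abs_f: "\<bar>f n\<bar> \<le> 1" for n using vals[of n] by auto
  obtain C where "summable (\<lambda>n. \<omega> n * of_real (1 / real n))"
      "L_series \<omega> 1 = (\<Sum>n. \<omega> n * of_real (1 / real n))"
    using L_series_bounds[OF B le] by metis
  hence "(\<lambda>n. \<omega> n * of_real (1 / real n)) sums 0" using L0 summable_sums by fastforce
  hence L1: "(\<lambda>n. \<omega> (Suc n) * of_real (1 / real (Suc n))) sums 0"
    by (subst sums_Suc_iff) (simp add: w0)
  have upper: "\<exists>S. ((\<lambda>n. f n * (x ^ n / (1 - x ^ n))) has_sum S) {1..} \<and> \<bar>S\<bar> \<le> real m"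
    if x: "0 < x" "x < 1" for x
  proof -
    \<comment> \<open>Since the series of \<open>\<omega> n / n\<close> sums to 0, its multiple by
      \<open>1 / (1 - x)\<close> can be introduced for free. What remains has weights
      \<open>b\<close> decreasing from 1 to 0, which Abel summation bounds by \<open>m\<close>
      independently of \<open>x\<close>.\<close>
    define b where "b n = 1 / (real n * (1 - x)) - x ^ n / (1 - x ^ n)" for n
    define u where "u n = b (Suc n) - b (Suc (Suc n))" for n
    have pow1: "x ^ n < 1" if "n \<ge> 1" for n using x that power_strict_decreasing[of 0 n x] by simp
    have u_nonneg: "u n \<ge> 0" for n
    proof -
      define k where "k = Suc n"
      have k: "k \<ge> 1" "x ^ k < 1" "x ^ Suc k < 1" using pow1[of k] pow1[of "Suc k"] by (auto simp: k_def)
      have "u n = (1 / (1 - x)) * (1 / (real k * real (Suc k))) - x ^ k * (1 - x) / ((1 - x ^ k) * (1 - x ^ Suc k))"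
      proof -
        have "u n = (1 / (1 - x)) * (1 / real k - 1 / real (Suc k)) - (x ^ k / (1 - x ^ k) - x ^ Suc k / (1 - x ^ Suc k))"
          using x by (simp add: u_def b_def k_def[symmetric] right_diff_distrib mult.commute)
        also have "1 / real k - 1 / real (Suc k) = 1 / (real k * real (Suc k))"
          using k by (simp add: field_simps)
        also have "x ^ k / (1 - x ^ k) - x ^ Suc k / (1 - x ^ Suc k) = x ^ k * (1 - x) / ((1 - x ^ k) * (1 - x ^ Suc k))"
          using k by (simp add: diff_frac_eq) (simp add: algebra_simps)
        finally show ?thesis .
      qed
      also have "\<dots> \<ge> 0"
      proof -
        have gen: "X / Y \<le> 1 / c" if "X * c \<le> 1 * Y" "0 < c" "0 < Y" for X Y c :: real
          using that by (simp add: field_simps)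
        have "x ^ k * (1 - x) * ((1 - x) * (real k * real (Suc k))) \<le> 1 * ((1 - x ^ k) * (1 - x ^ Suc k))"
          using lambert_inequality[OF x k(1)] by (simp only: power2_eq_square mult_ac mult_1_left)
        hence "x ^ k * (1 - x) / ((1 - x ^ k) * (1 - x ^ Suc k)) \<le> 1 / ((1 - x) * (real k * real (Suc k)))"
          using k x gen[of "x ^ k * (1 - x)"] by simp
        thus ?thesis by simp
      qed
      finally show ?thesis .
    qed
    have blim: "(\<lambda>n. b (Suc n)) \<longlonglongrightarrow> 0"
    proof -
      have "(\<lambda>n. 1 / (real n * (1 - x))) \<longlonglongrightarrow> 0" using x by real_asymp
      moreover have "(\<lambda>n. x ^ n / (1 - x ^ n)) \<longlonglongrightarrow> 0 / (1 - 0)"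
        using x by (intro tendsto_intros LIMSEQ_power_zero) auto
      ultimately have "b \<longlonglongrightarrow> 0 - 0 / (1 - 0)" unfolding b_def[abs_def] by (rule tendsto_diff)
      thus ?thesis by (simp add: LIMSEQ_Suc)
    qed
    have usum: "u sums (b (Suc 0) - 0)" unfolding u_def[abs_def] by (rule telescope_sums'[OF blim])
    have b1: "b (Suc 0) = 1" using x by (simp add: b_def diff_divide_distrib[symmetric])
    \<comment> \<open>The index is shifted by one since \<open>b 0\<close> does not fit the monotone
      pattern; nothing is lost as \<open>\<omega> 0 = 0\<close>.\<close>
    have B': "norm (\<Sum>n<N. \<omega> (Suc n)) \<le> real m" for N
      using B[of "Suc N"] by (simp add: sum.lessThan_Suc_shift w0 del: sum.lessThan_Suc)
    have ab: "\<bar>b (Suc n) - b (Suc (Suc n))\<bar> \<le> u n" for n using u_nonneg[of n] by (simp add: u_def)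
    note A = abel_bound[of "\<lambda>n. \<omega> (Suc n)", OF B' ab sums_summable[OF usum] blim]
    have bound: "norm (\<Sum>n. \<omega> (Suc n) * of_real (b (Suc n))) \<le> real m"
      using A(2) sums_unique[OF usum] b1 by simp
    define h where "h n = f n * (x ^ n / (1 - x ^ n))" for n
    have "(\<lambda>n. of_real (1 / (1 - x)) * (\<omega> (Suc n) * of_real (1 / real (Suc n))) - \<omega> (Suc n) * of_real (b (Suc n)))
            sums (of_real (1 / (1 - x)) * 0 - (\<Sum>n. \<omega> (Suc n) * of_real (b (Suc n))))"
      by (intro sums_diff sums_mult L1 summable_sums A(1))
    also have "(\<lambda>n. of_real (1 / (1 - x)) * (\<omega> (Suc n) * of_real (1 / real (Suc n))) - \<omega> (Suc n) * of_real (b (Suc n)))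
                 = (\<lambda>n. of_real (h (Suc n)))"
    proof
      fix n
      have "f (Suc n) * b (Suc n) = 1 / (1 - x) * (f (Suc n) * (1 / real (Suc n))) - h (Suc n)"
        by (simp add: b_def h_def right_diff_distrib mult.commute)
      hence "h (Suc n) = 1 / (1 - x) * (f (Suc n) * (1 / real (Suc n))) - f (Suc n) * b (Suc n)" by simp
      thus "of_real (1 / (1 - x)) * (\<omega> (Suc n) * of_real (1 / real (Suc n))) - \<omega> (Suc n) * of_real (b (Suc n))
              = of_real (h (Suc n))"
        unfolding of_f by (simp only: of_real_mult of_real_diff)
    qed
    finally have hs: "(\<lambda>n. complex_of_real (h (Suc n))) sums (- (\<Sum>n. \<omega> (Suc n) * of_real (b (Suc n))))"
      by simp
    define S where "S = Re (- (\<Sum>n. \<omega> (Suc n) * of_real (b (Suc n))))"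
    have "(\<lambda>n. h (Suc n)) sums S" using sums_Re[OF hs] by (simp add: S_def)
    hence "h sums S" using sums_Suc_iff[of h S] by (simp add: h_def f0)
    moreover have "summable (\<lambda>n. norm (h n))"
    proof (rule summable_comparison_test'[of "\<lambda>n. x ^ n * (1 / (1 - x))" 1])
      show "summable (\<lambda>n. x ^ n * (1 / (1 - x)))" using x by (intro summable_mult2 summable_geometric) auto
      fix n :: nat assume n: "n \<ge> 1"
      have "x ^ n \<le> x" using x n power_decreasing[of 1 n x] by simp
      hence "x ^ n / (1 - x ^ n) \<le> x ^ n / (1 - x)" using x by (intro divide_left_mono) auto
      moreover have "norm (h n) \<le> 1 * (x ^ n / (1 - x ^ n))"
        unfolding h_def real_norm_def abs_mult using abs_f[of n] x pow1[OF n] by (intro mult_mono) auto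
      ultimately show "norm (norm (h n)) \<le> x ^ n * (1 / (1 - x))" by simp
    qed
    ultimately have "(h has_sum S) {1..}"
      using has_sum_atLeast_1[of h] f0 sums_unique by (fastforce simp: h_def)
    moreover have "\<bar>S\<bar> \<le> real m"
      using bound abs_Re_le_cmod[of "\<Sum>n. \<omega> (Suc n) * of_real (b (Suc n))"] unfolding S_def by simp
    ultimately show ?thesis unfolding h_def by blast
  qed
  have lower: "(\<Sum>j<K. x ^ (4 ^ j)) \<le> S"
    if x: "0 < x" "x < 1" and S: "((\<lambda>n. f n * (x ^ n / (1 - x ^ n))) has_sum S) {1..}" for x S and K :: nat
  proof -
    have rows: "((\<lambda>k. x ^ (d * k)) has_sum (x ^ d / (1 - x ^ d))) {1..}" if "d \<ge> 1" for d
      using has_sum_geometric[of "x ^ d"] x that power_strict_decreasing[of 0 d x] by (simp add: power_mult)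
    have colsum: "(\<lambda>d. x ^ d / (1 - x ^ d)) summable_on {1..}"
    proof (rule summable_on_comparison_test[of "\<lambda>d. x ^ d * (1 / (1 - x))"])
      show "(\<lambda>d. x ^ d * (1 / (1 - x))) summable_on {1..}"
        using has_sum_geometric[of x] x by (intro summable_on_cmult_left) (auto simp: summable_on_def)
      fix n :: nat assume n: "n \<in> {1..}"
      have "x ^ n \<le> x" "x ^ n < 1" using x n power_decreasing[of 1 n x] by auto
      thus "x ^ n / (1 - x ^ n) \<le> x ^ n * (1 / (1 - x))" "0 \<le> x ^ n / (1 - x ^ n)"
        using x by (auto intro!: divide_left_mono)
    qed
    have "(\<lambda>(d, k). x ^ (d * k)) summable_on {1..} \<times> {1..}"
      by (rule summable_on_SigmaI[where g = "\<lambda>d. x ^ d / (1 - x ^ d)"]) (use rows colsum x in auto)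
    hence "(\<lambda>(d, k). norm (f d * x ^ (d * k))) summable_on {1..} \<times> {1..}"
      by (rule summable_on_comparison_test)
         (use abs_f x in \<open>auto simp: abs_mult intro!: mult_left_le_one_le\<close>)
    moreover have "((\<lambda>k. f d * x ^ (d * k)) has_sum f d * (x ^ d / (1 - x ^ d))) {1..}" if "d \<ge> 1" for d
      by (intro has_sum_cmult_right rows that)
    ultimately have "((\<lambda>n. \<Sum>d | d dvd n. f d * x ^ (d * (n div d))) has_sum S) {1..}"
      using S by (rule has_sum_divisors)
    also have "?this \<longleftrightarrow> ((\<lambda>n. r n * x ^ n) has_sum S) {1..}"
      by (rule has_sum_cong) (simp add: r_def sum_distrib_right)
    finally have rS: "((\<lambda>n. r n * x ^ n) has_sum S) {1..}" .
    \<comment> \<open>At powers of 4 the exponent of 2 is even, so the divisor sum \<open>r\<close>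
      is at least 1 whatever the sign of \<open>f 2\<close>; elsewhere \<open>r \<ge> 0\<close>
      suffices.\<close>
    let ?A = "(\<lambda>j. 4 ^ j) ` {..<K} :: nat set"
    have "(\<Sum>j<K. x ^ (4 ^ j)) = (\<Sum>n\<in>?A. x ^ n)"
      by (subst sum.reindex) (auto simp: inj_on_def)
    also have "\<dots> \<le> (\<Sum>n\<in>?A. r n * x ^ n)"
    proof (rule sum_mono)
      fix n :: nat assume "n \<in> ?A"
      then obtain j where j: "n = 4 ^ j" by auto
      have n: "n = 2 ^ (2 * j) * 1" by (simp add: j power_mult)
      have "r n = (\<Sum>i\<le>2 * j. f 2 ^ i)"
        unfolding r_def n using sum_divisors_prime_power_mult[of f 2 1 "2 * j", OF mult f1] f1 by simp
      also have "\<dots> \<ge> 1" using geometric_sign_sum[OF vals, of "2 * j" 2] by simp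
      finally show "x ^ n \<le> r n * x ^ n" using x by simp
    qed
    also have "\<dots> \<le> S"
    proof (rule has_sum_mono_neutral[OF has_sum_finite rS])
      fix n assume "n \<in> {1..} - ?A"
      thus "0 \<le> r n * x ^ n"
        unfolding r_def using x sum_divisors_nonneg[of f n, OF mult f1 vals] by simp
    qed auto
    finally show ?thesis .
  qed
  \<comment> \<open>By Bernoulli's inequality each of the \<open>K\<close> terms
    \<open>x ^ (4 ^ j)\<close> is at least 1/2 for the \<open>x\<close> below;
    \<open>K = 2 * m + 2\<close> makes their sum exceed the upper bound \<open>m\<close>.\<close>
  define K where "K = 2 * m + 2"
  define x where "x = 1 - 1 / (2 * 4 ^ K :: real)"
  have "(1::real) \<le> 4 ^ K" by simp
  hence "(1::real) < 2 * 4 ^ K" by linarith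
  hence x: "0 < x" "x < 1" by (auto simp: x_def field_simps)
  obtain S where S: "((\<lambda>n. f n * (x ^ n / (1 - x ^ n))) has_sum S) {1..}" "\<bar>S\<bar> \<le> real m"
    using upper[OF x] by blast
  have "1 / 2 \<le> x ^ (4 ^ j)" if "j < K" for j
  proof -
    have "1 / 2 = 1 + real (4 ^ K) * (- 1 / (2 * 4 ^ K))" by simp
    also have "\<dots> \<le> (1 + - 1 / (2 * 4 ^ K)) ^ (4 ^ K)"
      using x by (intro Bernoulli_inequality) (auto simp: x_def)
    also have "\<dots> = x ^ (4 ^ K)" by (simp add: x_def)
    also have "\<dots> \<le> x ^ (4 ^ j)" using x that by (intro power_decreasing power_increasing) auto
    finally show ?thesis .
  qed
  hence "(\<Sum>j<K. 1 / 2) \<le> (\<Sum>j<K. x ^ (4 ^ j))" by (intro sum_mono) auto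
  hence "real m + 1 \<le> S" using lower[OF x S(1), of K] by (simp add: K_def)
  thus False using S(2) by simp
qed

lemma L_series_1_nonzero:
  assumes "dirichlet_char m \<omega>" "m > 1" "\<omega> \<noteq> principal_char m"
  shows "L_series \<omega> 1 \<noteq> 0"
  using L_series_1_nonzero_real[OF assms] L_series_1_nonzero_complex[OF assms] by blast

section \<open>Primes in arithmetic progressions\<close>

text \<open>Near 1 the derivative is bounded and, since
  \<open>L_series \<omega> 1 \<noteq> 0\<close>, the Lipschitz estimate keeps the modulus of
  \<open>L_series\<close> above half of its value at 1; \<open>t\<close> is the point up to which
  this works.\<close>

lemma L_mangoldt_series_bounded:
  assumes chr: "dirichlet_char m \<omega>" and m: "m > 1" and np: "\<omega> \<noteq> principal_char m"
  shows "\<exists>C. \<forall>\<^sub>F s in at_right 1. norm (L_mangoldt_series \<omega> s) \<le> C"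
proof -
  have m0: "m > 0" using m by simp
  note le = norm_dirichlet_char_le[OF chr m0]
  note L1 = L_series_1_nonzero[OF chr m np]
  obtain C where C: "C > 0"
    "\<And>s. s \<in> {1<..2} \<Longrightarrow> norm (L_series \<omega> s - L_series \<omega> 1) \<le> C * (s - 1)"
    "\<And>s. s \<in> {1<..2} \<Longrightarrow> norm (L_ln_series \<omega> s) \<le> C"
    using L_series_bounds[OF norm_sum_dirichlet_char_le[OF chr m0 np] le] by metis
  define K where "K = norm (L_series \<omega> 1) / 2"
  have K: "K > 0" using L1 by (simp add: K_def)
  define t where "t = 1 + min 1 (K / C)"
  have t: "t > 1" using K C(1) by (simp add: t_def)
  have "norm (L_mangoldt_series \<omega> s) \<le> C / K" if s: "s \<in> {1<..<t}" for s
  proof -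
    have s2: "s \<in> {1<..2}" "s - 1 \<le> K / C" using s by (auto simp: t_def)
    have "C * (s - 1) \<le> K" using s2(2) C(1) by (simp add: field_simps)
    hence "norm (L_series \<omega> s - L_series \<omega> 1) \<le> K" using C(2)[OF s2(1)] by linarith
    hence "K \<le> norm (L_series \<omega> s)"
      using norm_triangle_sub[of "L_series \<omega> 1" "L_series \<omega> s"]
      by (simp add: K_def norm_minus_commute)
    hence "K * norm (L_mangoldt_series \<omega> s) \<le> norm (L_series \<omega> s) * norm (L_mangoldt_series \<omega> s)"
      by (intro mult_right_mono) auto
    also have "\<dots> = norm (L_ln_series \<omega> s)"
      using L_series_mult_mangoldt[of \<omega> s, OF dirichlet_charD(1)[OF chr] le] s2
      by (simp flip: norm_mult)
    also have "\<dots> \<le> C" by (rule C(3)[OF s2(1)])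
    finally show ?thesis using K by (simp add: field_simps)
  qed
  hence "\<forall>\<^sub>F s in at_right 1. norm (L_mangoldt_series \<omega> s) \<le> C / K"
    using t by (intro eventually_at_rightI[of 1 t]) auto
  thus ?thesis by blast
qed

text \<open>The numbers \<open>k * m + 1\<close> are coprime to \<open>m\<close>, so this alone
  makes the principal L-series blow up at 1.\<close>

lemma sum_harmonic_progression_unbounded:
  assumes "m > 0"
  shows "\<exists>J. (\<Sum>k<J. 1 / real (k * m + 1)) > K"
proof (rule ccontr)
  assume "\<not> ?thesis"
  hence le: "(\<Sum>k<J. 1 / real (k * m + 1)) \<le> K" for J by (simp add: not_less)
  have "summable (\<lambda>k. 1 / real (k * m + 1))"
    by (rule bounded_imp_summable[where B = K]) (use le in \<open>auto simp: lessThan_Suc_atMost[symmetric] simp del: sum.lessThan_Suc\<close>)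
  hence "summable (\<lambda>k. real m * (1 / real (k * m + 1)))" by (rule summable_mult)
  hence "summable (\<lambda>k. inverse (real (Suc k)))"
  proof (rule summable_comparison_test'[of _ 0])
    fix k :: nat
    have "real (k * m + 1) \<le> real m * real (Suc k)" using assms by (simp add: algebra_simps)
    thus "norm (inverse (real (Suc k))) \<le> real m * (1 / real (k * m + 1))"
      by (simp add: field_simps del: of_nat_Suc of_nat_add)
  qed
  hence "summable (\<lambda>k. inverse (real k))" by (subst (asm) summable_Suc_iff)
  thus False using not_summable_harmonic by blast
qed

text \<open>The derivative outgrows the series: \<open>ln n \<ge> ln N\<close> for
  \<open>n \<ge> N\<close> gives \<open>D s \<ge> ln N * (A s - N)\<close>, and once
  \<open>A s > 2 * N\<close> the quotient \<open>M s = D s / A s\<close> is at least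
  \<open>ln N / 2\<close>.\<close>

lemma L_mangoldt_series_principal_unbounded:
  assumes m: "m > 1"
  shows "\<forall>\<^sub>F s in at_right 1. K \<le> Re (L_mangoldt_series (principal_char m) s)"
proof -
  define c where "c n = (if coprime n m then 1 else 0 :: real)" for n
  define A where "A s = (\<Sum>n. c n * real n powr (- s))" for s
  define M where "M s = (\<Sum>n. c n * (mangoldt n * real n powr (- s)))" for s
  define D where "D s = (\<Sum>n. c n * (ln (real n) * real n powr (- s)))" for s
  have m0: "m > 0" using m by simp
  have c: "principal_char m n = of_real (c n)" for n by (simp add: principal_char_def c_def)
  have c01: "0 \<le> c n" "c n \<le> 1" for n by (auto simp: c_def)
  have sc: "summable (\<lambda>n. c n * f n)" if "summable f" "\<And>n. f n \<ge> 0" for f :: "nat \<Rightarrow> real"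
    by (rule summable_comparison_test'[OF that(1), of 0])
       (use c01 that(2) in \<open>auto simp: abs_mult intro: mult_left_le_one_le\<close>)
  have sA: "summable (\<lambda>n. c n * real n powr (- s))" if "s > 1" for s
    by (rule sc[OF summable_powr[OF that]]) auto
  have sM: "summable (\<lambda>n. c n * (mangoldt n * real n powr (- s)))" if "s > 1" for s
    by (rule sc[OF summable_mangoldt_powr[OF that] mangoldt_powr_nonneg])
  have sD: "summable (\<lambda>n. c n * (ln (real n) * real n powr (- s)))" if "s > 1" for s
    by (rule sc[OF summable_ln_powr[OF that] ln_powr_nonneg])
  have of_A: "L_series (principal_char m) s = of_real (A s)" if "s > 1" for s
    unfolding L_series_def A_def c of_real_mult[symmetric] by (rule suminf_of_real[OF sA[OF that], symmetric])
  have of_M: "L_mangoldt_series (principal_char m) s = of_real (M s)" if "s > 1" for s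
    unfolding L_mangoldt_series_def M_def c of_real_mult[symmetric]
    by (rule suminf_of_real[OF sM[OF that], symmetric])
  have of_D: "L_ln_series (principal_char m) s = of_real (D s)" if "s > 1" for s
    unfolding L_ln_series_def D_def c of_real_mult[symmetric]
    by (rule suminf_of_real[OF sD[OF that], symmetric])
  have chr: "dirichlet_char m (principal_char m)" by (rule dirichlet_char_principal[OF m0])
  have AMD: "A s * M s = D s" if "s > 1" for s
    using L_series_mult_mangoldt[of "principal_char m", OF dirichlet_charD(1)[OF chr]
        norm_dirichlet_char_le[OF chr m0] that]
    unfolding of_A[OF that] of_M[OF that] of_D[OF that] of_real_mult[symmetric] of_real_eq_iff .
  have A_large: "\<forall>\<^sub>F s in at_right 1. B < A s" for B
  proof -
    obtain J where J: "B < (\<Sum>k<J. 1 / real (k * m + 1))"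
      using sum_harmonic_progression_unbounded[OF m0] by blast
    have "((\<lambda>s. \<Sum>k<J. real (k * m + 1) powr (- s)) \<longlongrightarrow> (\<Sum>k<J. real (k * m + 1) powr (- 1))) (at_right 1)"
      by (intro tendsto_intros) (auto simp: add_nonneg_eq_0_iff)
    also have "(\<Sum>k<J. real (k * m + 1) powr (- 1)) = (\<Sum>k<J. 1 / real (k * m + 1))"
      by (intro sum.cong refl) (simp add: powr_minus divide_inverse del: of_nat_add)
    finally have "\<forall>\<^sub>F s in at_right 1. B < (\<Sum>k<J. real (k * m + 1) powr (- s))"
      using J by (rule order_tendstoD(1))
    moreover have "\<forall>\<^sub>F s in at_right 1. s > (1::real)" by (rule eventually_at_right_less)
    ultimately show ?thesis
    proof eventually_elim
      case (elim s)
      have "(\<Sum>k<J. real (k * m + 1) powr (- s)) = (\<Sum>n\<in>(\<lambda>k. k * m + 1) ` {..<J}. c n * real n powr (- s))"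
      proof (subst sum.reindex)
        show "inj_on (\<lambda>k. k * m + 1) {..<J}" using m0 by (auto simp: inj_on_def)
        have "coprime (k * m + 1) m" for k
        proof (rule coprimeI)
          fix d assume "d dvd k * m + 1" "d dvd m"
          thus "is_unit d" using dvd_add_right_iff[of d "k * m" 1] by simp
        qed
        thus "(\<Sum>k<J. real (k * m + 1) powr (- s)) =
                sum ((\<lambda>n. c n * real n powr (- s)) \<circ> (\<lambda>k. k * m + 1)) {..<J}"
          by (simp add: c_def)
      qed
      also have "\<dots> \<le> A s" unfolding A_def using c01 by (intro sum_le_suminf sA elim) auto
      finally show ?case using elim by linarith
    qed
  qed
  have "\<forall>\<^sub>F N in sequentially. 2 * K \<le> ln (real N)" by real_asymp
  hence "\<forall>\<^sub>F N in sequentially. N \<ge> 1 \<and> 2 * K \<le> ln (real N)"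
    by (intro eventually_conj eventually_ge_at_top)
  then obtain N :: nat where N: "N \<ge> 1" "2 * K \<le> ln (real N)"
    unfolding eventually_sequentially by blast
  have DA: "ln (real N) * (A s - real N) \<le> D s" if s: "s > 1" for s
  proof -
    have fin: "(\<lambda>n. if n \<in> {..<N} then 1 else 0) sums (\<Sum>n<N. 1::real)"
      by (rule sums_If_finite_set) auto
    hence s1: "(\<lambda>n. ln (real N) * (c n * real n powr (- s) - (if n \<in> {..<N} then 1 else 0))) sums
             (ln (real N) * (A s - (\<Sum>n<N. 1)))"
      unfolding A_def by (intro sums_mult sums_diff summable_sums sA s)
    have s2: "(\<lambda>n. c n * (ln (real n) * real n powr (- s))) sums D s"
      unfolding D_def by (intro summable_sums sD s)
    have "ln (real N) * (c n * real n powr (- s) - (if n \<in> {..<N} then 1 else 0)) \<le>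
                     c n * (ln (real n) * real n powr (- s))" for n
    proof (cases "n < N")
      case True
      have "real n powr (- s) \<le> 1"
      proof (cases "n = 0")
        case False
        thus ?thesis using s powr_mono[of "- s" 0 "real n"] by simp
      qed simp
      hence "c n * real n powr (- s) \<le> 1" using c01[of n] by (intro mult_le_one) auto
      hence "ln (real N) * (c n * real n powr (- s) - 1) \<le> 0"
        using N(1) by (intro mult_nonneg_nonpos) auto
      also have "0 \<le> c n * (ln (real n) * real n powr (- s))"
        using c01[of n] ln_powr_nonneg[of n s] by simp
      finally show ?thesis using True by simp
    next
      case False
      have "ln (real N) * (c n * real n powr (- s)) \<le> ln (real n) * (c n * real n powr (- s))"
        using False N(1) c01[of n] by (intro mult_right_mono) auto
      thus ?thesis using False by (simp add: mult_ac)
    qed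
    hence "ln (real N) * (A s - (\<Sum>n<N. 1)) \<le> D s" by (rule sums_le[OF _ s1 s2])
    thus ?thesis by simp
  qed
  have "\<forall>\<^sub>F s in at_right 1. s > (1::real)" by (rule eventually_at_right_less)
  with A_large[of "2 * real N"] show ?thesis
  proof eventually_elim
    case (elim s)
    have Apos: "A s > 0" using elim(1) N(1) by linarith
    have "ln (real N) * (A s / 2) \<le> ln (real N) * (A s - real N)"
      using elim(1) N(1) by (intro mult_left_mono) auto
    also have "\<dots> \<le> A s * M s" using DA[OF elim(2)] AMD[OF elim(2)] by simp
    finally have "A s * (ln (real N) / 2) \<le> A s * M s" by (simp add: mult_ac)
    hence "ln (real N) / 2 \<le> M s" using Apos by simp
    thus ?case using N(2) by (simp add: of_M[OF elim(2)])
  qed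
qed

text \<open>Proper prime powers are parametrised injectively as \<open>p ^ (k + 2)\<close>, and
  \<open>1 / p ^ (k + 2) \<le> p powr (- 2) * (1 / 2) ^ k\<close> dominates the sum by a product of
  two convergent series.\<close>

lemma summable_mangoldt_nonprime:
  "summable (\<lambda>n. if prime n then 0 else mangoldt n / real n)"
proof -
  define h :: "nat \<times> nat \<Rightarrow> nat" where "h = (\<lambda>(p, k). p ^ (k + 2))"
  define P where "P = {p::nat. prime p} \<times> (UNIV :: nat set)"
  have inj: "inj_on h P"
  proof (rule inj_onI)
    fix x y assume *: "x \<in> P" "y \<in> P" "h x = h y"
    obtain p k where x: "x = (p, k)" by (cases x)
    obtain q l where y: "y = (q, l)" by (cases y)
    show "x = y"
      using * prime_power_inj''[of p q "k + 2" "l + 2"] by (auto simp: x y P_def h_def)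
  qed
  have "(\<lambda>(p, k). (ln (real p) * real p powr (- 2)) * (1 / 2) ^ k) summable_on P"
    unfolding P_def using ln_powr_nonneg[of _ 2]
    by (intro summable_on_product summable_ln_powr summable_geometric) auto
  hence "((\<lambda>n. mangoldt n / real n) \<circ> h) summable_on P"
  proof (rule summable_on_comparison_test)
    fix x assume "x \<in> P"
    then obtain p k where x: "x = (p, k)" "prime p" by (auto simp: P_def)
    have p2: "real p \<ge> 2" using prime_ge_2_nat[OF x(2)] by simp
    have "(1 / real p) ^ k \<le> (1 / 2) ^ k" using p2 by (intro power_mono) (auto simp: field_simps)
    hence "ln (real p) * real p powr (-2) * (1 / real p) ^ k \<le> ln (real p) * real p powr (-2) * (1 / 2) ^ k"
      using ln_powr_nonneg[of p 2] by (intro mult_left_mono) auto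
    moreover have "real p powr (-2) = 1 / real p ^ 2" using p2 by (simp add: powr_minus divide_inverse)
    moreover have "mangoldt (h x) = ln (real p)"
      using mangoldt_primepow'[OF x(2), of "k + 2", where ?'a = real] by (simp add: x(1) h_def)
    moreover have "real (h x) = real p ^ 2 * real p ^ k"
      unfolding x(1) h_def by (simp add: power_add power2_eq_square)
    ultimately show "((\<lambda>n. mangoldt n / real n) \<circ> h) x \<le> (case x of (p, k) \<Rightarrow> (ln (real p) * real p powr (- 2)) * (1 / 2) ^ k)"
      using x by (simp add: power_divide)
    show "0 \<le> ((\<lambda>n. mangoldt n / real n) \<circ> h) x" by (simp add: mangoldt_nonneg)
  qed
  hence "(\<lambda>n. mangoldt n / real n) summable_on (h ` P)"
    using summable_on_reindex[OF inj] by blast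
  also have "?this \<longleftrightarrow> (\<lambda>n. if prime n then 0 else mangoldt n / real n) summable_on UNIV"
  proof (rule summable_on_cong_neutral)
    fix n assume n: "n \<in> UNIV - h ` P"
    show "(if prime n then 0 else mangoldt n / real n) = (0::real)"
    proof (cases "primepow n")
      case True
      then obtain p k where pk: "prime p" "k > 0" "n = p ^ k" unfolding primepow_def by auto
      have "k = 1"
      proof (rule ccontr)
        assume "k \<noteq> 1"
        hence "2 \<le> k" using pk(2) by simp
        then obtain j where "k = 2 + j" using le_Suc_ex by blast
        hence "n = h (p, j)" using pk by (simp add: h_def)
        moreover have "(p, j) \<in> P" using pk(1) by (simp add: P_def)
        ultimately show False using n by blast
      qed
      thus ?thesis using pk by simp
    qed (auto simp: mangoldt_def)
  next
    fix n assume "n \<in> h ` P \<inter> UNIV"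
    then obtain p k where "prime p" "n = p ^ (k + 2)" by (auto simp: h_def P_def)
    moreover from this have "\<not> prime (p ^ (k + 2))" unfolding prime_power_iff by simp
    ultimately have "\<not> prime n" by simp
    thus "mangoldt n / real n = (if prime n then 0 else mangoldt n / real n)" by simp
  qed auto
  finally show ?thesis by (rule summable_on_imp_summable)
qed

text \<open>With finitely many such primes the sum of \<open>mangoldt n * n powr (- s)\<close> over
  \<open>n\<close> congruent to \<open>a\<close> would stay bounded as \<open>s\<close> tends to 1,
  higher prime powers being summable even at 1. Orthogonality writes a multiple of it as a
  combination in which the principal character is unbounded and all others are bounded.\<close>

theorem infinite_primes_cong:
  assumes sep: "separated_modulus m" and m: "m > 1" and cop: "coprime a m"
  shows "infinite {p. prime p \<and> [p = a] (mod m)}"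
proof
  define P where "P = {p. prime p \<and> [p = a] (mod m)}"
  assume "finite {p. prime p \<and> [p = a] (mod m)}"
  hence finP: "finite P" by (simp add: P_def)
  have m0: "m > 0" using m by simp
  obtain b where b: "[a * b = 1] (mod m)" using cong_solve_coprime_nat[OF cop] by auto
  hence ba: "[b * a = 1] (mod m)" by (simp add: mult.commute)
  have cb: "coprime b m" using ba cop by (metis coprime_iff_invertible_nat mult.commute One_nat_def)
  define X where "X = {\<omega>. dirichlet_char m \<omega>}"
  have finX: "finite X" unfolding X_def by (rule finite_dirichlet_chars[OF m0])
  define t where "t s n = (if [n = a] (mod m) then mangoldt n * real n powr (- s) else 0)" for s n
  define W :: "nat \<Rightarrow> real" where "W n = (if prime n then 0 else mangoldt n / real n)" for n
  have st: "summable (t s)" if "s > 1" for s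
    by (rule summable_comparison_test'[OF summable_mangoldt_powr[OF that], of 0])
       (auto simp: t_def mangoldt_nonneg)
  define C0 where "C0 = (\<Sum>p\<in>P. ln (real p)) + suminf W"
  have upper: "suminf (t s) \<le> C0" if s: "s > 1" for s
  proof -
    have "(\<lambda>n. if n \<in> P then ln (real n) else 0) sums (\<Sum>p\<in>P. ln (real p))"
      by (rule sums_If_finite_set[OF finP])
    hence sums: "(\<lambda>n. (if n \<in> P then ln (real n) else 0) + W n) sums C0"
      unfolding C0_def using summable_sums[OF summable_mangoldt_nonprime] unfolding W_def
      by (intro sums_add) auto
    have "t s n \<le> (if n \<in> P then ln (real n) else 0) + W n" for n
    proof (cases "[n = a] (mod m) \<and> n > 0")
      case True
      have "real n powr (- s) \<le> real n powr (- 1)" using s True by (intro powr_mono) auto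
      also have "\<dots> = 1 / real n" using True by (simp add: powr_minus divide_inverse)
      finally have p1: "real n powr (- s) \<le> 1 / real n" .
      also have "\<dots> \<le> 1" using True by simp
      finally have p2: "real n powr (- s) \<le> 1" .
      show ?thesis
      proof (cases "prime n")
        case pr: True
        have "mangoldt n * real n powr (- s) \<le> mangoldt n * 1"
          using p2 mangoldt_nonneg[of n] by (intro mult_left_mono) auto
        thus ?thesis using True pr by (simp add: t_def P_def W_def)
      next
        case False
        have "mangoldt n * real n powr (- s) \<le> mangoldt n * (1 / real n)"
          using p1 mangoldt_nonneg[of n] by (intro mult_left_mono) auto
        thus ?thesis using True False by (simp add: t_def P_def W_def)
      qed
    next
      case False
      hence "t s n = 0" by (auto simp: t_def)
      moreover have "W n \<ge> 0" by (simp add: W_def mangoldt_nonneg)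
      moreover have "n \<in> P \<Longrightarrow> ln (real n) \<ge> 0"
        by (auto simp: P_def dest!: prime_gt_0_nat)
      ultimately show ?thesis by auto
    qed
    thus ?thesis using sums_le[OF _ summable_sums[OF st[OF s]] sums] by blast
  qed
  have key: "(\<Sum>\<omega>\<in>X. \<omega> b * L_mangoldt_series \<omega> s) = of_nat (card X) * of_real (suminf (t s))"
    if s: "s > 1" for s
  proof -
    have "(\<lambda>n. \<Sum>\<omega>\<in>X. \<omega> b * (\<omega> n * of_real (mangoldt n * real n powr (- s)))) sums
            (\<Sum>\<omega>\<in>X. \<omega> b * L_mangoldt_series \<omega> s)"
      unfolding L_mangoldt_series_def
      by (intro sums_sum sums_mult summable_sums summable_norm_bounded_mult(2) summable_mangoldt_powr s
            mangoldt_powr_nonneg) (auto simp: X_def intro: norm_dirichlet_char_le[OF _ m0])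
    also have "(\<lambda>n. \<Sum>\<omega>\<in>X. \<omega> b * (\<omega> n * of_real (mangoldt n * real n powr (- s)))) =
                 (\<lambda>n. of_nat (card X) * of_real (t s n))"
    proof
      fix n
      have "(\<Sum>\<omega>\<in>X. \<omega> b * (\<omega> n * of_real (mangoldt n * real n powr (- s)))) =
              (\<Sum>\<omega>\<in>X. \<omega> b * \<omega> n) * of_real (mangoldt n * real n powr (- s))"
        by (simp only: sum_distrib_right mult.assoc)
      also have "(\<Sum>\<omega>\<in>X. \<omega> b * \<omega> n) = (if [n = a] (mod m) then of_nat (card X) else 0)"
        unfolding X_def by (rule dirichlet_char_orthogonality[OF sep m0 cb ba])
      finally show "(\<Sum>\<omega>\<in>X. \<omega> b * (\<omega> n * of_real (mangoldt n * real n powr (- s)))) =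
                      of_nat (card X) * of_real (t s n)" by (simp add: t_def)
    qed
    finally have "(\<lambda>n. of_nat (card X) * of_real (t s n)) sums (\<Sum>\<omega>\<in>X. \<omega> b * L_mangoldt_series \<omega> s)" .
    moreover have "(\<lambda>n. of_nat (card X) * of_real (t s n)) sums (of_nat (card X) * complex_of_real (suminf (t s)))"
      by (intro sums_mult sums_of_real summable_sums st s)
    ultimately show ?thesis by (rule sums_unique2)
  qed
  have "\<forall>\<omega>\<in>X - {principal_char m}. \<exists>C. \<forall>\<^sub>F s in at_right 1. norm (L_mangoldt_series \<omega> s) \<le> C"
    using L_mangoldt_series_bounded[OF _ m] by (auto simp: X_def)
  then obtain C where C: "\<And>\<omega>. \<omega> \<in> X - {principal_char m} \<Longrightarrow>
      \<forall>\<^sub>F s in at_right 1. norm (L_mangoldt_series \<omega> s) \<le> C \<omega>"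
    by metis
  hence "\<forall>\<^sub>F s in at_right 1. \<forall>\<omega>\<in>X - {principal_char m}. norm (L_mangoldt_series \<omega> s) \<le> C \<omega>"
    using finX by (intro eventually_ball_finite) auto
  moreover define K where "K = (\<Sum>\<omega>\<in>X - {principal_char m}. C \<omega>) + real (card X) * C0 + 1"
  have "\<forall>\<^sub>F s in at_right 1. K \<le> Re (L_mangoldt_series (principal_char m) s)"
    by (rule L_mangoldt_series_principal_unbounded[OF m])
  moreover have "\<forall>\<^sub>F s in at_right 1. s > (1::real)" by (rule eventually_at_right_less)
  ultimately have "\<forall>\<^sub>F s in at_right (1::real). False"
  proof eventually_elim
    case (elim s)
    have pX: "principal_char m \<in> X" using dirichlet_char_principal[OF m0] by (simp add: X_def)
    have "- (\<Sum>\<omega>\<in>X - {principal_char m}. C \<omega>) \<le> - norm (\<Sum>\<omega>\<in>X - {principal_char m}. \<omega> b * L_mangoldt_series \<omega> s)"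
    proof -
      have "norm (\<Sum>\<omega>\<in>X - {principal_char m}. \<omega> b * L_mangoldt_series \<omega> s) \<le> (\<Sum>\<omega>\<in>X - {principal_char m}. C \<omega>)"
      proof (rule sum_norm_le)
        fix \<omega> assume w: "\<omega> \<in> X - {principal_char m}"
        have "norm (\<omega> b) = 1" using w norm_dirichlet_char[OF _ m0, of \<omega> b] cb by (simp add: X_def)
        thus "norm (\<omega> b * L_mangoldt_series \<omega> s) \<le> C \<omega>" using elim(1) w by (simp add: norm_mult)
      qed
      thus ?thesis by simp
    qed
    also have "\<dots> \<le> Re (\<Sum>\<omega>\<in>X - {principal_char m}. \<omega> b * L_mangoldt_series \<omega> s)"
      using abs_Re_le_cmod[of "\<Sum>\<omega>\<in>X - {principal_char m}. \<omega> b * L_mangoldt_series \<omega> s"] by linarith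
    finally have "K - (\<Sum>\<omega>\<in>X - {principal_char m}. C \<omega>) \<le> Re (\<Sum>\<omega>\<in>X. \<omega> b * L_mangoldt_series \<omega> s)"
      using elim(2) cb by (subst sum.remove[OF finX pX]) (simp add: principal_char_def)
    also have "\<dots> = real (card X) * suminf (t s)" by (subst key[OF elim(3)]) simp
    also have "\<dots> \<le> real (card X) * C0" using upper[OF elim(3)] by (intro mult_left_mono) auto
    finally show False by (simp add: K_def)
  qed
  thus False by simp
qed

corollary infinite_primes_cong_prime_modulus:
  fixes p :: nat
  assumes "prime p" "coprime a p"
  shows "infinite {r. prime r \<and> [r = a] (mod p)}"
  using infinite_primes_cong[OF separated_modulus_prime[OF assms(1)] _ assms(2)]
    prime_gt_1_nat[OF assms(1)] by blast

corollary infinite_primes_cong_semiprime_modulus: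
  fixes p q :: nat
  assumes "prime p" "prime q" "p \<noteq> q" "coprime a (p * q)"
  shows "infinite {r. prime r \<and> [r = a] (mod p * q)}"
proof (rule infinite_primes_cong)
  show "separated_modulus (p * q)"
    using assms primes_coprime prime_gt_0_nat by (intro separated_modulus_mult separated_modulus_prime) auto
  show "p * q > 1" using assms(1,2) prime_gt_1_nat[of p] prime_gt_1_nat[of q] less_1_mult by blast
qed fact

section \<open>The coefficients of ternary cyclotomic polynomials\<close>

abbreviation xpow1 :: "nat \<Rightarrow> int poly" where
  "xpow1 n \<equiv> monom 1 n - 1"

lemma prod_cyclotomic:
  assumes "n > 0"
  shows "(\<Prod>d | d dvd n. cyclotomic d) = xpow1 n"
proof -
  have "map_poly of_int (\<Prod>d | d dvd n. cyclotomic d) = (monom 1 n - 1 :: complex poly)"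
    by (simp add: map_poly_of_int_prod of_int_cyclotomic prod_complex_cyclotomic[OF assms])
  also have "\<dots> = map_poly of_int (xpow1 n)"
    by (intro poly_eqI) (simp add: coeff_map_poly coeff_1)
  finally show ?thesis by (simp only: map_poly_of_int_inject)
qed

lemma prod_divisors_mult_prime:
  fixes f :: "nat \<Rightarrow> 'a :: comm_monoid_mult"
  assumes "prime r" "\<not> r dvd n" "n > 0"
  shows "(\<Prod>d | d dvd n * r. f d) = (\<Prod>d | d dvd n. f d) * (\<Prod>d | d dvd n. f (d * r))"
proof -
  have eq: "{d. d dvd n * r} = {d. d dvd n} \<union> (\<lambda>d. d * r) ` {d. d dvd n}"
  proof (intro subset_antisym subsetI)
    fix d assume "d \<in> {d. d dvd n * r}"
    then obtain a b where ab: "d = a * b" "a dvd n" "b dvd r"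
      using division_decomp by blast
    moreover have "b = 1 \<or> b = r" using ab(3) assms(1) by (simp add: prime_nat_iff)
    ultimately show "d \<in> {d. d dvd n} \<union> (\<lambda>d. d * r) ` {d. d dvd n}" by auto
  qed auto
  have inj: "inj_on (\<lambda>d. d * r) {d. d dvd n}"
    using assms(1) by (auto simp: inj_on_def)
  have "(\<Prod>d | d dvd n * r. f d) = (\<Prod>d | d dvd n. f d) * (\<Prod>d\<in>(\<lambda>d. d * r) ` {d. d dvd n}. f d)"
    unfolding eq
  proof (rule prod.union_disjoint)
    show "{d. d dvd n} \<inter> (\<lambda>d. d * r) ` {d. d dvd n} = {}"
      using assms(2) by (auto dest: dvd_mult_right)
  qed (use assms(3) in auto)
  thus ?thesis by (simp add: prod.reindex[OF inj])
qed

lemma xpow1_nonzero: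
  assumes "n > 0"
  shows "xpow1 n \<noteq> 0"
proof
  assume "xpow1 n = 0"
  hence "coeff (xpow1 n) 0 = 0" by simp
  thus False using assms by simp
qed

lemma pcompose_monom: "pcompose (monom c k) (monom 1 r) = monom c (k * r)"
  for c :: "'a :: comm_semiring_1"
  by (induction k) (simp_all add: monom_0 monom_Suc pcompose_pCons mult_monom)

lemma xpow1_mult: "xpow1 (k * n) = xpow1 n * (\<Sum>j<k. monom 1 (j * n))"
proof -
  have "monom (1::int) (j * n) = monom 1 n ^ j" for j by (simp add: monom_power mult.commute)
  thus ?thesis using power_diff_1_eq[of "monom (1::int) n" k] by simp
qed

text \<open>Comparison of coefficients in \<open>x^c / (1 - x^k)\<close>: multiplying by
  \<open>1 - x^k\<close> leaves the single term \<open>x^c\<close>.\<close>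

lemma residue_count_step:
  assumes "k > (0::int)"
  shows "(if (c::int) \<le> z \<and> k dvd z - c then 1 else 0) =
           (if c \<le> z - k \<and> k dvd (z - k) - c then 1 else 0) + (if z = c then 1 else (0::int))"
proof -
  have dvd: "k dvd (z - k) - c \<longleftrightarrow> k dvd z - c"
    using dvd_add_left_iff[of k k "z - c - k"] by (simp add: algebra_simps)
  have "k \<le> z - c" if "k dvd z - c" "c \<le> z" "z \<noteq> c"
    using zdvd_imp_le[OF that(1)] that by simp
  thus ?thesis using assms unfolding dvd by auto
qed

locale three_primes =
  fixes p q r :: nat
  assumes p: "prime p" and q: "prime q" and r: "prime r" and pq: "p < q" and qr: "q < r"
begin

lemma pos: "p > 1" "q > 1" "r > 1"
  using p q r prime_gt_1_nat by auto

lemma not_dvd: "\<not> p dvd 1" "\<not> q dvd p" "\<not> r dvd p * q"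
  using p q r pq qr pos primes_dvd_imp_eq[of q p] primes_dvd_imp_eq[of r p] primes_dvd_imp_eq[of r q]
    prime_dvd_mult_iff[of r p q] by auto

text \<open>The divisor products give
  \<open>\<Phi> (x^p - 1) (x^q - 1) = (x^(pq) - 1) (x - 1)\<close>. Only \<open>x^p - 1\<close> is
  kept as a denominator: expanding its inverse turns coefficients into counts of residues modulo
  \<open>p\<close>.\<close>

lemma cyclotomic_pq_mult: "cyclotomic (p * q) * xpow1 p = (\<Sum>j<p. monom 1 (j * q)) * xpow1 1"
proof -
  have d1: "{d. d dvd Suc 0} = {1}" by auto
  have P: "(\<Prod>d | d dvd 1 * p. g d) = g 1 * g p" for g :: "nat \<Rightarrow> int poly"
    by (subst prod_divisors_mult_prime) (use p not_dvd in \<open>auto simp: d1\<close>)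
  have Q: "(\<Prod>d | d dvd 1 * q. g d) = g 1 * g q" for g :: "nat \<Rightarrow> int poly"
    by (subst prod_divisors_mult_prime) (use q pos in \<open>auto simp: d1\<close>)
  have PQ: "(\<Prod>d | d dvd p * q. g d) = (g 1 * g p) * (g q * g (p * q))" for g :: "nat \<Rightarrow> int poly"
    using prod_divisors_mult_prime[OF q not_dvd(2), of g] P[of g] P[of "\<lambda>d. g (d * q)"] pos by simp
  have "xpow1 1 = cyclotomic 1" using prod_cyclotomic[of 1] by (simp add: d1)
  moreover have "xpow1 p = cyclotomic 1 * cyclotomic p" using prod_cyclotomic[of p] P[of cyclotomic] pos by simp
  moreover have "xpow1 q = cyclotomic 1 * cyclotomic q" using prod_cyclotomic[of q] Q[of cyclotomic] pos by simp
  moreover have "xpow1 (p * q) = cyclotomic 1 * cyclotomic p * (cyclotomic q * cyclotomic (p * q))"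
    using prod_cyclotomic[of "p * q"] PQ[of cyclotomic] pos by simp
  ultimately have "cyclotomic (p * q) * (xpow1 p * xpow1 q) = xpow1 (p * q) * xpow1 1"
    by (simp only: mult_ac)
  also have "xpow1 (p * q) = xpow1 q * (\<Sum>j<p. monom 1 (j * q))" by (rule xpow1_mult)
  finally have "xpow1 q * (cyclotomic (p * q) * xpow1 p) = xpow1 q * ((\<Sum>j<p. monom 1 (j * q)) * xpow1 1)"
    by (simp only: mult_ac)
  thus ?thesis using xpow1_nonzero[of q] pos by simp
qed

text \<open>In essence the coefficients of \<open>\<Phi>\<close> for \<open>p q r\<close> arise by
  dividing \<open>\<Phi>\<close> for \<open>p q\<close> at \<open>x^r\<close> by the same at
  \<open>x\<close>. Each \<open>x^d - 1\<close> is written as a product of cyclotomic polynomials;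
  commutativity and cancellation of nonzero factors do the rest.\<close>

lemma cyclotomic_pqr_mult:
  "cyclotomic (p * q * r) * xpow1 (p * q) =
     pcompose (cyclotomic (p * q)) (monom 1 r) * ((\<Sum>m<p. monom 1 m) * xpow1 q)"
proof -
  define R where "R = pcompose (cyclotomic (p * q)) (monom 1 r)"
  have d1: "{d. d dvd Suc 0} = {1}" by auto
  have P1: "(\<Prod>d | d dvd 1 * p. g d) = g 1 * g p" if "prime p" for g :: "nat \<Rightarrow> int poly" and p
    by (subst prod_divisors_mult_prime) (use that in \<open>auto simp: d1\<close>)
  have P2: "(\<Prod>d | d dvd p * q. g d) = g 1 * g p * (g q * g (p * q))"
    if "prime p" "prime q" "p \<noteq> q" for g :: "nat \<Rightarrow> int poly" and p q
  proof -
    have "\<not> q dvd p" using primes_dvd_imp_eq[of q p] that by auto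
    thus ?thesis
      using prod_divisors_mult_prime[OF that(2), of p g] P1[OF that(1), of g]
        P1[OF that(1), of "\<lambda>d. g (d * q)"] prime_gt_0_nat[OF that(1)] by simp
  qed
  have x1: "xpow1 1 = cyclotomic 1" using prod_cyclotomic[of 1] by (simp add: d1)
  have xp: "xpow1 p' = cyclotomic 1 * cyclotomic p'" if "prime p'" for p'
    using prod_cyclotomic[of p'] P1[OF that, of cyclotomic] prime_gt_0_nat[OF that] by simp
  have xpq: "xpow1 (p' * q') = cyclotomic 1 * cyclotomic p' * (cyclotomic q' * cyclotomic (p' * q'))"
    if "prime p'" "prime q'" "p' \<noteq> q'" for p' q'
    using prod_cyclotomic[of "p' * q'"] P2[OF that, of cyclotomic] prime_gt_0_nat[OF that(1)] prime_gt_0_nat[OF that(2)]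
    by simp
  have xpqr: "xpow1 (p * q * r) = cyclotomic 1 * cyclotomic p * (cyclotomic q * cyclotomic (p * q)) *
      (cyclotomic r * cyclotomic (p * r) * (cyclotomic (q * r) * cyclotomic (p * q * r)))"
    using prod_cyclotomic[of "p * q * r"] prod_divisors_mult_prime[OF r not_dvd(3), of cyclotomic]
      P2[of p q cyclotomic] P2[of p q "\<lambda>d. cyclotomic (d * r)"] p q pq pos by simp
  have ne: "p \<noteq> q" "p \<noteq> r" "q \<noteq> r" using pq qr by auto
  have full: "cyclotomic (p * q * r) * (xpow1 (p * q) * xpow1 (p * r) * xpow1 (q * r) * xpow1 1) =
                xpow1 (p * q * r) * xpow1 p * xpow1 q * xpow1 r"
    unfolding x1 xp[OF p] xp[OF q] xp[OF r] xpq[OF p q ne(1)] xpq[OF p r ne(2)] xpq[OF q r ne(3)] xpqr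
    by (simp only: mult_ac)
  have "cyclotomic (p * q) * (xpow1 p * xpow1 q) = xpow1 (p * q) * xpow1 1"
    unfolding x1 xp[OF p] xp[OF q] xpq[OF p q ne(1)] by (simp only: mult_ac)
  hence "pcompose (cyclotomic (p * q) * (xpow1 p * xpow1 q)) (monom 1 r) = pcompose (xpow1 (p * q) * xpow1 1) (monom 1 r)"
    by simp
  hence "R * (xpow1 (p * r) * xpow1 (q * r)) = xpow1 (p * q * r) * xpow1 r"
    by (simp add: R_def pcompose_mult pcompose_diff pcompose_monom pcompose_1)
  hence R: "xpow1 (p * q * r) * xpow1 r = R * (xpow1 (p * r) * xpow1 (q * r))" by simp
  have "(xpow1 (p * r) * xpow1 (q * r)) * (cyclotomic (p * q * r) * (xpow1 (p * q) * xpow1 1)) =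
          cyclotomic (p * q * r) * (xpow1 (p * q) * xpow1 (p * r) * xpow1 (q * r) * xpow1 1)"
    by (simp only: mult_ac)
  also have "\<dots> = (xpow1 (p * q * r) * xpow1 r) * (xpow1 p * xpow1 q)"
    unfolding full by (simp only: mult_ac)
  also have "\<dots> = (xpow1 (p * r) * xpow1 (q * r)) * (R * (xpow1 p * xpow1 q))"
    unfolding R by (simp only: mult_ac)
  finally have eq: "(xpow1 (p * r) * xpow1 (q * r)) * (cyclotomic (p * q * r) * (xpow1 (p * q) * xpow1 1)) =
      (xpow1 (p * r) * xpow1 (q * r)) * (R * (xpow1 p * xpow1 q))" .
  have "xpow1 (p * r) * xpow1 (q * r) \<noteq> 0"
    using xpow1_nonzero pos by simp
  from iffD1[OF mult_left_cancel[OF this] eq]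
  have "cyclotomic (p * q * r) * (xpow1 (p * q) * xpow1 1) = R * (xpow1 p * xpow1 q)" .
  also have "xpow1 p = xpow1 1 * (\<Sum>m<p. monom 1 m)" using xpow1_mult[of p 1] by simp
  finally have "xpow1 1 * (cyclotomic (p * q * r) * xpow1 (p * q)) = xpow1 1 * (R * ((\<Sum>m<p. monom 1 m) * xpow1 q))"
    by (simp only: mult_ac)
  from iffD1[OF mult_left_cancel[OF xpow1_nonzero[of 1]] this] show ?thesis by (simp add: R_def)
qed

text \<open>The coefficient of \<open>x^z\<close> in
  \<open>(1 - x) (1 + x^q + ... + x^((p-1)q)) / (1 - x^p)\<close>. The argument is an integer
  because windows may start at negative positions.\<close>

definition pq_coeff :: "int \<Rightarrow> int" where
  "pq_coeff z = (\<Sum>j<p. (if int (j * q) \<le> z \<and> int p dvd z - int (j * q) then 1 else 0) -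
                 (if int (j * q) + 1 \<le> z \<and> int p dvd z - int (j * q) - 1 then 1 else 0))"

lemma pq_coeff_neg:
  assumes "z < 0"
  shows "pq_coeff z = 0"
  unfolding pq_coeff_def
proof (intro sum.neutral ballI)
  fix j
  have "0 \<le> int (j * q)" by simp
  hence "\<not> int (j * q) \<le> z" "\<not> int (j * q) + 1 \<le> z" using assms by linarith+
  thus "(if int (j * q) \<le> z \<and> int p dvd z - int (j * q) then 1 else 0) -
        (if int (j * q) + 1 \<le> z \<and> int p dvd z - int (j * q) - 1 then 1 else 0) = (0::int)"
    by simp
qed

lemma pq_coeff_step:
  "pq_coeff z = pq_coeff (z - int p) + (\<Sum>j<p. (if z = int (j * q) then 1 else 0) - (if z = int (j * q) + 1 then 1 else 0))"
proof -
  have "int p > 0" using pos by simp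
  show ?thesis
    unfolding pq_coeff_def sum.distrib[symmetric]
  proof (rule sum.cong, rule refl)
    fix j
    show "(if int (j * q) \<le> z \<and> int p dvd z - int (j * q) then 1 else 0) -
          (if int (j * q) + 1 \<le> z \<and> int p dvd z - int (j * q) - 1 then 1 else 0) =
          (if int (j * q) \<le> z - int p \<and> int p dvd z - int p - int (j * q) then 1 else 0) -
          (if int (j * q) + 1 \<le> z - int p \<and> int p dvd z - int p - int (j * q) - 1 then 1 else 0) +
          ((if z = int (j * q) then 1 else 0) - (if z = int (j * q) + 1 then 1 else (0::int)))"
      using residue_count_step[OF \<open>int p > 0\<close>, of "int (j * q)" z]
        residue_count_step[OF \<open>int p > 0\<close>, of "int (j * q) + 1" z]
      by (simp only: diff_diff_add[symmetric])
  qed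
qed

lemma coeff_cyclotomic_pq: "coeff (cyclotomic (p * q)) i = pq_coeff (int i)"
proof (induction i rule: less_induct)
  case (less i)
  let ?A = "coeff (cyclotomic (p * q))"
  have "coeff (cyclotomic (p * q) * xpow1 p) i = (if i < p then 0 else ?A (i - p)) - ?A i"
    by (simp add: right_diff_distrib coeff_monom_mult mult.commute[of _ "monom 1 p"])
  moreover have "coeff ((\<Sum>j<p. monom 1 (j * q)) * xpow1 1) i =
      (\<Sum>j<p. (if int i = int (j * q) + 1 then 1 else 0) - (if int i = int (j * q) then 1 else 0))"
  proof -
    have c: "int i = int (j * q) \<longleftrightarrow> i = j * q" "int i = int (j * q) + 1 \<longleftrightarrow> i = Suc (j * q)" for j
      by linarith+
    show ?thesis
      unfolding sum_distrib_right coeff_sum c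
      by (intro sum.cong refl) (auto simp: right_diff_distrib mult_monom)
  qed
  ultimately have "?A i = (if i < p then 0 else ?A (i - p)) +
      (\<Sum>j<p. (if int i = int (j * q) then 1 else 0) - (if int i = int (j * q) + 1 then 1 else 0))"
    unfolding cyclotomic_pq_mult sum_subtractf by simp
  also have "(if i < p then 0 else ?A (i - p)) = pq_coeff (int i - int p)"
    using less.IH[of "i - p"] pos pq_coeff_neg[of "int i - int p"] by (auto simp: of_nat_diff)
  finally show ?case using pq_coeff_step[of "int i"] by simp
qed

text \<open>The coefficients of \<open>(1 + x + \<dots> + x\<^bsup>p-1\<^esup>) (1 - x\<^bsup>q\<^esup>)\<close>.\<close>

definition G :: "nat \<Rightarrow> int" where
  "G k = (if k < p then 1 else 0) - (if q \<le> k \<and> k < q + p then 1 else 0)"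

lemma pq_le: "q + p \<le> p * q"
proof -
  obtain p' q' where "p = p' + 2" "q = q' + 2"
    using pos by (metis Suc_1 Suc_leI add.commute le_Suc_ex)
  thus ?thesis by simp
qed

text \<open>Dividing by \<open>1 - x^(pq)\<close> repeats \<open>G\<close>, whose support lies below
  \<open>p * q\<close>, with period \<open>p * q\<close>; the restriction to
  \<open>i \<le> n div r\<close> remains because exponents are nonnegative. Both sides obey the same
  recurrence with step \<open>p * q\<close>.\<close>

lemma coeff_cyclotomic_pqr:
  "coeff (cyclotomic (p * q * r)) n = (\<Sum>i\<le>n div r. pq_coeff (int i) * G ((n - r * i) mod (p * q)))"
proof -
  let ?C = "coeff (cyclotomic (p * q * r))"
  define c where "c n = (\<Sum>i\<le>n div r. pq_coeff (int i) * G ((n - r * i) mod (p * q)))" for n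
  define D where "D = degree (cyclotomic (p * q))"
  define V where "V = (\<Sum>m<p. monom 1 m) * xpow1 q"
  have V: "coeff V k = - G k" for k
  proof -
    have S: "coeff (\<Sum>m<p. monom (1::int) m) k = (if k < p then 1 else 0)" for k
      by (simp add: coeff_sum)
    show ?thesis
      unfolding V_def by (auto simp: right_diff_distrib coeff_monom_mult mult.commute[of _ "monom 1 q"] S G_def)
  qed
  have "pcompose (cyclotomic (p * q)) (monom 1 r) = (\<Sum>i\<le>D. monom (pq_coeff (int i)) (r * i))"
    by (subst poly_as_sum_of_monoms[of "cyclotomic (p * q)", symmetric])
       (simp add: pcompose_sum pcompose_monom coeff_cyclotomic_pq D_def mult.commute)
  hence prod: "cyclotomic (p * q * r) * xpow1 (p * q) = (\<Sum>i\<le>D. monom (pq_coeff (int i)) (r * i)) * V"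
    unfolding V_def cyclotomic_pqr_mult by simp
  have rec: "?C n = (if n < p * q then 0 else ?C (n - p * q)) + (\<Sum>i\<le>n div r. pq_coeff (int i) * G (n - r * i))" for n
  proof -
    have "coeff (cyclotomic (p * q * r) * xpow1 (p * q)) n = (if n < p * q then 0 else ?C (n - p * q)) - ?C n"
      by (simp add: right_diff_distrib coeff_monom_mult mult.commute[of _ "monom 1 (p * q)"])
    moreover have "coeff ((\<Sum>i\<le>D. monom (pq_coeff (int i)) (r * i)) * V) n = - (\<Sum>i\<le>n div r. pq_coeff (int i) * G (n - r * i))"
    proof -
      have "coeff ((\<Sum>i\<le>D. monom (pq_coeff (int i)) (r * i)) * V) n =
              (\<Sum>i\<le>D. if n < r * i then 0 else - (pq_coeff (int i) * G (n - r * i)))"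
        unfolding sum_distrib_right coeff_sum coeff_monom_mult V by (intro sum.cong) auto
      also have "\<dots> = (\<Sum>i\<le>n div r. - (pq_coeff (int i) * G (n - r * i)))"
      proof (rule sum.mono_neutral_cong)
        fix i assume "i \<in> {..n div r} - {..D}"
        hence "pq_coeff (int i) = 0"
          using coeff_eq_0[of "cyclotomic (p * q)" i] by (auto simp: D_def coeff_cyclotomic_pq)
        thus "- (pq_coeff (int i) * G (n - r * i)) = 0" by simp
      next
        fix i assume "i \<in> {..D} - {..n div r}"
        hence "n < r * i" using pos by (simp add: div_less_iff_less_mult mult.commute not_le)
        thus "(if n < r * i then 0 else - (pq_coeff (int i) * G (n - r * i))) = 0" by simp
      next
        fix i assume "i \<in> {..D} \<inter> {..n div r}"
        hence "\<not> n < r * i" using pos by (simp add: less_eq_div_iff_mult_less_eq mult.commute)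
        thus "(if n < r * i then 0 else - (pq_coeff (int i) * G (n - r * i))) = - (pq_coeff (int i) * G (n - r * i))" by simp
      qed auto
      also have "\<dots> = - (\<Sum>i\<le>n div r. pq_coeff (int i) * G (n - r * i))" by (rule sum_negf)
      finally show ?thesis .
    qed
    ultimately show ?thesis unfolding prod by linarith
  qed
  have "?C n = c n"
  proof (induction n rule: less_induct)
    case (less n)
    have "c n = (\<Sum>i\<le>n div r. (if n - r * i < p * q then 0 else pq_coeff (int i) * G ((n - p * q - r * i) mod (p * q))) +
                   pq_coeff (int i) * G (n - r * i))"
      unfolding c_def
    proof (rule sum.cong, rule refl)
      fix i assume "i \<in> {..n div r}"
      show "pq_coeff (int i) * G ((n - r * i) mod (p * q)) =
          (if n - r * i < p * q then 0 else pq_coeff (int i) * G ((n - p * q - r * i) mod (p * q))) + pq_coeff (int i) * G (n - r * i)"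
      proof (cases "n - r * i < p * q")
        case False
        hence "(n - r * i) mod (p * q) = (n - r * i - p * q) mod (p * q)" by (simp add: le_mod_geq)
        moreover have "n - r * i - p * q = n - p * q - r * i" by simp
        moreover have "G (n - r * i) = 0" using False pq_le by (auto simp: G_def)
        ultimately show ?thesis using False by simp
      qed simp
    qed
    also have "\<dots> = (\<Sum>i\<le>n div r. if n - r * i < p * q then 0 else pq_coeff (int i) * G ((n - p * q - r * i) mod (p * q))) +
                      (\<Sum>i\<le>n div r. pq_coeff (int i) * G (n - r * i))"
      by (rule sum.distrib)
    also have "(\<Sum>i\<le>n div r. if n - r * i < p * q then 0 else pq_coeff (int i) * G ((n - p * q - r * i) mod (p * q))) =
                 (if n < p * q then 0 else c (n - p * q))"
    proof (cases "n < p * q")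
      case False
      have "(\<Sum>i\<le>n div r. if n - r * i < p * q then 0 else pq_coeff (int i) * G ((n - p * q - r * i) mod (p * q))) =
              (\<Sum>i\<le>(n - p * q) div r. pq_coeff (int i) * G ((n - p * q - r * i) mod (p * q)))"
      proof (rule sum.mono_neutral_cong_right)
        show "{..(n - p * q) div r} \<subseteq> {..n div r}" by (auto intro: order_trans[OF _ div_le_mono])
        show "\<forall>i\<in>{..n div r} - {..(n - p * q) div r}.
            (if n - r * i < p * q then 0 else pq_coeff (int i) * G ((n - p * q - r * i) mod (p * q))) = 0"
        proof
          fix i assume i: "i \<in> {..n div r} - {..(n - p * q) div r}"
          hence "n - p * q < r * i" using pos by (simp add: div_less_iff_less_mult mult.commute not_le)
          hence "n - r * i < p * q" using False pos pq_le by linarith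
          thus "(if n - r * i < p * q then 0 else pq_coeff (int i) * G ((n - p * q - r * i) mod (p * q))) = 0" by simp
        qed
        fix i assume i: "i \<in> {..(n - p * q) div r}"
        hence "r * i \<le> n - p * q" using pos by (simp add: less_eq_div_iff_mult_less_eq mult.commute)
        hence "\<not> n - r * i < p * q" using False by linarith
        thus "(if n - r * i < p * q then 0 else pq_coeff (int i) * G ((n - p * q - r * i) mod (p * q))) =
            pq_coeff (int i) * G ((n - p * q - r * i) mod (p * q))" by simp
      qed auto
      thus ?thesis using False by (simp add: c_def)
    next
      case True
      thus ?thesis by (auto intro!: sum.neutral)
    qed
    also have "(if n < p * q then 0 else c (n - p * q)) = (if n < p * q then 0 else ?C (n - p * q))"
      using less.IH[of "n - p * q"] pos pq_le by auto
    finally show ?case using rec[of n] by simp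
  qed
  thus ?thesis by (simp add: c_def)
qed

end

section \<open>Sums over windows\<close>

lemma mult_le_div_iff:
  fixes b :: int
  assumes "b > 0"
  shows "x * b \<le> y \<longleftrightarrow> x \<le> y div b"
proof
  assume "x * b \<le> y"
  from zdiv_mono1[OF this assms] show "x \<le> y div b" using assms by simp
next
  assume "x \<le> y div b"
  hence "x * b \<le> y div b * b" using assms by (intro mult_right_mono) auto
  also have "\<dots> \<le> y" using div_mult_mod_eq[of y b] pos_mod_sign[OF assms, of y] by linarith
  finally show "x * b \<le> y" .
qed

text \<open>The role of \<open>a\<close> is played by the coefficients of \<open>\<Phi>\<^bsub>pq\<^esub>\<close>, extended by \<open>0\<close> to negative
  arguments. On the block \<open>[(k - 1) q, k q)\<close> they depend only on \<open>z\<close> modulo \<open>p\<close>, and multiplication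
  by \<open>\<sigma>\<close>, the inverse of \<open>q\<close> (and \<open>s\<close>) modulo \<open>p\<close>, turns the residues \<open>0, q, \<dots>, (k - 1) q\<close> into the
  interval \<open>[0, k)\<close>.\<close>

locale window =
  fixes p q s :: int and \<sigma> :: nat and a :: "int \<Rightarrow> int"
  assumes \<sigma>: "1 \<le> \<sigma>" "2 * int \<sigma> + 1 \<le> p" and s: "1 \<le> s" "p dvd s * int \<sigma> - 1"
    and qs: "p dvd q - s" "s * p < q"
    and a_eq: "\<And>k z. \<lbrakk>0 \<le> k; k \<le> p; k = 0 \<or> (k - 1) * q \<le> z; k = p \<or> z < k * q\<rbrakk> \<Longrightarrow>
      a z = (if (int \<sigma> * z) mod p < k then 1 else 0) - (if (int \<sigma> * z - int \<sigma>) mod p < k then 1 else 0)"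
begin

definition I :: "int \<Rightarrow> int \<Rightarrow> int" where
  "I k x = (if x mod p < k then 1 else 0)"

text \<open>By telescoping, a sum of \<open>I k x - I k (x - \<sigma>)\<close> over an interval of integers \<open>x\<close> is a
  difference of two values of \<open>H k\<close>, hence at most \<open>\<sigma>\<close> in modulus. Passing from block \<open>k\<close> to
  block \<open>k + 1\<close> inside the interval costs one value of \<open>J\<close>.\<close>

definition H :: "int \<Rightarrow> int \<Rightarrow> int" where
  "H k y = (\<Sum>i<\<sigma>. I k (y - 1 - int i))"

text \<open>As \<open>\<sigma> < p\<close>, this is the indicator of
  \<open>w mod p \<in> {1..\<sigma>}\<close>, written as a sum so that \<open>H_Suc\<close> holds
  term by term.\<close>

definition J :: "int \<Rightarrow> int" where
  "J w = (\<Sum>i<\<sigma>. if p dvd w - 1 - int i then 1 else 0)"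

lemma p_pos: "p > 0" using \<sigma> by linarith

lemma I_cong: "[x = y] (mod p) \<Longrightarrow> I k x = I k y"
  by (simp add: I_def cong_def)

lemma H_cong: "[x = y] (mod p) \<Longrightarrow> H k x = H k y"
  unfolding H_def by (intro sum.cong refl I_cong cong_diff) auto

lemma J_cong:
  assumes "[x = y] (mod p)"
  shows "J x = J y"
proof -
  have "p dvd x - 1 - int i \<longleftrightarrow> p dvd y - 1 - int i" for i
    using cong_dvd_iff[of "x - 1 - int i" "y - 1 - int i" p] cong_diff[OF cong_diff[OF assms cong_refl] cong_refl]
    by blast
  thus ?thesis unfolding J_def by simp
qed

lemma H_step: "H k (y + 1) = H k y + I k y - I k (y - int \<sigma>)"
proof -
  have "(\<Sum>i<Suc \<sigma>. I k (y - int i)) = I k y + (\<Sum>i<\<sigma>. I k (y - 1 - int i))"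
    by (subst sum.lessThan_Suc_shift) (simp add: algebra_simps)
  moreover have "H k (y + 1) = (\<Sum>i<\<sigma>. I k (y - int i))" by (simp add: H_def)
  ultimately show ?thesis by (simp add: H_def)
qed

lemma H_bounds: "0 \<le> H k y" "H k y \<le> int \<sigma>"
proof -
  show "0 \<le> H k y" unfolding H_def by (intro sum_nonneg) (simp add: I_def)
  have "H k y \<le> (\<Sum>i<\<sigma>. 1)" unfolding H_def by (intro sum_mono) (simp add: I_def)
  thus "H k y \<le> int \<sigma>" by simp
qed

lemma inj_residues: "inj_on (\<lambda>i. (y - int i) mod p) {..<\<sigma>}"
proof (rule inj_onI)
  fix i j assume ij: "i \<in> {..<\<sigma>}" "j \<in> {..<\<sigma>}" "(y - int i) mod p = (y - int j) mod p"
  hence "p dvd (y - int i) - (y - int j)" by (simp add: mod_eq_dvd_iff)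
  hence d: "p dvd int j - int i" by simp
  have "\<bar>int j - int i\<bar> < p" using ij(1,2) \<sigma> by auto
  hence "int j - int i = 0" using d dvd_imp_le_int[of "int j - int i" p] by force
  thus "i = j" by simp
qed

text \<open>Pigeonhole: the \<open>\<sigma>\<close> consecutive integers counted by \<open>H\<close>
  have distinct residues, all of which must fit below \<open>k\<close>. This later restricts the
  block numbers of extreme coefficients.\<close>

lemma H_eq_max:
  assumes "H k y = int \<sigma>"
  shows "int \<sigma> \<le> k"
proof -
  have one: "I k (y - 1 - int i) = 1" if "i < \<sigma>" for i
  proof (rule ccontr)
    assume "I k (y - 1 - int i) \<noteq> 1"
    hence 0: "I k (y - 1 - int i) = 0" by (auto simp: I_def split: if_splits)
    have "H k y < (\<Sum>i<\<sigma>. 1)"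
      unfolding H_def by (rule sum_strict_mono_ex1) (use that 0 in \<open>auto simp: I_def intro!: bexI[of _ i]\<close>)
    thus False using assms by simp
  qed
  have "(y - 1 - int i) mod p < k" if "i < \<sigma>" for i
    using one[OF that] by (simp add: I_def split: if_splits)
  hence "(\<lambda>i. (y - 1 - int i) mod p) ` {..<\<sigma>} \<subseteq> {0..<k}" using p_pos by auto
  hence "card {..<\<sigma>} \<le> card {0..<k}"
    by (intro card_inj_on_le[OF inj_residues]) auto
  thus ?thesis using \<sigma>(1) by simp
qed

lemma H_eq_0:
  assumes "H k y = 0" "0 \<le> k" "k \<le> p"
  shows "k \<le> p - int \<sigma>"
proof -
  have "I k (y - 1 - int i) = 0" if "i < \<sigma>" for i
    using assms(1) that unfolding H_def by (subst (asm) sum_nonneg_eq_0_iff) (auto simp: I_def)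
  hence "(y - 1 - int i) mod p \<ge> k" if "i < \<sigma>" for i
    using that by (fastforce simp: I_def split: if_splits)
  hence "(\<lambda>i. (y - 1 - int i) mod p) ` {..<\<sigma>} \<subseteq> {k..<p}" using p_pos by auto
  hence "card {..<\<sigma>} \<le> card {k..<p}"
    by (intro card_inj_on_le[OF inj_residues]) auto
  thus ?thesis using assms(2,3) by simp
qed

lemma H_Suc:
  assumes "0 \<le> k" "k < p"
  shows "H (k + 1) y = H k y + J (y - k)"
proof -
  have "I (k + 1) x = I k x + (if p dvd x - k then 1 else 0)" for x
  proof -
    have "p dvd x - k \<longleftrightarrow> x mod p = k"
      using assms by (metis mod_eq_dvd_iff mod_pos_pos_trivial)
    thus ?thesis by (auto simp: I_def)
  qed
  thus ?thesis unfolding H_def J_def sum.distrib[symmetric] by (simp add: algebra_simps)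
qed

lemma J_bounds: "0 \<le> J w" "J w \<le> 1"
proof -
  show "0 \<le> J w" unfolding J_def by (intro sum_nonneg) simp
  have "card {i \<in> {..<\<sigma>}. p dvd w - 1 - int i} \<le> Suc 0"
  proof (subst card_le_Suc0_iff_eq, simp, intro ballI)
    fix i j assume *: "i \<in> {i \<in> {..<\<sigma>}. p dvd w - 1 - int i}" "j \<in> {i \<in> {..<\<sigma>}. p dvd w - 1 - int i}"
    hence "(w - 1 - int i) mod p = (w - 1 - int j) mod p" by (auto simp: dvd_eq_mod_eq_0)
    thus "i = j" using inj_onD[OF inj_residues[of "w - 1"], of i j] * by auto
  qed
  thus "J w \<le> 1" unfolding J_def by (simp add: sum.If_cases Int_def)
qed

text \<open>Residue 0 lies outside \<open>{1..\<sigma>}\<close>. This rules out the surplus 1 when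
  \<open>s = 1\<close>.\<close>

lemma J_eq_0:
  assumes "p dvd w"
  shows "J w = 0"
  unfolding J_def
proof (intro sum.neutral ballI)
  fix i assume i: "i \<in> {..<\<sigma>}"
  have "\<not> p dvd w - 1 - int i"
  proof
    assume "p dvd w - 1 - int i"
    hence "p dvd w - (w - 1 - int i)" using assms by (rule dvd_diff[rotated])
    hence "p dvd 1 + int i" by simp
    hence "p \<le> 1 + int i" by (rule zdvd_imp_le) simp
    thus False using i \<sigma> by auto
  qed
  thus "(if p dvd w - 1 - int i then 1 else 0) = (0::int)" by simp
qed

definition W :: "int \<Rightarrow> int \<Rightarrow> int" where
  "W N t = (\<Sum>m<nat p. if N + s * int m \<le> t then a (N + s * int m) else 0)"

definition seg :: "int \<Rightarrow> nat \<Rightarrow> nat \<Rightarrow> int" where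
  "seg N M M' = (\<Sum>m\<in>{M..<M'}. a (N + s * int m))"

text \<open>Since \<open>s \<ge> 1\<close> the arguments increase with \<open>m\<close>, so the
  cutoff keeps an initial segment. The further conclusions fix its length when the cutoff precedes
  the window, leaves it complete, or falls on a given position.\<close>

lemma W_eq_seg:
  obtains M where "M \<le> nat p" "W N t = seg N 0 M" "t < N \<Longrightarrow> M = 0" "N + s * (p - 1) \<le> t \<Longrightarrow> M = nat p"
    "\<And>M'. t = N + s * (int M' - 1) \<Longrightarrow> M' \<le> nat p \<Longrightarrow> M = M'"
proof -
  define M where "M = min (nat p) (nat ((t - N) div s + 1))"
  have iff: "m < M \<longleftrightarrow> m < nat p \<and> N + s * int m \<le> t" for m
  proof -
    have "N + s * int m \<le> t \<longleftrightarrow> int m * s \<le> t - N" by (auto simp: algebra_simps)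
    also have "\<dots> \<longleftrightarrow> int m \<le> (t - N) div s" using s(1) by (intro mult_le_div_iff) auto
    finally show ?thesis unfolding M_def by (auto simp: zless_nat_eq_int_zless)
  qed
  show thesis
  proof (rule that)
    show "M \<le> nat p" by (simp add: M_def)
    have "W N t = (\<Sum>m\<in>{m \<in> {..<nat p}. N + s * int m \<le> t}. a (N + s * int m))"
      unfolding W_def by (rule sum.inter_filter[symmetric]) simp
    also have "{m \<in> {..<nat p}. N + s * int m \<le> t} = {0..<M}"
      by (rule Set.set_eqI) (simp only: mem_Collect_eq lessThan_iff atLeastLessThan_iff iff le0 simp_thms)
    finally show "W N t = seg N 0 M" by (simp add: seg_def)
    show "M = 0" if "t < N" using iff[of 0] that by auto
    show "M = nat p" if "N + s * (p - 1) \<le> t"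
    proof -
      have "nat p - 1 < M" using iff[of "nat p - 1"] that p_pos by (simp add: of_nat_diff)
      thus ?thesis using \<open>M \<le> nat p\<close> by linarith
    qed
    fix M' assume t: "t = N + s * (int M' - 1)" and M': "M' \<le> nat p"
    have meq: "m < M \<longleftrightarrow> m < M'" for m
    proof -
      have "N + s * int m \<le> t \<longleftrightarrow> int m \<le> int M' - 1"
        unfolding t using s(1) by simp
      thus ?thesis using iff[of m] M' by auto
    qed
    show "M = M'" using meq[of M] meq[of M'] by auto
  qed
qed

text \<open>\<open>\<sigma> * s\<close> is 1 modulo \<open>p\<close>, so scaling by
  \<open>\<sigma>\<close> turns the step \<open>s\<close> into the step 1 and \<open>H_step\<close>
  telescopes.\<close>

lemma seg_pure:
  assumes "M \<le> M'"
    and "\<And>m. M \<le> m \<Longrightarrow> m < M' \<Longrightarrow> a (N + s * int m) = I k (int \<sigma> * (N + s * int m)) - I k (int \<sigma> * (N + s * int m) - int \<sigma>)"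
  shows "seg N M M' = H k (int \<sigma> * N + int M') - H k (int \<sigma> * N + int M)"
  using assms
proof (induction M' rule: dec_induct)
  case (step m)
  have cong: "[int \<sigma> * (N + s * int m) = int \<sigma> * N + int m] (mod p)"
  proof -
    have "int \<sigma> * (N + s * int m) - (int \<sigma> * N + int m) = (s * int \<sigma> - 1) * int m"
      by (simp add: algebra_simps)
    thus ?thesis using s(2) by (metis cong_iff_dvd_diff dvd_mult2)
  qed
  have "seg N M (Suc m) = seg N M m + a (N + s * int m)"
    using step(1) by (simp add: seg_def)
  also have "a (N + s * int m) = I k (int \<sigma> * N + int m) - I k (int \<sigma> * N + int m - int \<sigma>)"
    using step.prems[of m] I_cong[OF cong, of k] I_cong[OF cong_diff[OF cong cong_refl], of k "int \<sigma>"]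
      step(1) by simp
  also have "seg N M m = H k (int \<sigma> * N + int m) - H k (int \<sigma> * N + int M)"
    by (rule step.IH) (use step.prems in auto)
  finally show ?case using H_step[of k "int \<sigma> * N + int m"] by (simp add: algebra_simps)
qed (simp add: seg_def)

end

text \<open>The arguments \<open>N + s m\<close> with \<open>m < p\<close> span less than one block. They start in block \<open>\<kappa>\<close>
  (arguments below \<open>\<kappa> q\<close>) and reach block \<open>\<kappa> + 1\<close> at \<open>m = L\<close>.\<close>

locale positioned_window = window +
  fixes \<kappa> \<rho> :: int
  assumes \<kappa>: "0 \<le> \<kappa>" "\<kappa> < p" and \<rho>: "0 \<le> \<rho>" "\<rho> < q"
begin

text \<open>The last term of the window is one step \<open>s\<close> short of
  \<open>\<kappa> * q + \<rho>\<close>. If \<open>\<rho> \<ge> s * p\<close>, the window lies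
  entirely in the later block, and \<open>nat\<close> makes \<open>L = 0\<close>.\<close>

definition N :: int where "N = \<kappa> * q - s * p + \<rho>"
definition L :: nat where "L = nat (p - \<rho> div s)"

lemma crossing: "\<kappa> * q \<le> N + s * int m \<longleftrightarrow> L \<le> m"
proof -
  have "\<kappa> * q \<le> N + s * int m \<longleftrightarrow> (p - int m) * s \<le> \<rho>" by (simp add: N_def algebra_simps)
  also have "\<dots> \<longleftrightarrow> p - int m \<le> \<rho> div s" using s(1) by (intro mult_le_div_iff) auto
  also have "\<dots> \<longleftrightarrow> L \<le> m" unfolding L_def by linarith
  finally show ?thesis .
qed

lemma L_le: "L \<le> nat p"
  using \<rho>(1) s(1) pos_imp_zdiv_nonneg_iff[of s \<rho>] unfolding L_def by auto

text \<open>\<open>\<sigma> * q\<close> is congruent to \<open>\<sigma> * s\<close>, hence to 1,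
  modulo \<open>p\<close>.\<close>

lemma sigma_N: "[int \<sigma> * N = \<kappa> + int \<sigma> * \<rho>] (mod p)"
proof -
  have "int \<sigma> * N - (\<kappa> + int \<sigma> * \<rho>) = \<kappa> * (int \<sigma> * (q - s) + (s * int \<sigma> - 1)) - p * (int \<sigma> * s)"
    by (simp add: N_def algebra_simps)
  also have "p dvd \<dots>"
    by (intro dvd_diff dvd_mult[OF dvd_add[OF dvd_mult[OF qs(1)] s(2)]] dvd_triv_left)
  finally show ?thesis by (simp add: cong_iff_dvd_diff)
qed

lemma a_below:
  assumes "m < L"
  shows "a (N + s * int m) = I \<kappa> (int \<sigma> * (N + s * int m)) - I \<kappa> (int \<sigma> * (N + s * int m) - int \<sigma>)"
  unfolding I_def
proof (rule a_eq)
  have lt: "N + s * int m < \<kappa> * q" using crossing[of m] assms by linarith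
  thus "\<kappa> = p \<or> N + s * int m < \<kappa> * q" by blast
  have "0 \<le> s * int m" using s(1) by simp
  hence "(\<kappa> - 1) * q \<le> N + s * int m" using qs(2) \<rho>(1) by (simp add: N_def left_diff_distrib)
  thus "\<kappa> = 0 \<or> (\<kappa> - 1) * q \<le> N + s * int m" by blast
qed (use \<kappa> in auto)

lemma a_above:
  assumes "L \<le> m" "m < nat p"
  shows "a (N + s * int m) = I (\<kappa> + 1) (int \<sigma> * (N + s * int m)) - I (\<kappa> + 1) (int \<sigma> * (N + s * int m) - int \<sigma>)"
  unfolding I_def
proof (rule a_eq)
  have "\<kappa> * q \<le> N + s * int m" using crossing[of m] assms by linarith
  thus "\<kappa> + 1 = 0 \<or> (\<kappa> + 1 - 1) * q \<le> N + s * int m" by simp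
  have "s * int m < s * p" using assms(2) s(1) p_pos by (intro mult_strict_left_mono) linarith+
  hence "N + s * int m < (\<kappa> + 1) * q" using \<rho>(2) by (simp add: N_def distrib_right)
  thus "\<kappa> + 1 = p \<or> N + s * int m < (\<kappa> + 1) * q" by blast
qed (use \<kappa> in auto)

lemma seg_below:
  assumes "M \<le> M'" "M' \<le> L"
  shows "seg N M M' = H \<kappa> (int \<sigma> * N + int M') - H \<kappa> (int \<sigma> * N + int M)"
  by (rule seg_pure[OF assms(1)]) (use a_below assms(2) in auto)

lemma seg_above:
  assumes "M \<le> M'" "L \<le> M" "M' \<le> nat p"
  shows "seg N M M' = H (\<kappa> + 1) (int \<sigma> * N + int M') - H (\<kappa> + 1) (int \<sigma> * N + int M)"
  by (rule seg_pure[OF assms(1)]) (use a_above assms(2,3) in auto)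

text \<open>Splitting at \<open>L\<close> leaves \<open>H \<kappa> - H (\<kappa> + 1)\<close> at the
  crossing, which is \<open>- J\<close> by \<open>H_Suc\<close>: the surplus has only one
  sign.\<close>

lemma seg_across:
  assumes "M \<le> L" "L \<le> M'" "M' \<le> nat p"
  shows "seg N M M' = H (\<kappa> + 1) (int \<sigma> * N + int M') - H \<kappa> (int \<sigma> * N + int M) - J (int \<sigma> * N + int L - \<kappa>)"
proof -
  have "seg N M M' = seg N M L + seg N L M'"
    unfolding seg_def using assms by (simp add: sum.atLeastLessThan_concat)
  thus ?thesis
    using seg_below[of M L] seg_above[of L M'] assms H_Suc[OF \<kappa>, of "int \<sigma> * N + int L"] by simp
qed

text \<open>The end points differ by \<open>p\<close>, so \<open>H\<close> returns to the same
  residue and only the two changes from \<open>\<kappa>\<close> to \<open>\<kappa> + 1\<close>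
  survive. In their arguments \<open>\<kappa>\<close> cancels.\<close>

lemma seg_full: "seg N 0 (nat p) = J (int \<sigma> * \<rho>) - J (int \<sigma> * \<rho> + int L)"
proof -
  have "seg N 0 (nat p) = H (\<kappa> + 1) (int \<sigma> * N + p) - H \<kappa> (int \<sigma> * N) - J (int \<sigma> * N + int L - \<kappa>)"
    using seg_across[of 0 "nat p"] L_le p_pos by simp
  also have "H (\<kappa> + 1) (int \<sigma> * N + p) = H (\<kappa> + 1) (int \<sigma> * N)"
    by (intro H_cong) (simp add: cong_def)
  also have "\<dots> = H \<kappa> (int \<sigma> * N) + J (int \<sigma> * N - \<kappa>)" by (rule H_Suc[OF \<kappa>])
  also have "J (int \<sigma> * N - \<kappa>) = J (int \<sigma> * \<rho>)"
    using cong_diff[OF sigma_N cong_refl[of \<kappa>]] by (intro J_cong) simp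
  also have "J (int \<sigma> * N + int L - \<kappa>) = J (int \<sigma> * \<rho> + int L)"
    using cong_diff[OF cong_add[OF sigma_N cong_refl[of "int L"]] cong_refl[of \<kappa>]]
    by (intro J_cong) (simp add: algebra_simps)
  finally show ?thesis by simp
qed

text \<open>Without a crossing the value is a difference of two numbers in
  \<open>[0, \<sigma>]\<close>. The minimum \<open>- \<sigma> - 1\<close> needs
  \<open>H \<kappa> = \<sigma>\<close>, \<open>H (\<kappa> + 1) = 0\<close> and \<open>J = 1\<close>
  at once, and pigeonhole turns the first two into bounds on \<open>\<kappa>\<close>.\<close>

lemma seg_bounds:
  assumes "M \<le> M'" "M' \<le> nat p"
  shows "- int \<sigma> - 1 \<le> seg N M M'" "seg N M M' \<le> int \<sigma>"
    "seg N M M' = - int \<sigma> - 1 \<Longrightarrow> s \<ge> 2 \<and> int \<sigma> \<le> \<kappa> \<and> \<kappa> \<le> p - 1 - int \<sigma>"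
proof -
  let ?A = "int \<sigma> * N"
  have "M' \<le> L \<or> L \<le> M \<or> (M < L \<and> L < M')" by linarith
  hence "- int \<sigma> - 1 \<le> seg N M M' \<and> seg N M M' \<le> int \<sigma> \<and>
    (seg N M M' = - int \<sigma> - 1 \<longrightarrow> s \<ge> 2 \<and> int \<sigma> \<le> \<kappa> \<and> \<kappa> \<le> p - 1 - int \<sigma>)"
  proof (elim disjE conjE)
    assume "M' \<le> L"
    thus ?thesis
      using seg_below[OF assms(1)] H_bounds[of \<kappa> "?A + int M"] H_bounds[of \<kappa> "?A + int M'"] by linarith
  next
    assume "L \<le> M"
    thus ?thesis
      using seg_above[OF assms(1) _ assms(2)] H_bounds[of "\<kappa> + 1" "?A + int M"]
        H_bounds[of "\<kappa> + 1" "?A + int M'"] by linarith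
  next
    assume L: "M < L" "L < M'"
    note seg = seg_across[of M M', OF less_imp_le[OF L(1)] less_imp_le[OF L(2)] assms(2)]
    note b = H_bounds[of \<kappa> "?A + int M"] H_bounds[of "\<kappa> + 1" "?A + int M'"] J_bounds[of "?A + int L - \<kappa>"]
    have "s \<ge> 2 \<and> int \<sigma> \<le> \<kappa> \<and> \<kappa> \<le> p - 1 - int \<sigma>" if "seg N M M' = - int \<sigma> - 1"
    proof -
      have e: "H \<kappa> (?A + int M) = int \<sigma>" "H (\<kappa> + 1) (?A + int M') = 0" "J (?A + int L - \<kappa>) = 1"
        using seg b that by linarith+
      have "int \<sigma> \<le> \<kappa>" by (rule H_eq_max[OF e(1)])
      moreover have "\<kappa> + 1 \<le> p - int \<sigma>" by (rule H_eq_0[OF e(2)]) (use \<kappa> in auto)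
      moreover have "s \<noteq> 1"
      proof
        \<comment> \<open>Then \<open>p\<close> divides \<open>\<sigma> - 1\<close> and
          \<open>L = p - \<rho>\<close>, so the argument of \<open>J\<close> is divisible by
          \<open>p\<close>.\<close>
        assume s1: "s = 1"
        have "\<rho> div s = \<rho>" by (simp add: s1)
        hence "L = nat (p - \<rho>)" unfolding L_def by simp
        hence intL: "int L = p - \<rho>" using L(1) by linarith
        have "[?A + int L - \<kappa> = \<kappa> + int \<sigma> * \<rho> + int L - \<kappa>] (mod p)"
          by (intro cong_diff cong_add sigma_N cong_refl)
        moreover have "p dvd \<kappa> + int \<sigma> * \<rho> + int L - \<kappa>"
        proof -
          have "\<kappa> + int \<sigma> * \<rho> + int L - \<kappa> = (s * int \<sigma> - 1) * \<rho> + p"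
            unfolding intL by (simp add: s1 algebra_simps)
          thus ?thesis using s(2) by (metis dvd_add dvd_mult2 dvd_refl)
        qed
        ultimately have "p dvd ?A + int L - \<kappa>" using cong_dvd_iff by blast
        thus False using J_eq_0 e(3) by simp
      qed
      ultimately show ?thesis using s(1) by linarith
    qed
    thus ?thesis using seg b by linarith
  qed
  thus "- int \<sigma> - 1 \<le> seg N M M'" "seg N M M' \<le> int \<sigma>"
    "seg N M M' = - int \<sigma> - 1 \<Longrightarrow> s \<ge> 2 \<and> int \<sigma> \<le> \<kappa> \<and> \<kappa> \<le> p - 1 - int \<sigma>" by blast+
qed

end

section \<open>Two windows with a common offset\<close>

context window
begin

definition start :: "int \<Rightarrow> int \<Rightarrow> int" where
  "start \<kappa> \<rho> = \<kappa> * q - s * p + \<rho>"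

lemma positioned:
  assumes "0 \<le> \<kappa>" "\<kappa> < p" "0 \<le> \<rho>" "\<rho> < q"
  shows "positioned_window p q s \<sigma> a \<kappa> \<rho>" "positioned_window.N p q s \<kappa> \<rho> = start \<kappa> \<rho>"
proof -
  show *: "positioned_window p q s \<sigma> a \<kappa> \<rho>"
    by unfold_locales (use assms in auto)
  show "positioned_window.N p q s \<kappa> \<rho> = start \<kappa> \<rho>"
    unfolding positioned_window.N_def[OF *] start_def by simp
qed

lemma q_pos: "q > 0"
proof -
  have "0 < s * p" using s(1) p_pos by simp
  thus ?thesis using qs(2) by linarith
qed

lemma start_less:
  assumes "\<kappa> < \<kappa>'"
  shows "start \<kappa> \<rho> + s * (p - 1) < start \<kappa>' \<rho>"
proof -
  note q = q_pos
  have "\<kappa> * q + q \<le> \<kappa>' * q"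
    using mult_right_mono[of "\<kappa> + 1" \<kappa>' q] assms q by (simp add: distrib_right)
  moreover have "s * (p - 1) \<le> s * p" using s(1) by (intro mult_left_mono) auto
  ultimately show ?thesis using qs(2) by (simp add: start_def)
qed

lemma seg_empty: "seg x M M = 0"
  by (simp add: seg_def)

text \<open>The two windows are at least a block apart, so the cutoff \<open>t\<close> truncates only one of them;
  a complete window contributes a sum that depends on \<open>\<rho>\<close> only, so that in either case the
  difference is a sum over part of a single window.\<close>

lemma W_diff_bounds:
  fixes t :: int
  assumes k: "0 \<le> \<kappa>1" "\<kappa>1 < \<kappa>2" "\<kappa>2 < p" and rho: "0 \<le> \<rho>" "\<rho> < q"
  defines "c \<equiv> W (start \<kappa>1 \<rho>) t - W (start \<kappa>2 \<rho>) t"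
  shows "- int \<sigma> - 1 \<le> c" "c \<le> int \<sigma>"
    "c = - int \<sigma> - 1 \<Longrightarrow> s \<ge> 2 \<and> int \<sigma> \<le> \<kappa>2 \<and> \<kappa>1 \<le> p - 1 - int \<sigma> \<and> (int \<sigma> \<le> \<kappa>1 \<or> \<kappa>2 \<le> p - 1 - int \<sigma>)"
proof -
  have k1: "\<kappa>1 < p" and k2: "0 \<le> \<kappa>2" using k by auto
  interpret w1: positioned_window p q s \<sigma> a \<kappa>1 \<rho> by (rule positioned(1)[OF k(1) k1 rho])
  interpret w2: positioned_window p q s \<sigma> a \<kappa>2 \<rho> by (rule positioned(1)[OF k2 k(3) rho])
  note N1 = positioned(2)[OF k(1) k1 rho] and N2 = positioned(2)[OF k2 k(3) rho]
  obtain M1 where M1: "M1 \<le> nat p" "W (start \<kappa>1 \<rho>) t = seg (start \<kappa>1 \<rho>) 0 M1"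
    "start \<kappa>1 \<rho> + s * (p - 1) \<le> t \<Longrightarrow> M1 = nat p"
    by (rule W_eq_seg[of "start \<kappa>1 \<rho>" t]) (rule that)
  obtain M2 where M2: "M2 \<le> nat p" "W (start \<kappa>2 \<rho>) t = seg (start \<kappa>2 \<rho>) 0 M2" "t < start \<kappa>2 \<rho> \<Longrightarrow> M2 = 0"
    by (rule W_eq_seg[of "start \<kappa>2 \<rho>" t]) (rule that)
  have "- int \<sigma> - 1 \<le> c \<and> c \<le> int \<sigma> \<and>
    (c = - int \<sigma> - 1 \<longrightarrow> s \<ge> 2 \<and> int \<sigma> \<le> \<kappa>2 \<and> \<kappa>1 \<le> p - 1 - int \<sigma> \<and> (int \<sigma> \<le> \<kappa>1 \<or> \<kappa>2 \<le> p - 1 - int \<sigma>))"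
  proof (cases "t < start \<kappa>2 \<rho>")
    case True
    hence "c = seg (start \<kappa>1 \<rho>) 0 M1" using M1(2) M2(2,3) by (simp add: c_def seg_empty)
    thus ?thesis using w1.seg_bounds[OF le0 M1(1)] k(2) unfolding N1 by auto
  next
    case False
    hence "M1 = nat p" using start_less[OF k(2), of \<rho>] M1(3) by linarith
    hence "c = seg (start \<kappa>2 \<rho>) 0 (nat p) - seg (start \<kappa>2 \<rho>) 0 M2"
      using M1(2) M2(2) w1.seg_full w2.seg_full unfolding N1 N2 w1.L_def w2.L_def by (simp add: c_def)
    also have "seg (start \<kappa>2 \<rho>) 0 (nat p) = seg (start \<kappa>2 \<rho>) 0 M2 + seg (start \<kappa>2 \<rho>) M2 (nat p)"
      unfolding seg_def using M2(1) by (simp add: sum.atLeastLessThan_concat)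
    finally have "c = seg (start \<kappa>2 \<rho>) M2 (nat p)" by simp
    thus ?thesis using w2.seg_bounds[OF M2(1) order_refl] k(2) unfolding N2 by auto
  qed
  thus "- int \<sigma> - 1 \<le> c" "c \<le> int \<sigma>"
    "c = - int \<sigma> - 1 \<Longrightarrow> s \<ge> 2 \<and> int \<sigma> \<le> \<kappa>2 \<and> \<kappa>1 \<le> p - 1 - int \<sigma> \<and> (int \<sigma> \<le> \<kappa>1 \<or> \<kappa>2 \<le> p - 1 - int \<sigma>)"
    by blast+
qed

text \<open>With the cutoff at term \<open>M - 1\<close> of the earlier window the later one
  contributes nothing, so every initial segment of a single window occurs as a difference.\<close>

lemma W_diff_prefix:
  assumes "M \<le> nat p" "\<kappa> < \<kappa>'" "t = start \<kappa> \<rho> + s * (int M - 1)"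
  shows "W (start \<kappa> \<rho>) t = seg (start \<kappa> \<rho>) 0 M" "W (start \<kappa>' \<rho>) t = 0"
proof -
  show "W (start \<kappa> \<rho>) t = seg (start \<kappa> \<rho>) 0 M"
    by (rule W_eq_seg[of "start \<kappa> \<rho>" t]) (use assms in metis)
  have "s * (int M - 1) \<le> s * (p - 1)" using assms(1) s(1) p_pos by (intro mult_left_mono) auto
  hence "t < start \<kappa>' \<rho>" using start_less[OF assms(2), of \<rho>] assms(3) by linarith
  thus "W (start \<kappa>' \<rho>) t = 0"
    by (rule_tac W_eq_seg[of "start \<kappa>' \<rho>" t]) (metis seg_empty)
qed

lemma H_explicit:
  assumes "int \<sigma> \<le> y" "y \<le> p"
  shows "y \<le> k \<Longrightarrow> H k y = int \<sigma>" "k \<le> y - int \<sigma> \<Longrightarrow> H k y = 0"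
proof -
  have m: "(y - 1 - int i) mod p = y - 1 - int i" if "i < \<sigma>" for i
    using that assms by (intro mod_pos_pos_trivial) auto
  show "H k y = int \<sigma>" if "y \<le> k"
  proof -
    have "H k y = (\<Sum>i<\<sigma>. 1)"
      unfolding H_def using that by (intro sum.cong refl) (auto simp: I_def m)
    thus ?thesis by simp
  qed
  show "H k y = 0" if "k \<le> y - int \<sigma>"
    unfolding H_def using that by (intro sum.neutral ballI) (auto simp: I_def m)
qed

text \<open>Block \<open>\<sigma>\<close> is the first one where \<open>H\<close> can reach
  \<open>\<sigma>\<close>. The three offsets place \<open>\<sigma> * N\<close> at
  \<open>\<sigma>\<close>, \<open>0\<close> and \<open>\<sigma>\<close> modulo \<open>p\<close>:
  \<open>H\<close> falls from full to empty, rises from empty to full, and falls while crossing a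
  boundary with \<open>J = 1\<close>.\<close>

lemma extreme_seg:
  shows "seg (start (int \<sigma>) 0) 0 \<sigma> = - int \<sigma>"
    and "seg (start (int \<sigma>) (p - 1)) 0 \<sigma> = int \<sigma>"
    and "s \<ge> 2 \<Longrightarrow> seg (start (int \<sigma>) (s * (p - int \<sigma>) + 1)) 0 (Suc \<sigma>) = - int \<sigma> - 1"
proof -
  have k: "0 \<le> int \<sigma>" "int \<sigma> < p" using \<sigma> by auto
  have sp: "p \<le> s * p" using s(1) p_pos mult_right_mono[of 1 s p] by simp
  have \<sigma>_le: "\<sigma> \<le> nat p" "Suc \<sigma> \<le> nat p" using \<sigma> by auto
  show "seg (start (int \<sigma>) 0) 0 \<sigma> = - int \<sigma>"
  proof -
    have rho: "0 \<le> (0::int)" "0 < q" using q_pos by auto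
    interpret w: positioned_window p q s \<sigma> a "int \<sigma>" 0 by (rule positioned(1)[OF k rho])
    have N: "[int \<sigma> * w.N = int \<sigma>] (mod p)" using w.sigma_N by simp
    have "seg w.N 0 \<sigma> = H (int \<sigma>) (int \<sigma> * w.N + int \<sigma>) - H (int \<sigma>) (int \<sigma> * w.N)"
      using w.seg_below[of 0 \<sigma>] \<sigma>_le by (simp add: w.L_def)
    also have "H (int \<sigma>) (int \<sigma> * w.N + int \<sigma>) = H (int \<sigma>) (int \<sigma> + int \<sigma>)"
      by (intro H_cong cong_add N cong_refl)
    also have "\<dots> = 0" using \<sigma> by (intro H_explicit) auto
    also have "H (int \<sigma>) (int \<sigma> * w.N) = H (int \<sigma>) (int \<sigma>)" by (rule H_cong[OF N])
    also have "\<dots> = int \<sigma>" using \<sigma> by (intro H_explicit) auto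
    finally show ?thesis using positioned(2)[OF k rho] by simp
  qed
  show "seg (start (int \<sigma>) (p - 1)) 0 \<sigma> = int \<sigma>"
  proof -
    have rho: "0 \<le> p - 1" "p - 1 < q" using qs(2) sp p_pos by linarith+
    interpret w: positioned_window p q s \<sigma> a "int \<sigma>" "p - 1" by (rule positioned(1)[OF k rho])
    have "int \<sigma> + int \<sigma> * (p - 1) = p * int \<sigma>" by (simp add: algebra_simps)
    hence N: "[int \<sigma> * w.N = 0] (mod p)" using w.sigma_N by (simp add: cong_def)
    \<comment> \<open>The window must not reach the next block within its first
      \<open>\<sigma>\<close> terms; for \<open>s = 1\<close> this holds because then
      \<open>\<sigma> = 1\<close>.\<close>
    have "(p - 1) div s \<le> p - int \<sigma>"
    proof (cases "s = 1")
      case True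
      hence "p dvd int \<sigma> - 1" using s(2) by simp
      hence "int \<sigma> - 1 = 0" using \<sigma> zdvd_imp_le[of p "int \<sigma> - 1"] by linarith
      thus ?thesis using True by simp
    next
      case False
      have "(p - 1) div s \<le> (p - 1) div 2" using s(1) False p_pos by (intro zdiv_mono2) auto
      thus ?thesis using \<sigma> by linarith
    qed
    hence "\<sigma> \<le> w.L" unfolding w.L_def by linarith
    hence "seg w.N 0 \<sigma> = H (int \<sigma>) (int \<sigma> * w.N + int \<sigma>) - H (int \<sigma>) (int \<sigma> * w.N)"
      using w.seg_below[of 0 \<sigma>] by simp
    also have "H (int \<sigma>) (int \<sigma> * w.N + int \<sigma>) = H (int \<sigma>) (0 + int \<sigma>)"
      by (intro H_cong cong_add N cong_refl)
    also have "\<dots> = int \<sigma>" using \<sigma> by (subst H_explicit(1)) auto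
    also have "H (int \<sigma>) (int \<sigma> * w.N) = H (int \<sigma>) p"
      by (rule H_cong) (use N in \<open>simp add: cong_def\<close>)
    also have "\<dots> = 0" using \<sigma> by (intro H_explicit) auto
    finally show ?thesis using positioned(2)[OF k rho] by simp
  qed
  show "seg (start (int \<sigma>) (s * (p - int \<sigma>) + 1)) 0 (Suc \<sigma>) = - int \<sigma> - 1" if s2: "s \<ge> 2"
  proof -
    \<comment> \<open>The multiple of \<open>s\<close> puts the crossing exactly at
      \<open>L = \<sigma>\<close>; the added 1, harmless for the quotient as
      \<open>s \<ge> 2\<close>, makes \<open>\<sigma> * \<rho>\<close> divisible by
      \<open>p\<close>.\<close>
    define \<rho> where "\<rho> = s * (p - int \<sigma>) + 1"
    have "s * 1 \<le> s * int \<sigma>" using s(1) \<sigma>(1) by (intro mult_left_mono) auto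
    hence "\<rho> \<le> s * p - s + 1" by (simp add: \<rho>_def algebra_simps)
    hence rho: "0 \<le> \<rho>" "\<rho> < q" using qs(2) s2 \<sigma> by (auto simp: \<rho>_def intro!: add_nonneg_nonneg)
    interpret w: positioned_window p q s \<sigma> a "int \<sigma>" \<rho> by (rule positioned(1)[OF k rho])
    have "int \<sigma> + int \<sigma> * \<rho> - int \<sigma> = (s * int \<sigma> - 1) * (p - int \<sigma>) + p"
      by (simp add: \<rho>_def algebra_simps)
    hence "p dvd int \<sigma> + int \<sigma> * \<rho> - int \<sigma>" using s(2) by (metis dvd_add dvd_mult2 dvd_refl)
    hence N: "[int \<sigma> * w.N = int \<sigma>] (mod p)"
      using w.sigma_N cong_iff_dvd_diff cong_trans by blast
    have "\<rho> div s = p - int \<sigma>" using s2 unfolding \<rho>_def by (simp add: div_add1_eq)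
    hence L: "w.L = \<sigma>" by (simp add: w.L_def)
    have "seg w.N 0 (Suc \<sigma>) = H (int \<sigma> + 1) (int \<sigma> * w.N + int (Suc \<sigma>)) - H (int \<sigma>) (int \<sigma> * w.N) -
        J (int \<sigma> * w.N + int \<sigma> - int \<sigma>)"
      using w.seg_across[of 0 "Suc \<sigma>"] L \<sigma>_le by simp
    also have "H (int \<sigma> + 1) (int \<sigma> * w.N + int (Suc \<sigma>)) = H (int \<sigma> + 1) (int \<sigma> + int (Suc \<sigma>))"
      by (intro H_cong cong_add N cong_refl)
    also have "\<dots> = 0" using \<sigma> by (intro H_explicit) auto
    also have "H (int \<sigma>) (int \<sigma> * w.N) = H (int \<sigma>) (int \<sigma>)" by (rule H_cong[OF N])
    also have "\<dots> = int \<sigma>" using \<sigma> by (intro H_explicit) auto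
    also have "J (int \<sigma> * w.N + int \<sigma> - int \<sigma>) = J (int \<sigma>)" using N by (intro J_cong) simp
    also have "J (int \<sigma>) = 1"
    proof -
      have "(\<Sum>i\<in>{\<sigma> - 1}. if p dvd int \<sigma> - 1 - int i then 1 else 0) \<le> J (int \<sigma>)"
        unfolding J_def by (rule sum_mono2) (use \<sigma>(1) in auto)
      thus ?thesis using J_bounds(2)[of "int \<sigma>"] \<sigma>(1) by (simp add: of_nat_diff)
    qed
    finally show ?thesis using positioned(2)[OF k rho] by (simp add: \<rho>_def)
  qed
qed

end

text \<open>\<open>s * p < q\<close> keeps windows shorter than a block, and
  \<open>p * q < r\<close> lets \<open>n div r\<close> and the residue of \<open>n\<close> modulo
  \<open>p * q\<close> be prescribed independently.\<close>

locale ternary_family = three_primes p q r for p q r :: nat +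
  fixes s :: int and \<sigma> :: nat
  assumes \<sigma>: "1 \<le> \<sigma>" "2 * \<sigma> + 1 \<le> p" and s: "1 \<le> s" "int p dvd s * int \<sigma> - 1"
    and qs: "int p dvd int q - s" "s * int p < int q"
    and rs: "int p * int q dvd int r * s + 1" and r_large: "p * q < r"
begin

lemma residue_sum:
  assumes "0 \<le> k" "k \<le> int p"
  shows "(\<Sum>j<p. if int j < k \<and> int p dvd x - int j then 1 else 0) = (if x mod int p < k then 1 else (0::int))"
proof -
  have p0: "int p > 0" using three_primes.pos(1)[OF three_primes_axioms] by simp
  define j0 where "j0 = nat (x mod int p)"
  have j0: "int j0 = x mod int p" "j0 < p" using p0 by (auto simp: j0_def nat_less_iff)
  have "int p dvd x - int j \<longleftrightarrow> j = j0" if "j < p" for j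
  proof -
    have "int p dvd x - int j \<longleftrightarrow> x mod int p = int j mod int p" by (simp add: mod_eq_dvd_iff)
    also have "int j mod int p = int j" using that by simp
    also have "x mod int p = int j \<longleftrightarrow> j = j0" using j0(1) by linarith
    finally show ?thesis .
  qed
  hence "(\<Sum>j<p. if int j < k \<and> int p dvd x - int j then 1 else 0) = (\<Sum>j<p. if j = j0 then (if int j0 < k then 1 else 0) else (0::int))"
    by (intro sum.cong) auto
  thus ?thesis using j0 by simp
qed

lemma dvd_scale: "int p dvd z - int j * int q \<longleftrightarrow> int p dvd int \<sigma> * z - int j"
proof
  assume "int p dvd z - int j * int q"
  hence "int p dvd int \<sigma> * (z - int j * int q) + int j * (int \<sigma> * (int q - s) + (s * int \<sigma> - 1))"
    by (intro dvd_add dvd_mult[OF dvd_add[OF dvd_mult[OF qs(1)] s(2)]] dvd_mult)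
  thus "int p dvd int \<sigma> * z - int j" by (simp add: algebra_simps)
next
  assume "int p dvd int \<sigma> * z - int j"
  from dvd_diff[OF dvd_diff[OF dvd_mult[OF this] dvd_mult[OF s(2)]] dvd_mult[OF qs(1)]]
  have "int p dvd s * (int \<sigma> * z - int j) - z * (s * int \<sigma> - 1) - int j * (int q - s)"
    .
  thus "int p dvd z - int j * int q" by (simp add: algebra_simps)
qed

text \<open>In block \<open>k\<close> the inequality \<open>j * q \<le> z\<close> means
  \<open>j < k\<close>, and scaling by \<open>\<sigma>\<close> turns \<open>j * q\<close> into
  \<open>j\<close>. For \<open>k = 0\<close> and \<open>k = p\<close> the block is unbounded on one
  side and both indicators agree, matching the vanishing of \<open>pq_coeff\<close> there.\<close>

lemma pq_coeff_residue:
  assumes k: "0 \<le> k" "k \<le> int p" "k = 0 \<or> (k - 1) * int q \<le> z" "k = int p \<or> z < k * int q"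
  shows "pq_coeff z = (if (int \<sigma> * z) mod int p < k then 1 else 0) - (if (int \<sigma> * z - int \<sigma>) mod int p < k then 1 else 0)"
proof -
  have p1: "int p > 1" and q0: "int q > 0" using pos by auto
  have le: "int (j * q) \<le> z \<longleftrightarrow> int j < k" if j: "j < p" for j
  proof
    assume le: "int (j * q) \<le> z"
    show "int j < k"
    proof (cases "k = int p")
      case False
      hence "int j * int q < k * int q" using k(4) le by simp
      thus ?thesis using q0 by simp
    qed (use j in simp)
  next
    assume "int j < k"
    hence "int j * int q \<le> (k - 1) * int q" using q0 by (intro mult_right_mono) auto
    thus "int (j * q) \<le> z" using k(3) \<open>int j < k\<close> by auto
  qed
  have "pq_coeff z = (\<Sum>j<p. (if int j < k \<and> int p dvd int \<sigma> * z - int j then 1 else 0) -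
                     (if int j < k \<and> int p dvd (int \<sigma> * z - int \<sigma>) - int j then 1 else 0))"
    unfolding pq_coeff_def
  proof (rule sum.cong, rule refl)
    fix j assume "j \<in> {..<p}"
    hence j: "j < p" by simp
    have d1: "int p dvd z - int (j * q) \<longleftrightarrow> int p dvd int \<sigma> * z - int j"
      using dvd_scale[of z j] by simp
    have d2: "int p dvd z - int (j * q) - 1 \<longleftrightarrow> int p dvd (int \<sigma> * z - int \<sigma>) - int j"
      using dvd_scale[of "z - 1" j] by (simp add: algebra_simps)
    \<comment> \<open>\<open>z = j * q\<close> is incompatible with the congruence, so the bounds
      \<open>j * q + 1 \<le> z\<close> and \<open>j * q \<le> z\<close> are interchangeable and both
      indicators get the same \<open>k\<close>.\<close>
    have "z \<noteq> int (j * q)" if "int p dvd z - int (j * q) - 1"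
    proof
      assume "z = int (j * q)"
      hence "int p dvd 1" using that by simp
      thus False using p1 by simp
    qed
    hence "int (j * q) + 1 \<le> z \<and> int p dvd z - int (j * q) - 1 \<longleftrightarrow>
        int (j * q) \<le> z \<and> int p dvd z - int (j * q) - 1" by fastforce
    thus "(if int (j * q) \<le> z \<and> int p dvd z - int (j * q) then 1 else 0) -
          (if int (j * q) + 1 \<le> z \<and> int p dvd z - int (j * q) - 1 then 1 else 0) =
          (if int j < k \<and> int p dvd int \<sigma> * z - int j then 1 else 0) -
          (if int j < k \<and> int p dvd (int \<sigma> * z - int \<sigma>) - int j then 1 else (0::int))"
      unfolding le[OF j] d1 d2 by presburger
  qed
  thus ?thesis unfolding sum_subtractf residue_sum[OF k(1,2)] .
qed

sublocale window "int p" "int q" s \<sigma> pq_coeff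
proof unfold_locales
  show "2 * int \<sigma> + 1 \<le> int p" using \<sigma>(2) by linarith
qed (use \<sigma>(1) s qs pq_coeff_residue in auto)

end

section \<open>The diameter\<close>

text \<open>The signs of \<open>lo\<close> and \<open>hi\<close> guarantee that both extremes are
  nonzero coefficients and so belong to the list \<open>coeffs P\<close>; the zeros of
  \<open>coeff\<close> beyond the degree lie strictly between them.\<close>

lemma diameter_eqI:
  assumes "\<And>n. lo \<le> coeff P n" "\<And>n. coeff P n \<le> hi" "coeff P m = lo" "coeff P n = hi" "lo < 0" "0 < hi"
  shows "diameter P = hi - lo"
proof -
  have mem: "coeff P i \<in> set (coeffs P)" if "coeff P i \<noteq> 0" for i
    using that le_degree[of P i] coeff_in_coeffs[of P i] by (cases "P = 0") auto
  have rng: "x \<in> range (coeff P)" if "x \<in> set (coeffs P)" for x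
    using that by (auto simp: coeffs_def split: if_splits)
  have "Max (set (coeffs P)) = hi"
    by (rule Max_eqI) (use mem[of n] rng assms in auto)
  moreover have "Min (set (coeffs P)) = lo"
    by (rule Min_eqI) (use mem[of m] rng assms in auto)
  ultimately show ?thesis by (simp add: Defs.diameter_def)
qed

section \<open>Coefficients as differences of two windows\<close>

context ternary_family
begin

lemma pq_coeff_top:
  assumes "(int p - 1) * int q \<le> z"
  shows "pq_coeff z = 0"
  using pq_coeff_residue[of "int p" z] assms pos by simp

lemma s_bound: "s * int p < int p * int q"
proof -
  have "int q * 1 \<le> int q * int p" using pos by (intro mult_left_mono) auto
  thus ?thesis using qs(2) by (simp add: mult.commute)
qed

text \<open>Reduction modulo \<open>p * q\<close> is undone by starting at a representative in
  \<open>[- s * p, p * q - s * p)\<close>. A negative term and its reduction both lie where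
  \<open>pq_coeff\<close> vanishes, so the wrap-around does no harm.\<close>

lemma sum_eq_W:
  "(\<Sum>m<p. let i = (s * int m + c) mod (int p * int q) in if i \<le> t then pq_coeff i else 0) =
     W ((c + s * int p) mod (int p * int q) - s * int p) t"
proof -
  define Z where "Z = int p * int q"
  define N where "N = (c + s * int p) mod Z - s * int p"
  have Z: "Z > 0" using pos by (simp add: Z_def)
  have "(let i = (s * int m + c) mod Z in if i \<le> t then pq_coeff i else 0) =
          (if N + s * int m \<le> t then pq_coeff (N + s * int m) else 0)" if m: "m < p" for m
  proof -
    define x where "x = N + s * int m"
    have "s * int m \<le> s * (int p - 1)" using m s(1) by (intro mult_left_mono) auto
    moreover have "0 \<le> s * int m" using s(1) by simp
    moreover have "0 \<le> (c + s * int p) mod Z" "(c + s * int p) mod Z < Z" using Z by auto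
    ultimately have x: "- (s * int p) \<le> x" "x < Z" using s(1) by (auto simp: x_def N_def right_diff_distrib)
    have "[x = c + s * int p - s * int p + s * int m] (mod Z)"
      unfolding x_def N_def by (intro cong_add cong_diff cong_refl) (simp add: cong_def)
    hence cong: "(s * int m + c) mod Z = x mod Z" by (simp add: cong_def add.commute)
    show ?thesis
    proof (cases "0 \<le> x")
      case True
      hence "(s * int m + c) mod Z = x" unfolding cong using x(2) by simp
      thus ?thesis by (simp add: Let_def x_def)
    next
      case False
      have "(s * int m + c) mod Z = (x + Z) mod Z" unfolding cong by simp
      also have "\<dots> = x + Z" using False x s_bound by (intro mod_pos_pos_trivial) (auto simp: Z_def)
      finally have i: "(s * int m + c) mod Z = x + Z" .
      have "(int p - 1) * int q \<le> x + Z" using x(1) qs(2) by (simp add: Z_def left_diff_distrib)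
      hence "pq_coeff (x + Z) = 0" by (rule pq_coeff_top)
      moreover have "pq_coeff x = 0" using False by (intro pq_coeff_neg) simp
      ultimately show ?thesis unfolding i by (simp add: Let_def x_def[symmetric])
    qed
  qed
  thus ?thesis unfolding W_def Z_def[symmetric] N_def[symmetric] nat_int by (intro sum.cong) auto
qed

lemma sum_interval_indicator:
  fixes f :: "int \<Rightarrow> int"
  assumes "0 \<le> c" "c + int p \<le> Z"
  shows "(\<Sum>k\<in>{0..<Z}. f k * (if c \<le> k \<and> k < c + int p then 1 else 0)) = (\<Sum>m<p. f (c + int m))"
proof -
  have "(\<Sum>k\<in>{0..<Z}. f k * (if c \<le> k \<and> k < c + int p then 1 else 0)) = (\<Sum>k\<in>{c..<c + int p}. f k)"
    by (rule sum.mono_neutral_cong_right) (use assms in auto)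
  also have "\<dots> = (\<Sum>m<p. f (c + int m))"
    by (rule sum.reindex_bij_witness[of _ "\<lambda>m. c + int m" "\<lambda>k. nat (k - c)"]) auto
  finally show ?thesis .
qed

text \<open>As \<open>-s\<close> inverts \<open>r\<close> modulo \<open>p q\<close>, the indices \<open>i\<close> with \<open>n - r i \<equiv> m\<close> are those congruent
  to \<open>s (m - n)\<close>: the two runs of ones in \<open>G\<close> become two windows with step \<open>s\<close>.\<close>

lemma coeff_eq_W:
  fixes n :: nat
  defines "Z \<equiv> int p * int q" and "t \<equiv> int (n div r)"
  shows "coeff (cyclotomic (p * q * r)) n =
           W ((s * int p - s * int n) mod Z - s * int p) t -
           W ((s * int q + (s * int p - s * int n)) mod Z - s * int p) t"
proof -
  define F where "F i = (if i \<le> t then pq_coeff i else 0)" for i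
  define g :: "int \<Rightarrow> int"
    where "g k = (if 0 \<le> k \<and> k < 0 + int p then 1 else 0) - (if int q \<le> k \<and> k < int q + int p then 1 else 0)" for k
  have Z: "Z > 0" "Z = int (p * q)" using pos by (simp_all add: Z_def)
  have Zrs: "Z dvd int r * s + 1" using rs by (simp add: Z_def)
  have G: "G k = g (int k)" for k unfolding G_def g_def by auto
  have "coeff (cyclotomic (p * q * r)) n = (\<Sum>i<p * q. F (int i) * g ((int n - int r * int i) mod Z))"
    unfolding coeff_cyclotomic_pqr
  proof (rule sum.mono_neutral_cong)
    fix i assume "i \<in> {..n div r} - {..<p * q}"
    hence "p * q \<le> i" by simp
    hence "int (p * q) \<le> int i" by (simp only: of_nat_le_iff)
    hence "(int p - 1) * int q \<le> int i" by (simp add: left_diff_distrib)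
    thus "pq_coeff (int i) * G ((n - r * i) mod (p * q)) = 0" using pq_coeff_top by simp
  next
    fix i assume "i \<in> {..<p * q} - {..n div r}"
    thus "F (int i) * g ((int n - int r * int i) mod Z) = 0" by (simp add: F_def t_def)
  next
    fix i assume "i \<in> {..n div r} \<inter> {..<p * q}"
    hence i: "i \<le> n div r" by simp
    hence "r * i \<le> n" using pos by (simp add: less_eq_div_iff_mult_less_eq mult.commute)
    hence "int ((n - r * i) mod (p * q)) = (int n - int r * int i) mod Z"
      by (simp add: zmod_int Z_def of_nat_diff)
    thus "pq_coeff (int i) * G ((n - r * i) mod (p * q)) = F (int i) * g ((int n - int r * int i) mod Z)"
      using i by (simp add: G F_def t_def)
  qed auto
  also have "\<dots> = (\<Sum>i\<in>{0..<Z}. F i * g ((int n - int r * i) mod Z))"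
    by (rule sum.reindex_bij_witness[of _ nat int]) (auto simp: Z(2) nat_less_iff simp del: of_nat_mult)
  also have "\<dots> = (\<Sum>k\<in>{0..<Z}. F ((s * (k - int n)) mod Z) * g k)"
  proof (rule sum.reindex_bij_witness[of _ "\<lambda>k. (s * (k - int n)) mod Z" "\<lambda>i. (int n - int r * i) mod Z"])
    fix i assume i: "i \<in> {0..<Z}"
    have "[s * ((int n - int r * i) mod Z - int n) = s * ((int n - int r * i) - int n)] (mod Z)"
      by (intro cong_mult cong_diff cong_refl) (simp add: cong_def)
    also have "s * ((int n - int r * i) - int n) = i - (int r * s + 1) * i" by (simp add: algebra_simps)
    also have "[\<dots> = i - 0 * i] (mod Z)"
      using Zrs by (intro cong_diff cong_mult cong_refl) (simp add: cong_0_iff)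
    finally show eq: "(s * ((int n - int r * i) mod Z - int n)) mod Z = i"
      using i by (simp add: cong_def)
    show "F ((s * ((int n - int r * i) mod Z - int n)) mod Z) * g ((int n - int r * i) mod Z) =
            F i * g ((int n - int r * i) mod Z)" unfolding eq ..
    show "(int n - int r * i) mod Z \<in> {0..<Z}" using Z(1) by simp
  next
    fix k assume k: "k \<in> {0..<Z}"
    have "[int n - int r * ((s * (k - int n)) mod Z) = int n - int r * (s * (k - int n))] (mod Z)"
      by (intro cong_mult cong_diff cong_refl) (simp add: cong_def)
    also have "int n - int r * (s * (k - int n)) = k - (int r * s + 1) * (k - int n)" by (simp add: algebra_simps)
    also have "[\<dots> = k - 0 * (k - int n)] (mod Z)"
      using Zrs by (intro cong_diff cong_mult cong_refl) (simp add: cong_0_iff)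
    finally show "(int n - int r * ((s * (k - int n)) mod Z)) mod Z = k"
      using k by (simp add: cong_def)
    show "(s * (k - int n)) mod Z \<in> {0..<Z}" using Z(1) by simp
  qed
  also have "\<dots> = (\<Sum>m<p. F ((s * ((0 + int m) - int n)) mod Z)) - (\<Sum>m<p. F ((s * ((int q + int m) - int n)) mod Z))"
  proof -
    have b: "int q + int p \<le> Z" unfolding Z(2) using pq_le by linarith
    show ?thesis
      unfolding g_def right_diff_distrib[of "F _"] sum_subtractf
      using sum_interval_indicator[of 0 Z "\<lambda>k. F ((s * (k - int n)) mod Z)"]
        sum_interval_indicator[of "int q" Z "\<lambda>k. F ((s * (k - int n)) mod Z)"] b by simp
  qed
  also have "(\<Sum>m<p. F ((s * ((0 + int m) - int n)) mod Z)) = W ((s * int p - s * int n) mod Z - s * int p) t"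
  proof -
    have e: "s * ((0 + int m) - int n) = s * int m + - (s * int n)" for m by (simp add: algebra_simps)
    show ?thesis
      using sum_eq_W[of "- (s * int n)" t] unfolding e F_def Z_def Let_def by (simp add: add.commute)
  qed
  also have "(\<Sum>m<p. F ((s * ((int q + int m) - int n)) mod Z)) =
               W ((s * int q + (s * int p - s * int n)) mod Z - s * int p) t"
  proof -
    have e: "s * ((int q + int m) - int n) = s * int m + (s * int q - s * int n)" for m
      by (simp add: algebra_simps)
    have e': "s * int q + (s * int p - s * int n) = (s * int q - s * int n) + s * int p" by simp
    show ?thesis
      using sum_eq_W[of "s * int q - s * int n" t] unfolding e e' F_def Z_def Let_def .
  qed
  finally show ?thesis .
qed

text \<open>The second run of \<open>G\<close> begins \<open>q\<close> later; after multiplication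
  by \<open>s\<close> this adds \<open>s * q\<close>, which preserves the offset
  \<open>\<rho>\<close> and moves the block number by \<open>s\<close> modulo
  \<open>p\<close>.\<close>

lemma coeff_eq_W_start:
  assumes "(s * int p - s * int n) mod (int p * int q) = \<kappa> * int q + \<rho>" "0 \<le> \<rho>" "\<rho> < int q"
  shows "coeff (cyclotomic (p * q * r)) n =
           W (start \<kappa> \<rho>) (int (n div r)) - W (start ((\<kappa> + s) mod int p) \<rho>) (int (n div r))"
proof -
  have q0: "int q > 0" using pos by simp
  have "(s * int q + (s * int p - s * int n)) mod (int q * int p) =
          (s * int q + (\<kappa> * int q + \<rho>)) mod (int q * int p)"
    by (metis assms(1) mod_add_right_eq mult.commute)
  also have "s * int q + (\<kappa> * int q + \<rho>) = (\<kappa> + s) * int q + \<rho>" by (simp add: algebra_simps)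
  also have "\<dots> mod (int q * int p) = int q * ((\<kappa> + s) mod int p) + \<rho>"
    using q0 assms(2,3) by (subst zmod_zmult2_eq) auto
  finally have "(s * int q + (s * int p - s * int n)) mod (int p * int q) - s * int p = start ((\<kappa> + s) mod int p) \<rho>"
    by (simp add: start_def mult.commute)
  moreover have "(s * int p - s * int n) mod (int p * int q) - s * int p = start \<kappa> \<rho>"
    by (simp add: assms(1) start_def)
  ultimately show ?thesis by (simp add: coeff_eq_W)
qed

lemma coeff_as_W:
  obtains \<kappa> \<rho> where "0 \<le> \<kappa>" "\<kappa> < int p" "0 \<le> \<rho>" "\<rho> < int q"
    "coeff (cyclotomic (p * q * r)) n =
       W (start \<kappa> \<rho>) (int (n div r)) - W (start ((\<kappa> + s) mod int p) \<rho>) (int (n div r))"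
proof -
  define x where "x = (s * int p - s * int n) mod (int p * int q)"
  have q0: "int q > 0" "int p * int q > 0" using pos by auto
  have x: "0 \<le> x" "x < int p * int q" using q0 by (auto simp: x_def)
  show thesis
  proof (rule that)
    show "0 \<le> x div int q" using x(1) q0 by (simp add: pos_imp_zdiv_nonneg_iff)
    show "x div int q < int p" using x(2) q0(1) mult_le_div_iff[of "int q" "int p" x] by linarith
    show r: "0 \<le> x mod int q" "x mod int q < int q" using q0 by auto
    show "coeff (cyclotomic (p * q * r)) n =
       W (start (x div int q) (x mod int q)) (int (n div r)) -
       W (start ((x div int q + s) mod int p) (x mod int q)) (int (n div r))"
      by (rule coeff_eq_W_start[OF _ r]) (simp add: x_def[symmetric])
  qed
qed

text \<open>Converse to \<open>coeff_as_W\<close>: as \<open>p * q < r\<close>, one may take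
  \<open>n = r * t + j\<close> with \<open>j < p * q\<close>, where \<open>j\<close> makes
  \<open>n\<close> congruent to \<open>r * N\<close>, and hence \<open>- s * n\<close> to
  \<open>N\<close>, modulo \<open>p * q\<close>.\<close>

lemma W_as_coeff:
  assumes "0 \<le> \<kappa>" "\<kappa> < int p" "0 \<le> \<rho>" "\<rho> < int q" "0 \<le> t"
  shows "\<exists>n. coeff (cyclotomic (p * q * r)) n = W (start \<kappa> \<rho>) t - W (start ((\<kappa> + s) mod int p) \<rho>) t"
proof -
  define Z where "Z = int p * int q"
  define N where "N = start \<kappa> \<rho>"
  define j where "j = (int r * (N - t)) mod Z"
  have Z: "Z > 0" "Z = int (p * q)" using pos by (simp_all add: Z_def)
  have "Z < int r" using r_large unfolding Z(2) by (simp only: of_nat_less_iff)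
  moreover have "0 \<le> j" "j < Z" using Z(1) by (auto simp: j_def)
  ultimately have j: "0 \<le> j" "j < int r" by auto
  define n where "n = nat (int r * t + j)"
  have n: "int n = int r * t + j" using assms(5) j by (simp add: n_def)
  have "int (n div r) = int n div int r" by (simp add: zdiv_int)
  also have "\<dots> = t" unfolding n using j by simp
  finally have nt: "int (n div r) = t" .
  have "[s * int p - s * int n = s * int p - s * (int r * t + int r * (N - t))] (mod Z)"
    unfolding n j_def by (intro cong_diff cong_mult cong_add cong_refl) (simp add: cong_def)
  also have "s * int p - s * (int r * t + int r * (N - t)) = s * int p + N - (int r * s + 1) * N"
    by (simp add: algebra_simps)
  also have "[\<dots> = s * int p + N - 0 * N] (mod Z)"
    using rs by (intro cong_diff cong_mult cong_refl) (simp add: cong_0_iff Z_def)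
  also have "s * int p + N - 0 * N = \<kappa> * int q + \<rho>" by (simp add: N_def start_def)
  finally have "(s * int p - s * int n) mod Z = (\<kappa> * int q + \<rho>) mod Z" by (simp add: cong_def)
  also have "\<dots> = \<kappa> * int q + \<rho>"
  proof (rule mod_pos_pos_trivial)
    show "0 \<le> \<kappa> * int q + \<rho>" using assms by simp
    have "(\<kappa> + 1) * int q \<le> int p * int q" using assms(2) by (intro mult_right_mono) auto
    thus "\<kappa> * int q + \<rho> < Z" using assms(4) by (simp add: Z_def distrib_right)
  qed
  finally have "coeff (cyclotomic (p * q * r)) n =
      W (start \<kappa> \<rho>) (int (n div r)) - W (start ((\<kappa> + s) mod int p) \<rho>) (int (n div r))"
    unfolding Z_def by (rule coeff_eq_W_start) (use assms in auto)
  thus ?thesis unfolding nt by blast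
qed

section \<open>The extreme coefficients\<close>

lemma shift_cases:
  assumes "0 \<le> \<kappa>" "\<kappa> < int p"
  shows "(\<kappa> + s) mod int p = (if \<kappa> + s mod int p < int p then \<kappa> + s mod int p else \<kappa> + s mod int p - int p)"
proof -
  have p0: "int p > 0" using pos by simp
  have b: "0 \<le> s mod int p" "s mod int p < int p" using p0 by auto
  have "(\<kappa> + s) mod int p = (\<kappa> + s mod int p) mod int p" by (simp add: mod_add_right_eq)
  also have "\<dots> = (if \<kappa> + s mod int p < int p then \<kappa> + s mod int p else \<kappa> + s mod int p - int p)"
  proof (cases "\<kappa> + s mod int p < int p")
    case False
    hence "(\<kappa> + s mod int p) mod int p = (\<kappa> + s mod int p - int p) mod int p" by simp
    also have "\<dots> = \<kappa> + s mod int p - int p" using False assms b by (intro mod_pos_pos_trivial) auto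
    finally show ?thesis using False by simp
  qed (use assms b in simp)
  finally show ?thesis .
qed

lemma s_mod: "0 < s mod int p" "s mod int p < int p"
proof -
  have p1: "int p > 1" using pos by simp
  have "\<not> int p dvd s"
  proof
    assume "int p dvd s"
    from dvd_diff[OF dvd_mult2[OF this] s(2)]
    have "int p dvd s * int \<sigma> - (s * int \<sigma> - 1)" .
    thus False using p1 by simp
  qed
  hence "s mod int p \<noteq> 0" by (simp add: dvd_eq_mod_eq_0)
  moreover have "0 \<le> s mod int p" "s mod int p < int p" using p1 by auto
  ultimately show "0 < s mod int p" "s mod int p < int p" by auto
qed

text \<open>The second block number is \<open>\<kappa> + s mod p\<close>, possibly reduced by
  \<open>p\<close>. Without reduction the coefficient may drop to \<open>- \<sigma> - 1\<close>;
  with it the order of the windows and the sign are exchanged. At either extreme the gap between the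
  blocks, \<open>s mod p\<close> or its complement to \<open>p\<close>, must be less than
  \<open>p - \<sigma>\<close>.\<close>

lemma coeff_bounds:
  fixes n :: nat
  defines "c \<equiv> coeff (cyclotomic (p * q * r)) n"
  shows "- int \<sigma> - 1 \<le> c" "c \<le> int \<sigma> + 1"
    "c = - int \<sigma> - 1 \<Longrightarrow> s \<ge> 2 \<and> s mod int p < int p - int \<sigma>"
    "c = int \<sigma> + 1 \<Longrightarrow> s \<ge> 2 \<and> int \<sigma> < s mod int p"
proof -
  define t where "t = int (n div r)"
  obtain \<kappa> \<rho> where *: "0 \<le> \<kappa>" "\<kappa> < int p" "0 \<le> \<rho>" "\<rho> < int q"
    "c = W (start \<kappa> \<rho>) t - W (start ((\<kappa> + s) mod int p) \<rho>) t"
    unfolding c_def t_def by (rule coeff_as_W[of n])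
  have "- int \<sigma> - 1 \<le> c \<and> c \<le> int \<sigma> + 1 \<and>
    (c = - int \<sigma> - 1 \<longrightarrow> s \<ge> 2 \<and> s mod int p < int p - int \<sigma>) \<and>
    (c = int \<sigma> + 1 \<longrightarrow> s \<ge> 2 \<and> int \<sigma> < s mod int p)"
  proof (cases "\<kappa> + s mod int p < int p")
    case True
    hence k2: "(\<kappa> + s) mod int p = \<kappa> + s mod int p" using shift_cases[OF *(1,2)] by simp
    have "\<kappa> < \<kappa> + s mod int p" using s_mod by simp
    from W_diff_bounds[OF *(1) this True *(3,4), of t]
    show ?thesis unfolding *(5) k2 using *(1) True by auto
  next
    case False
    hence k2: "(\<kappa> + s) mod int p = \<kappa> + s mod int p - int p" using shift_cases[OF *(1,2)] by simp
    have lt: "0 \<le> \<kappa> + s mod int p - int p" "\<kappa> + s mod int p - int p < \<kappa>" using s_mod False by auto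
    from W_diff_bounds[OF lt *(2) *(3,4), of t]
    show ?thesis unfolding *(5) k2 using *(2) False by auto
  qed
  thus "- int \<sigma> - 1 \<le> c" "c \<le> int \<sigma> + 1"
    "c = - int \<sigma> - 1 \<Longrightarrow> s \<ge> 2 \<and> s mod int p < int p - int \<sigma>"
    "c = int \<sigma> + 1 \<Longrightarrow> s \<ge> 2 \<and> int \<sigma> < s mod int p" by blast+
qed

text \<open>The window at block \<open>\<sigma>\<close> is made the earlier of the two. It enters
  positively if block \<open>\<sigma> + s mod p\<close> is still below \<open>p\<close>, and
  negatively if it is the shifted one, coming from
  \<open>\<kappa> = \<sigma> + p - s mod p\<close>.\<close>

lemma coeff_attained:
  assumes M: "1 \<le> M" "M \<le> p" and rho: "0 \<le> \<rho>" "\<rho> < int q"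
  shows "s mod int p < int p - int \<sigma> \<Longrightarrow>
           \<exists>n. coeff (cyclotomic (p * q * r)) n = seg (start (int \<sigma>) \<rho>) 0 M"
    and "int \<sigma> < s mod int p \<Longrightarrow>
           \<exists>n. coeff (cyclotomic (p * q * r)) n = - seg (start (int \<sigma>) \<rho>) 0 M"
proof -
  define t where "t = start (int \<sigma>) \<rho> + s * (int M - 1)"
  have "1 * int q \<le> int \<sigma> * int q" using \<sigma>(1) by (intro mult_right_mono) auto
  hence "0 \<le> start (int \<sigma>) \<rho>" using qs(2) rho(1) by (simp add: start_def)
  moreover have "0 \<le> s * (int M - 1)" using s(1) M(1) by simp
  ultimately have t: "0 \<le> t" by (simp add: t_def)
  have M': "M \<le> nat (int p)" using M(2) by simp
  show "\<exists>n. coeff (cyclotomic (p * q * r)) n = seg (start (int \<sigma>) \<rho>) 0 M"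
    if "s mod int p < int p - int \<sigma>"
  proof -
    have k: "0 \<le> int \<sigma>" "int \<sigma> < int p" using \<sigma> by auto
    have "(int \<sigma> + s) mod int p = int \<sigma> + s mod int p" using shift_cases[OF k] that by simp
    moreover have "int \<sigma> < int \<sigma> + s mod int p" using s_mod by simp
    ultimately show ?thesis
      using W_as_coeff[OF k rho t] W_diff_prefix[OF M' _ t_def, of "int \<sigma> + s mod int p"] by simp
  qed
  show "\<exists>n. coeff (cyclotomic (p * q * r)) n = - seg (start (int \<sigma>) \<rho>) 0 M"
    if "int \<sigma> < s mod int p"
  proof -
    define \<kappa> where "\<kappa> = int \<sigma> + int p - s mod int p"
    have k: "0 \<le> \<kappa>" "\<kappa> < int p" using that s_mod by (auto simp: \<kappa>_def)
    have "(\<kappa> + s) mod int p = int \<sigma>" using shift_cases[OF k] \<sigma> by (simp add: \<kappa>_def)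
    moreover have "int \<sigma> < \<kappa>" using s_mod by (simp add: \<kappa>_def)
    ultimately show ?thesis
      using W_as_coeff[OF k rho t] W_diff_prefix[OF M' _ t_def, of \<kappa>] by simp
  qed
qed

text \<open>As \<open>2 * \<sigma> < p\<close>, at least one of the two signs in
  \<open>coeff_attained\<close> is available, and initial segments with sums \<open>\<sigma>\<close>
  and \<open>- \<sigma>\<close> both exist, so both values occur in any case.\<close>

lemma extreme_coeffs:
  shows "\<exists>n. coeff (cyclotomic (p * q * r)) n = int \<sigma>"
    and "\<exists>n. coeff (cyclotomic (p * q * r)) n = - int \<sigma>"
    and "s \<ge> 2 \<Longrightarrow> s mod int p < int p - int \<sigma> \<Longrightarrow> \<exists>n. coeff (cyclotomic (p * q * r)) n = - int \<sigma> - 1"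
    and "s \<ge> 2 \<Longrightarrow> int \<sigma> < s mod int p \<Longrightarrow> \<exists>n. coeff (cyclotomic (p * q * r)) n = int \<sigma> + 1"
proof -
  have M: "1 \<le> \<sigma>" "\<sigma> \<le> p" "1 \<le> Suc \<sigma>" "Suc \<sigma> \<le> p" using \<sigma> by auto
  have "int p \<le> s * int p" using mult_right_mono[of 1 s "int p"] s(1) by simp
  hence rho: "0 \<le> (0::int)" "0 < int q" "0 \<le> int p - 1" "int p - 1 < int q" using qs(2) pos by linarith+
  have "s * 1 \<le> s * int \<sigma>" using s(1) \<sigma>(1) by (intro mult_left_mono) auto
  hence "s * (int p - int \<sigma>) + 1 < int q" using qs(2) s(1) unfolding right_diff_distrib by linarith
  moreover have "0 \<le> s * (int p - int \<sigma>)" using s(1) \<sigma> by (intro mult_nonneg_nonneg) auto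
  ultimately have rho': "0 \<le> s * (int p - int \<sigma>) + 1" "s * (int p - int \<sigma>) + 1 < int q" by auto
  note A = coeff_attained[OF M(1,2) rho(1,2), unfolded extreme_seg(1)]
    and B = coeff_attained[OF M(1,2) rho(3,4), unfolded extreme_seg(2)]
    and C = coeff_attained[OF M(3,4) rho']
  have "s mod int p < int p - int \<sigma> \<or> int \<sigma> < s mod int p" using \<sigma>(2) by linarith
  thus "\<exists>n. coeff (cyclotomic (p * q * r)) n = int \<sigma>" "\<exists>n. coeff (cyclotomic (p * q * r)) n = - int \<sigma>"
    using A B by auto
  show "\<exists>n. coeff (cyclotomic (p * q * r)) n = - int \<sigma> - 1" if "s \<ge> 2" "s mod int p < int p - int \<sigma>"
    using C(1)[OF that(2)] extreme_seg(3)[OF that(1)] by simp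
  show "\<exists>n. coeff (cyclotomic (p * q * r)) n = int \<sigma> + 1" if "s \<ge> 2" "int \<sigma> < s mod int p"
    using C(2)[OF that(2)] unfolding extreme_seg(3)[OF that(1)] by (simp add: add.commute)
qed

theorem diameter_cyclotomic:
  "diameter (cyclotomic (p * q * r)) =
     2 * int \<sigma> + (if s \<ge> 2 then if int \<sigma> < s mod int p \<and> s mod int p < int p - int \<sigma> then 2 else 1 else 0)"
proof -
  define hi where "hi = int \<sigma> + (if s \<ge> 2 \<and> int \<sigma> < s mod int p then 1 else 0)"
  define lo where "lo = - int \<sigma> - (if s \<ge> 2 \<and> s mod int p < int p - int \<sigma> then 1 else 0)"
  have "\<exists>m. coeff (cyclotomic (p * q * r)) m = lo"
    using extreme_coeffs(2,3) by (cases "s \<ge> 2 \<and> s mod int p < int p - int \<sigma>") (auto simp: lo_def)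
  then obtain m where m: "coeff (cyclotomic (p * q * r)) m = lo" ..
  have "\<exists>n. coeff (cyclotomic (p * q * r)) n = hi"
    using extreme_coeffs(1,4) by (cases "s \<ge> 2 \<and> int \<sigma> < s mod int p") (auto simp: hi_def)
  then obtain n where n: "coeff (cyclotomic (p * q * r)) n = hi" ..
  have "diameter (cyclotomic (p * q * r)) = hi - lo"
  proof (rule diameter_eqI[OF _ _ m n])
    fix i
    show "lo \<le> coeff (cyclotomic (p * q * r)) i" "coeff (cyclotomic (p * q * r)) i \<le> hi"
      using coeff_bounds[of i] unfolding lo_def hi_def by (smt (verit))+
  qed (use \<sigma> in \<open>auto simp: lo_def hi_def\<close>)
  moreover have "s mod int p < int p - int \<sigma> \<or> int \<sigma> < s mod int p" using \<sigma>(2) by linarith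
  ultimately show ?thesis by (auto simp: hi_def lo_def)
qed

end

text \<open>The congruences for \<open>q\<close> and \<open>r\<close> prescribe units, so
  Dirichlet's theorem supplies arbitrarily large solutions: \<open>q\<close> congruent to
  \<open>s\<close> modulo \<open>p\<close>, then \<open>r\<close> to \<open>- 1 / s\<close> modulo
  \<open>p * q\<close>.\<close>

lemma arbitrarily_large_ternary_family:
  fixes p :: nat and s :: int
  assumes p: "prime p" and \<sigma>: "1 \<le> \<sigma>" "2 * \<sigma> + 1 \<le> p" and s: "1 \<le> s" "int p dvd s * int \<sigma> - 1"
    and D: "\<And>q r. ternary_family p q r s \<sigma> \<Longrightarrow> diameter (cyclotomic (p * q * r)) = d"
  shows "arbitrarily_large_primes p (\<lambda>q r. diameter (cyclotomic (p * q * r)) = d)"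
  unfolding arbitrarily_large_primes_def
proof (intro allI)
  fix B :: nat
  define S where "S = nat s"
  have S: "int S = s" using s(1) by (simp add: S_def)
  have "[s * int \<sigma> = 1] (mod int p)" using s(2) by (simp add: cong_iff_dvd_diff)
  hence cop_sp: "coprime s (int p)" using coprime_iff_invertible_int by blast
  hence "coprime S p" unfolding S[symmetric] by simp
  from infinite_primes_cong_prime_modulus[OF p this]
  \<comment> \<open>Exceeding \<open>S * p\<close> gives the block condition; exceeding
    \<open>S\<close> keeps \<open>q\<close> from dividing \<open>S\<close>.\<close>
  obtain q where q: "q > B + p + S * p + S" "prime q" "[q = S] (mod p)"
    unfolding infinite_nat_iff_unbounded by blast
  have "\<not> q dvd S" using q(1) s(1) S by (auto dest: dvd_imp_le)
  hence "coprime S q" using q(2) prime_imp_coprime coprime_commute by blast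
  hence cop: "coprime s (int p * int q)" using cop_sp unfolding S[symmetric] by simp
  obtain x where x: "[s * x = 1] (mod int p * int q)" using cong_solve_coprime_int[OF cop] by auto
  define b where "b = nat ((- x) mod (int p * int q))"
  have pq0: "int p * int q > 0" using p q(2) prime_gt_0_nat by simp
  have b: "[int b = - x] (mod int p * int q)" using pq0 by (simp add: b_def cong_def)
  have sb: "[s * int b = - 1] (mod int p * int q)"
    using cong_trans[OF cong_mult[OF cong_refl b, of s]] x by (simp add: cong_minus_minus_iff)
  have "coprime (int b) (int p * int q)"
  proof (rule coprimeI)
    fix d assume d: "d dvd int b" "d dvd int p * int q"
    have "int p * int q dvd s * int b + 1" using sb by (simp add: cong_iff_dvd_diff)
    hence "d dvd s * int b + 1" using d(2) dvd_trans by blast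
    thus "is_unit d" using d(1) dvd_add_right_iff[of d "s * int b" 1] by simp
  qed
  hence "coprime (int b) (int (p * q))" by simp
  hence "coprime b (p * q)" by (simp only: coprime_int_iff)
  moreover have "p \<noteq> q" using q(1) by simp
  ultimately obtain r where r: "r > p * q" "prime r" "[r = b] (mod p * q)"
    using infinite_primes_cong_semiprime_modulus[OF p q(2)] unfolding infinite_nat_iff_unbounded by blast
  have "q < r" using r(1) prime_gt_0_nat[OF p] by (metis less_trans le_less_trans mult.commute mult_le_mono2 mult_1_right Suc_leI One_nat_def)
  have fam: "ternary_family p q r s \<sigma>"
  proof unfold_locales
    show "prime p" "prime q" "prime r" "p < q" "q < r" "p * q < r"
      using p q(1,2) r(1,2) \<open>q < r\<close> by auto
    show "1 \<le> \<sigma>" "2 * \<sigma> + 1 \<le> p" "1 \<le> s" "int p dvd s * int \<sigma> - 1" by fact+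
    show "int p dvd int q - s"
      using q(3) unfolding S[symmetric] by (metis cong_iff_dvd_diff cong_int_iff)
    have "int (S * p) < int q" using q(1) by linarith
    thus "s * int p < int q" by (simp add: S)
    have "[int r * s = s * int b] (mod int p * int q)"
      using r(3) by (metis cong_int_iff cong_scalar_right mult.commute of_nat_mult)
    hence "[int r * s = - 1] (mod int p * int q)" using sb cong_trans by blast
    thus "int p * int q dvd int r * s + 1" by (simp add: cong_iff_dvd_diff)
  qed
  have "q > B" "q > p" using q(1) by auto
  thus "\<exists>q r. prime q \<and> prime r \<and> B < q \<and> p < q \<and> q < r \<and> diameter (cyclotomic (p * q * r)) = d"
    using q(2) r(2) \<open>q < r\<close> D[OF fam] by blast
qed

section \<open>Parameters for the four claims\<close>

lemma inverse_mod_prime: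
  fixes p \<sigma> :: nat
  assumes "prime p" "1 \<le> \<sigma>" "\<sigma> < p"
  obtains s :: int where "1 \<le> s" "s < int p" "int p dvd s * int \<sigma> - 1"
proof -
  have "\<not> p dvd \<sigma>" using assms(2,3) by (auto dest: dvd_imp_le)
  hence "coprime (int \<sigma>) (int p)" using prime_imp_coprime[OF assms(1)] coprime_commute by auto
  then obtain x where x: "[int \<sigma> * x = 1] (mod int p)" using cong_solve_coprime_int by blast
  define s where "s = x mod int p"
  have p1: "int p > 1" using prime_gt_1_nat[OF assms(1)] by simp
  have "[int \<sigma> * s = int \<sigma> * x] (mod int p)" by (intro cong_mult cong_refl) (simp add: s_def cong_def)
  hence "[int \<sigma> * s = 1] (mod int p)" using x cong_trans by blast
  hence dvd: "int p dvd s * int \<sigma> - 1" by (simp add: cong_iff_dvd_diff mult.commute)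
  have "s \<noteq> 0" using dvd p1 by auto
  moreover have "0 \<le> s" "s < int p" using p1 by (auto simp: s_def)
  ultimately show thesis using dvd by (intro that[of s]) auto
qed

theorem corollary7:
  fixes p :: nat
  assumes "prime p" and "odd p"
  shows
    "arbitrarily_large_primes p (\<lambda>q r. diameter (cyclotomic (p * q * r)) = 2) \<and>
     (\<forall>h::int. 3 \<le> h \<and> real_of_int h < sqrt (real p) \<longrightarrow>
        arbitrarily_large_primes p (\<lambda>q r. diameter (cyclotomic (p * q * r)) = 2 * h)) \<and>
     arbitrarily_large_primes p (\<lambda>q r. diameter (cyclotomic (p * q * r)) = int p) \<and>
     (\<forall>k::int. 1 \<le> k \<and> real_of_int k < sqrt (real p) / 2 - 1 \<longrightarrow>
        arbitrarily_large_primes p (\<lambda>q r. diameter (cyclotomic (p * q * r)) = int p - 2 * k))"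
proof (intro conjI allI impI)
  have p3: "p \<ge> 3" using prime_ge_2_nat[OF assms(1)] assms(2) by (cases "p = 2") auto
  \<comment> \<open>The exceptional case \<open>s = 1\<close>: both parameters are 1 and no surplus
    occurs.\<close>
  show "arbitrarily_large_primes p (\<lambda>q r. diameter (cyclotomic (p * q * r)) = 2)"
    by (rule arbitrarily_large_ternary_family[of p 1 1])
       (use assms p3 ternary_family.diameter_cyclotomic[of p _ _ 1 1] in auto)
  \<comment> \<open>The parameter \<open>s + p\<close> instead of \<open>s\<close> guarantees that it is at least \<open>2\<close>, even when \<open>p = 3\<close>.\<close>
  have odd_case: "arbitrarily_large_primes p (\<lambda>q r. diameter (cyclotomic (p * q * r)) = int p - 2 * k)"
    if k: "0 \<le> k" "k = 0 \<or> (2 * k + 2)\<^sup>2 < int p" for k :: int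
  proof -
    define \<sigma> where "\<sigma> = nat ((int p - 1) div 2 - k)"
    have "even (int p - 1)" using assms(2) by simp
    hence half: "2 * ((int p - 1) div 2) = int p - 1" by simp
    have "2 * k + 3 \<le> int p"
      using k p3 by (auto simp: power2_eq_square algebra_simps) (smt (verit) mult_nonneg_nonneg)
    hence \<sigma>: "2 * int \<sigma> + 1 = int p - 2 * k" "1 \<le> \<sigma>" using half by (auto simp: \<sigma>_def)
    have \<sigma>p: "2 * \<sigma> + 1 \<le> p" "\<sigma> < p" using \<sigma>(1) k(1) by auto
    obtain s :: int where s: "1 \<le> s" "s < int p" "int p dvd s * int \<sigma> - 1"
      using inverse_mod_prime[OF assms(1) \<sigma>(2) \<sigma>p(2)] .
    have "\<not> (int \<sigma> < s \<and> s < int p - int \<sigma>)"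
    proof
      assume as: "int \<sigma> < s \<and> s < int p - int \<sigma>"
      \<comment> \<open>\<open>u\<close> and \<open>2 * k + 1\<close> are congruent to
        \<open>2 * s\<close> and \<open>- 2 * \<sigma>\<close> modulo \<open>p\<close>, so
        \<open>p\<close> divides \<open>u * (2 * k + 1) + 4\<close>, which parity keeps from being
        0. For \<open>k = 0\<close> the range of \<open>u\<close> is empty.\<close>
      define u where "u = 2 * s - int p"
      have u: "1 - 2 * k \<le> u" "u \<le> 2 * k - 1" using as \<sigma>(1) by (auto simp: u_def)
      hence k1: "k \<ge> 1" by linarith
      have "u * (2 * k + 1) + 4 = int p * (2 * s - 1 - 2 * k) - 4 * (s * int \<sigma> - 1)"
      proof -
        have "2 * k + 1 = int p - 2 * int \<sigma>" using \<sigma>(1) by simp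
        hence k': "2 * k = int p - 2 * int \<sigma> - 1" by simp
        show ?thesis unfolding u_def k' by (simp add: algebra_simps)
      qed
      also have "int p dvd \<dots>" by (rule dvd_diff[OF dvd_triv_left dvd_mult[OF s(3)]])
      finally have dvd: "int p dvd u * (2 * k + 1) + 4" .
      have "odd u" using assms(2) by (simp add: u_def)
      hence "odd (u * (2 * k + 1) + 4)" by simp
      hence "u * (2 * k + 1) + 4 \<noteq> 0" by (metis even_zero)
      from dvd_imp_le_int[OF this dvd] have "int p \<le> \<bar>u * (2 * k + 1) + 4\<bar>" by simp
      also have "\<dots> \<le> \<bar>u\<bar> * (2 * k + 1) + 4" using k1 by (simp add: abs_mult abs_triangle_ineq[THEN order_trans])
      also have "\<dots> \<le> (2 * k - 1) * (2 * k + 1) + 4" using u k1 by (intro add_mono mult_right_mono) auto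
      \<comment> \<open>The value so far is \<open>4 * k ^ 2 + 3\<close>; the square on the right is
        what the bound on \<open>k\<close> controls.\<close>
      also have "\<dots> \<le> (2 * k + 2)\<^sup>2" using k1 by (simp add: power2_eq_square algebra_simps)
      also have "\<dots> < int p" using k k1 by auto
      finally show False by simp
    qed
    moreover have "(s + int p) mod int p = s" using s by simp
    moreover have "s + int p \<ge> 2" using s p3 by simp
    ultimately have "diameter (cyclotomic (p * q * r)) = int p - 2 * k" if "ternary_family p q r (s + int p) \<sigma>" for q r
      using ternary_family.diameter_cyclotomic[OF that] \<sigma>(1) by auto
    moreover have eq: "(s + int p) * int \<sigma> - 1 = (s * int \<sigma> - 1) + int p * int \<sigma>" by (simp add: algebra_simps)
    have "int p dvd (s + int p) * int \<sigma> - 1" unfolding eq by (intro dvd_add s(3) dvd_triv_left)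
    ultimately show ?thesis
      using s(1) by (intro arbitrarily_large_ternary_family[OF assms(1) \<sigma>(2) \<sigma>p(1), of "s + int p"]) auto
  qed
  show "arbitrarily_large_primes p (\<lambda>q r. diameter (cyclotomic (p * q * r)) = int p)"
    using odd_case[of 0] by simp
  show "arbitrarily_large_primes p (\<lambda>q r. diameter (cyclotomic (p * q * r)) = int p - 2 * k)"
    if "1 \<le> k \<and> real_of_int k < sqrt (real p) / 2 - 1" for k :: int
  proof (rule odd_case)
    have "real_of_int (2 * k + 2) < sqrt (real p)" "0 \<le> real_of_int (2 * k + 2)" using that by auto
    hence "(real_of_int (2 * k + 2))\<^sup>2 < (sqrt (real p))\<^sup>2" by (intro power_strict_mono) auto
    hence "real_of_int ((2 * k + 2)\<^sup>2) < real_of_int (int p)" by simp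
    hence "(2 * k + 2)\<^sup>2 < int p" by (simp only: of_int_less_iff)
    thus "k = 0 \<or> (2 * k + 2)\<^sup>2 < int p" by blast
  qed (use that in auto)
  show "arbitrarily_large_primes p (\<lambda>q r. diameter (cyclotomic (p * q * r)) = 2 * h)"
    if "3 \<le> h \<and> real_of_int h < sqrt (real p)" for h :: int
  proof -
    have h3: "h \<ge> 3" using that by simp
    have "(real_of_int h)\<^sup>2 < (sqrt (real p))\<^sup>2" using that by (intro power_strict_mono) auto
    hence "real_of_int (h\<^sup>2) < real_of_int (int p)" by simp
    hence h2: "h * h < int p" by (simp only: of_int_less_iff power2_eq_square)
    define \<sigma> where "\<sigma> = nat (h - 1)"
    have \<sigma>: "int \<sigma> = h - 1" "1 \<le> \<sigma>" using h3 by (auto simp: \<sigma>_def)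
    have "2 * h \<le> h * h" using h3 by (intro mult_right_mono) auto
    hence "2 * int \<sigma> + 1 \<le> int p" using h2 \<sigma>(1) by linarith
    hence \<sigma>p: "2 * \<sigma> + 1 \<le> p" "\<sigma> < p" by auto
    have sq: "int \<sigma> * int \<sigma> + 1 < int p" using h2 h3 by (simp add: \<sigma>(1) algebra_simps)
    obtain s :: int where s: "1 \<le> s" "s < int p" "int p dvd s * int \<sigma> - 1"
      using inverse_mod_prime[OF assms(1) \<sigma>(2) \<sigma>p(2)] .
    \<comment> \<open>If \<open>s \<le> \<sigma>\<close>, then \<open>s * \<sigma> - 1\<close> is a
      multiple of \<open>p\<close> below \<open>p\<close>, and it is positive because
      \<open>h \<ge> 3\<close> gives \<open>\<sigma> \<ge> 2\<close>.\<close>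
    have low: "int \<sigma> < s"
    proof (rule ccontr)
      assume "\<not> int \<sigma> < s"
      hence "s * int \<sigma> \<le> int \<sigma> * int \<sigma>" by (intro mult_right_mono) auto
      moreover have "1 * 2 \<le> s * int \<sigma>" using s(1) h3 \<sigma>(1) by (intro mult_mono) auto
      ultimately show False using zdvd_imp_le[OF s(3)] sq by linarith
    qed
    \<comment> \<open>Replacing \<open>s\<close> by \<open>p - s\<close> changes the sign:
      \<open>(p - s) * \<sigma> + 1\<close> would be a positive multiple of \<open>p\<close> of size
      at most \<open>\<sigma> * \<sigma> + 1 < p\<close>.\<close>
    have high: "s < int p - int \<sigma>"
    proof (rule ccontr)
      assume "\<not> s < int p - int \<sigma>"
      hence "(int p - s) * int \<sigma> \<le> int \<sigma> * int \<sigma>" by (intro mult_right_mono) auto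
      moreover have "0 \<le> (int p - s) * int \<sigma>" using s(2) by simp
      moreover have "(int p - s) * int \<sigma> + 1 = int p * int \<sigma> - (s * int \<sigma> - 1)" by (simp add: algebra_simps)
      hence "int p dvd (int p - s) * int \<sigma> + 1" using s(3) by (metis dvd_diff dvd_triv_left)
      ultimately show False using zdvd_imp_le[of "int p" "(int p - s) * int \<sigma> + 1"] sq by linarith
    qed
    have "s \<ge> 2" using low \<sigma>(2) by linarith
    moreover have "s mod int p = s" using s by simp
    ultimately have "diameter (cyclotomic (p * q * r)) = 2 * h" if "ternary_family p q r s \<sigma>" for q r
      using ternary_family.diameter_cyclotomic[OF that] low high \<sigma>(1) by auto
    thus ?thesis
      by (intro arbitrarily_large_ternary_family[OF assms(1) \<sigma>(2) \<sigma>p(1) s(1,3)]) auto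
  qed
qed

end
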